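(* Let $E=E(0,\infty)$ be a fully symmetric Banach space on the semi-axis $(0,\infty)$, equipped with a Fatou norm, such that $E(0,\infty)\subset L_1(0,\infty)$, and let $x\in E$. If $\varphi(y)\le\varphi(x)$ for every positive symmetric functional $\varphi$ on $E$ and every $0\le y\prec\prec x$, then $$\lim_{m\to\infty}\frac1m\|\sigma_m(\mu(x))\chi_{(0,1)}\|_E=0.$$
   Context: For a measurable function $x$ on $(0,\infty)$, $\mu(t,x)=\inf\{s\ge0:\ |\{|x|>s\}|\le t\}$ (Lebesgue measure) is its decreasing rearrangement; $y\prec\prec x$ means $\int_0^t\mu(s,y)ds\le\int_0^t\mu(s,x)ds$ for all $t\ge0$. A fully symmetric Banach space $E$ on $(0,\infty)$ is a Banach space of (real-valued) functions $E\subset(L_1+L_\infty)(0,\infty)$ such that $x\in E$, $y\in L_1+L_\infty$ and $y\prec\prec x$ imply $y\in E$ and $\|y\|_E\le\|x\|_E$. The norm on $E$ is a Fatou norm if the unit ball of $E$ is closed with respect to almost everywhere convergence (i.e. if $\|x_n\|_E\le1$ and $x_n\to x$ a.e., then $x\in E$ and $\|x\|_E\le1$). The dilation operator is $(\sigma_mx)(t)=x(t/m)$, $t>0$. A linear functional $\varphi$ on $E$ is symmetric if $\varphi(y)=\varphi(x)$ for all $0\le x,y\in E$ with $\mu(y)=\mu(x)$. *)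

theory Defs
  imports "HOL-Analysis.Analysis"
begin

text \<open>
  Function spaces on $(0,\infty)$ are represented by sets of functions of type
  \<^typ>\<open>real \<Rightarrow> real\<close>; values at arguments \<open>t \<le> 0\<close> are irrelevant. Functions equal almost everywhere
  on $(0,\infty)$ are not identified as terms; accordingly norms are only required to vanish exactly
  on the functions that are null a.e., and functionals have to respect equality a.e.
\<close>

abbreviation halfline :: "real measure"
  where "halfline \<equiv> lebesgue_on {0<..}"

definition L1 :: "(real \<Rightarrow> real) set"
  where "L1 = {x. integrable halfline x}"

definition Linf :: "(real \<Rightarrow> real) set"
  where "Linf = {x \<in> borel_measurable halfline. \<exists>C. AE t in halfline. \<bar>x t\<bar> \<le> C}"

definition L1_plus_Linf :: "(real \<Rightarrow> real) set"
  where "L1_plus_Linf = {x. \<exists>f\<in>L1. \<exists>g\<in>Linf. \<forall>t>0. x t = f t + g t}"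

text \<open>
  The infimum is taken in \<^typ>\<open>ennreal\<close>, so that it is \<open>\<infinity>\<close> when no admissible \<open>s\<close> exists
  (in particular \<open>\<mu>(0,x) = \<infinity>\<close> for essentially unbounded \<open>x\<close>). It is finite for
  \<open>x \<in> L1_plus_Linf\<close> and \<open>t > 0\<close>, where \<open>rearr\<close> is the same function with real values.
\<close>

definition mu :: "real \<Rightarrow> (real \<Rightarrow> real) \<Rightarrow> ennreal"
  where "mu t x =
    Inf {ennreal s | s. 0 \<le> s \<and> emeasure halfline {u \<in> {0<..}. s < \<bar>x u\<bar>} \<le> ennreal t}"

definition rearr :: "(real \<Rightarrow> real) \<Rightarrow> real \<Rightarrow> real"
  where "rearr x t = enn2real (mu t x)"

definition submajorized :: "(real \<Rightarrow> real) \<Rightarrow> (real \<Rightarrow> real) \<Rightarrow> bool"  (infix \<open>\<prec>\<prec>\<close> 50)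
  where "y \<prec>\<prec> x \<longleftrightarrow>
    (\<forall>t\<ge>0. (\<integral>\<^sup>+ s\<in>{0<..<t}. mu s y \<partial>lebesgue) \<le> (\<integral>\<^sup>+ s\<in>{0<..<t}. mu s x \<partial>lebesgue))"

definition dilation :: "real \<Rightarrow> (real \<Rightarrow> real) \<Rightarrow> real \<Rightarrow> real"
  where "dilation m x t = x (t / m)"

definition function_subspace :: "(real \<Rightarrow> real) set \<Rightarrow> bool"
  where "function_subspace E \<longleftrightarrow>
    E \<subseteq> L1_plus_Linf \<and>
    (\<lambda>t. 0) \<in> E \<and>
    (\<forall>x\<in>E. \<forall>y\<in>E. (\<lambda>t. x t + y t) \<in> E) \<and>
    (\<forall>c. \<forall>x\<in>E. (\<lambda>t. c * x t) \<in> E)"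

definition norm_on :: "(real \<Rightarrow> real) set \<Rightarrow> ((real \<Rightarrow> real) \<Rightarrow> real) \<Rightarrow> bool"
  where "norm_on E N \<longleftrightarrow>
    (\<forall>x\<in>E. 0 \<le> N x) \<and>
    (\<forall>x\<in>E. N x = 0 \<longleftrightarrow> (AE t in halfline. x t = 0)) \<and>
    (\<forall>c. \<forall>x\<in>E. N (\<lambda>t. c * x t) = \<bar>c\<bar> * N x) \<and>
    (\<forall>x\<in>E. \<forall>y\<in>E. N (\<lambda>t. x t + y t) \<le> N x + N y)"

definition complete_norm_on :: "(real \<Rightarrow> real) set \<Rightarrow> ((real \<Rightarrow> real) \<Rightarrow> real) \<Rightarrow> bool"
  where "complete_norm_on E N \<longleftrightarrow>
    (\<forall>X :: nat \<Rightarrow> real \<Rightarrow> real. (\<forall>n. X n \<in> E) \<longrightarrow>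
      (\<forall>e>0. \<exists>k. \<forall>m\<ge>k. \<forall>n\<ge>k. N (\<lambda>t. X m t - X n t) < e) \<longrightarrow>
      (\<exists>x\<in>E. (\<lambda>n. N (\<lambda>t. X n t - x t)) \<longlonglongrightarrow> 0))"

definition fully_symmetric_banach_space ::
    "(real \<Rightarrow> real) set \<Rightarrow> ((real \<Rightarrow> real) \<Rightarrow> real) \<Rightarrow> bool"
  where "fully_symmetric_banach_space E N \<longleftrightarrow>
    function_subspace E \<and> norm_on E N \<and> complete_norm_on E N \<and>
    (\<forall>x\<in>E. \<forall>y\<in>L1_plus_Linf. y \<prec>\<prec> x \<longrightarrow> y \<in> E \<and> N y \<le> N x)"

definition fatou_norm :: "(real \<Rightarrow> real) set \<Rightarrow> ((real \<Rightarrow> real) \<Rightarrow> real) \<Rightarrow> bool"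
  where "fatou_norm E N \<longleftrightarrow>
    (\<forall>(X :: nat \<Rightarrow> real \<Rightarrow> real) x. (\<forall>n. X n \<in> E \<and> N (X n) \<le> 1) \<longrightarrow>
      x \<in> borel_measurable halfline \<longrightarrow>
      (AE t in halfline. (\<lambda>n. X n t) \<longlonglongrightarrow> x t) \<longrightarrow> x \<in> E \<and> N x \<le> 1)"

definition nonneg_fun :: "(real \<Rightarrow> real) \<Rightarrow> bool"
  where "nonneg_fun x \<longleftrightarrow> (AE t in halfline. 0 \<le> x t)"

definition linear_functional_on :: "(real \<Rightarrow> real) set \<Rightarrow> ((real \<Rightarrow> real) \<Rightarrow> real) \<Rightarrow> bool"
  where "linear_functional_on E \<phi> \<longleftrightarrow>
    (\<forall>x\<in>E. \<forall>y\<in>E. (AE t in halfline. x t = y t) \<longrightarrow> \<phi> x = \<phi> y) \<and>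
    (\<forall>x\<in>E. \<forall>y\<in>E. \<phi> (\<lambda>t. x t + y t) = \<phi> x + \<phi> y) \<and>
    (\<forall>c. \<forall>x\<in>E. \<phi> (\<lambda>t. c * x t) = c * \<phi> x)"

definition positive_on :: "(real \<Rightarrow> real) set \<Rightarrow> ((real \<Rightarrow> real) \<Rightarrow> real) \<Rightarrow> bool"
  where "positive_on E \<phi> \<longleftrightarrow> (\<forall>x\<in>E. nonneg_fun x \<longrightarrow> 0 \<le> \<phi> x)"

definition symmetric_on :: "(real \<Rightarrow> real) set \<Rightarrow> ((real \<Rightarrow> real) \<Rightarrow> real) \<Rightarrow> bool"
  where "symmetric_on E \<phi> \<longleftrightarrow>
    (\<forall>x\<in>E. \<forall>y\<in>E. nonneg_fun x \<longrightarrow> nonneg_fun y \<longrightarrow> (\<forall>t>0. mu t y = mu t x) \<longrightarrow> \<phi> y = \<phi> x)"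

definition positive_symmetric_functional ::
    "(real \<Rightarrow> real) set \<Rightarrow> ((real \<Rightarrow> real) \<Rightarrow> real) \<Rightarrow> bool"
  where "positive_symmetric_functional E \<phi> \<longleftrightarrow>
    linear_functional_on E \<phi> \<and> positive_on E \<phi> \<and> symmetric_on E \<phi>"

end

theory Submission
  imports Defs
begin

text \<open>
  Write \<open>X(t)\<close> for the integral of \<open>mu s x\<close> over \<open>0 < s < t\<close>, and \<open>Y\<close>, \<open>W\<close>, \<dots> for the corresponding
  functions of \<open>y\<close>, \<open>w\<close>, \<dots>. Submajorization \<open>y \<prec>\<prec> x\<close> is \<open>Y \<le> X\<close>, the norm of \<open>E\<close> is monotone in these
  functions, and the function of the dilate \<open>1/m \<sigma>_m mu(x)\<close> is \<open>X(t/m)\<close>. Assume that the norms of these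
  dilates, cut to \<open>(0,1)\<close>, do not tend to 0. The proof constructs a single \<open>y \<prec>\<prec> x\<close> for which
  \<open>\<phi>(y) \<le> \<phi>(x)\<close> cannot hold for all positive symmetric \<open>\<phi>\<close>.

  What the functionals give. Let \<open>p(u)\<close> be the infimum of the norms of those \<open>w\<close> with \<open>u \<le> w + P - Q\<close>, where
  \<open>(P, Q)\<close> ranges over pairs that behave like \<open>(\<Sum> u\<^sub>i, \<Sum> v\<^sub>i)\<close> with \<open>u\<^sub>i\<close> and \<open>v\<^sub>i\<close> equimeasurable. A linear
  functional below \<open>p\<close> is positive and symmetric, so by the Hahn-Banach theorem the hypothesis yields
  \<open>p(y - x) \<le> 0\<close>: there are \<open>w\<close> of arbitrarily small norm and such \<open>P, Q\<close> with \<open>y \<le> x + w + P - Q\<close>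
  (\<open>approximate_domination\<close>). The functions of \<open>P\<close> and \<open>Q\<close> agree up to dilation by a constant \<open>K\<close>. If one
  compares increments of the functions between \<open>a\<close> and \<open>b\<close> and sums over the scales \<open>a/L^j\<close>, \<open>b/L^j\<close> with \<open>j < n\<close>
  and \<open>L = K + 1\<close>, the contribution of \<open>P\<close> and \<open>Q\<close> telescopes: it stays bounded while the other terms
  accumulate \<open>n\<close> times (\<open>balanced_average\<close>). Hence, for large \<open>n\<close>, the defect \<open>X - Y\<close> averaged over \<open>n\<close> scales
  below \<open>a\<close> exceeds its average over \<open>n\<close> scales below \<open>b\<close> by at most a multiple of \<open>W(b)\<close>, up to small errors.

  How \<open>y\<close> contradicts this. Averaging \<open>mu(x)\<close> over an interval \<open>(c,b)\<close> replaces \<open>X\<close> by its chord there. If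
  \<open>X(c)\<close> and \<open>X(b)/M\<close> are small compared with \<open>X(b/M\<^sup>2)\<close>, the defect is at least \<open>X(b/M\<^sup>2)/2\<close> between
  \<open>b/M\<^sup>2\<close> and \<open>b/M\<close>, and it vanishes between \<open>b\<close> and \<open>M b\<close> when no other interval meets that range. Therefore
  \<open>8 W(M b) \<ge> X(b/M\<^sup>2)\<close>, up to small errors (\<open>domination_at_scale\<close>). The points \<open>b\<close> are chosen greedily, from small
  scales to large ones, so that these bounds at sparse points imply \<open>X(t/M^5) \<le> \<delta> X(t) + (64/\<delta>) W(t)\<close>, with
  the same small errors, on a whole range of scales (\<open>greedy_scales\<close>). Scales where \<open>X(t/M\<^sup>2)\<close> is negligible against
  \<open>X(M t)\<close> are absorbed by the term \<open>\<delta> X\<close>.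
  The greedy choice needs a smallest scale to start from. The Fatou property provides it: a dilate set to
  0 on a sufficiently short interval \<open>(0,a]\<close> still has more than half of the given norm bound (\<open>Fatou_cut\<close>). Since \<open>K\<close> depends on
  \<open>y\<close> and on the norm of \<open>w\<close>, one uses countably many such ranges, with \<open>M\<close> tending to infinity
  (\<open>scale_block_sequence\<close>). On the range with \<open>M \<ge> L^n\<close> the norm of the dilate is then at most a small
  constant plus a multiple of the norm of \<open>w\<close>, which is a contradiction (\<open>norm_cut_dilate_small\<close>).
\<close>

section \<open>Integrals of decreasing rearrangements\<close>

definition kyfan :: "(real \<Rightarrow> real) \<Rightarrow> real \<Rightarrow> real"
  where "kyfan u t = enn2real (\<integral>\<^sup>+ s\<in>{0<..<t}. mu s u \<partial>lebesgue)"

text \<open>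
  The two functions are linked by \<open>kyfan u t = inf\<^sub>s (excess u s + s t)\<close>, the formula for the K-functional of the
  couple \<open>(L\<^sub>1, L\<^sub>\<infinity>)\<close>. It reduces the calculus of \<open>kyfan\<close> to pointwise inequalities for truncated
  functions. The value is an extended real because negative differences are truncated to 0 there.
\<close>

definition excess :: "(real \<Rightarrow> real) \<Rightarrow> real \<Rightarrow> ennreal"
  where "excess u s = (\<integral>\<^sup>+ t. ennreal (\<bar>u t\<bar> - s) \<partial>halfline)"

definition distribution :: "(real \<Rightarrow> real) \<Rightarrow> real \<Rightarrow> ennreal"
  where "distribution u s = emeasure halfline {t \<in> {0<..}. s < \<bar>u t\<bar>}"

lemma sigma_finite_halfline: "sigma_finite_measure halfline"
proof -
  have s: "{0<..real n} \<in> sets halfline" for n :: nat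
    by (subst sets_restrict_space_iff) auto
  have 0: "emeasure halfline {0<..real n} = ennreal (real n)" for n :: nat
    by (subst emeasure_restrict_space) (auto simp: )
  show ?thesis
  proof (standard, intro exI[of _ "range (\<lambda>n::nat. {0<..real n})"] conjI ballI)
    show "\<Union> (range (\<lambda>n::nat. {0<..real n})) = space halfline"
      by (auto simp: real_arch_simple)
  qed (use s 0 in \<open>auto simp: \<close>)
qed

lemma distribution_sets:
  fixes u :: "real \<Rightarrow> real"
  assumes "u \<in> borel_measurable halfline"
  shows "{t \<in> {0<..}. s < \<bar>u t\<bar>} \<in> sets halfline"
proof -
  have "{t \<in> space halfline. s < \<bar>u t\<bar>} \<in> sets halfline"
    using borel_measurable_less[OF borel_measurable_const[of s] borel_measurable_abs[OF assms]] by simp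
  thus ?thesis by simp
qed

lemma distribution_mono:
  assumes "u \<in> borel_measurable halfline" "s \<le> s'"
  shows "distribution u s' \<le> distribution u s"
  unfolding distribution_def
  by (rule emeasure_mono) (use assms distribution_sets[OF assms(1)] in auto)

text \<open>
  The layer cake formula. It shows that \<open>excess\<close> depends only on the distribution function, and hence
  is the same for a function and its rearrangement.
\<close>

lemma excess_eq_distribution_integral:
  assumes u: "u \<in> borel_measurable halfline" and s: "0 \<le> s"
  shows "excess u s = (\<integral>\<^sup>+ r. indicator {s<..} r * distribution u r \<partial>lborel)"
proof -
  interpret H: sigma_finite_measure halfline by (rule sigma_finite_halfline)
  interpret P: pair_sigma_finite halfline lborel ..
  note u[measurable]
  have "excess u s = (\<integral>\<^sup>+ t. (\<integral>\<^sup>+ r. indicator {s<..} r * indicator {r. r < \<bar>u t\<bar>} r \<partial>lborel) \<partial>halfline)"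
    unfolding excess_def
  proof (rule nn_integral_cong)
    fix t
    have "(\<integral>\<^sup>+ r. indicator {s<..} r * indicator {r. r < \<bar>u t\<bar>} r \<partial>lborel)
       = (\<integral>\<^sup>+ r. indicator {s<..<\<bar>u t\<bar>} r \<partial>lborel)"
      by (rule nn_integral_cong) (auto simp: indicator_def)
    also have "\<dots> = ennreal (\<bar>u t\<bar> - s)"
      by (cases "s \<le> \<bar>u t\<bar>") (auto simp: ennreal_neg)
    finally show "ennreal (\<bar>u t\<bar> - s) = (\<integral>\<^sup>+ r. indicator {s<..} r * indicator {r. r < \<bar>u t\<bar>} r \<partial>lborel)" by simp
  qed
  also have "\<dots> = (\<integral>\<^sup>+ r. (\<integral>\<^sup>+ t. indicator {s<..} r * indicator {r. r < \<bar>u t\<bar>} r \<partial>halfline) \<partial>lborel)"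
    by (rule P.Fubini'[symmetric]) measurable
  also have "\<dots> = (\<integral>\<^sup>+ r. indicator {s<..} r * distribution u r \<partial>lborel)"
  proof (rule nn_integral_cong)
    fix r
    have "(\<integral>\<^sup>+ t. indicator {s<..} r * indicator {r. r < \<bar>u t\<bar>} r \<partial>halfline)
      = indicator {s<..} r * (\<integral>\<^sup>+ t. indicator {r. r < \<bar>u t\<bar>} r \<partial>halfline)"
      by (rule nn_integral_cmult) measurable
    also have "(\<integral>\<^sup>+ t. indicator {r. r < \<bar>u t\<bar>} r \<partial>halfline) = 
       (\<integral>\<^sup>+ t. indicator {t\<in>{0<..}. r < \<bar>u t\<bar>} t \<partial>halfline)"
      by (rule nn_integral_cong) (auto simp: indicator_def)
    also have "\<dots> = distribution u r"
      unfolding distribution_def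
      by (rule nn_integral_indicator) (rule distribution_sets[OF u])
    finally show "(\<integral>\<^sup>+ t. indicator {s<..} r * indicator {r. r < \<bar>u t\<bar>} r \<partial>halfline) = indicator {s<..} r * distribution u r" .
  qed
  finally show ?thesis .
qed

lemma mu_le:
  assumes "0 \<le> s" "distribution u s \<le> ennreal t" 
  shows "mu t u \<le> ennreal s"
  unfolding mu_def using assms unfolding distribution_def by (intro Inf_lower) auto

text \<open>
  The rearrangement is the right-continuous inverse of the distribution function. Right continuity
  of the distribution function, that is, continuity of the measure from below, gives the
  implication from right to left.
\<close>

lemma less_mu_iff:
  assumes u: "u \<in> borel_measurable halfline" and r: "0 \<le> r"
  shows "ennreal r < mu t u \<longleftrightarrow> ennreal t < distribution u r"
proof
  show "ennreal r < mu t u \<Longrightarrow> ennreal t < distribution u r"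
    using mu_le[OF r, of u t] by (meson leD leI)
next
  assume lt: "ennreal t < distribution u r"
  define A where "A n = {x \<in> {0<..}. r + 1 / real (Suc n) < \<bar>u x\<bar>}" for n
  have "(\<Union>n. A n) = {t \<in> {0<..}. r < \<bar>u t\<bar>}"
  proof (intro equalityI subsetI)
    fix x assume "x \<in> {t \<in> {0<..}. r < \<bar>u t\<bar>}"
    hence x: "0 < x" "0 < \<bar>u x\<bar> - r" by auto
    obtain n where "1 / real (Suc n) < \<bar>u x\<bar> - r"
      using reals_Archimedean[OF x(2)] by (auto simp: inverse_eq_divide)
    thus "x \<in> (\<Union>n. A n)" using x unfolding A_def by (auto intro!: exI[of _ n])
  next
    fix x assume "x \<in> (\<Union>n. A n)"
    then obtain n where "x > 0" "r + 1 / real (Suc n) < \<bar>u x\<bar>" unfolding A_def by auto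
    moreover have "0 \<le> 1 / real (Suc n)" by simp
    ultimately show "x \<in> {t \<in> {0<..}. r < \<bar>u t\<bar>}" by (smt (verit) greaterThan_iff mem_Collect_eq)
  qed
  moreover have "(SUP n. emeasure halfline (A n)) = emeasure halfline (\<Union>n. A n)"
  proof (rule SUP_emeasure_incseq)
    show "range A \<subseteq> sets halfline" unfolding A_def using distribution_sets[OF u] by auto
    show "incseq A"
    proof (rule incseq_SucI, rule subsetI)
      fix n x assume "x \<in> A n"
      moreover have "1 / real (Suc (Suc n)) \<le> 1 / real (Suc n)" by (simp add: field_simps)
      ultimately show "x \<in> A (Suc n)" unfolding A_def
        by (smt (verit) mem_Collect_eq)
    qed
  qed
  ultimately have "distribution u r = (SUP n. emeasure halfline (A n))"
    unfolding distribution_def by simp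
  with lt obtain n where n: "ennreal t < emeasure halfline (A n)" by (auto simp: less_SUP_iff)
  let ?r = "r + 1 / real (Suc n)"
  have r': "ennreal r < ennreal ?r" using r by (intro ennreal_lessI) (auto intro: add_nonneg_pos)
  have "ennreal ?r \<le> mu t u" unfolding mu_def
  proof (rule Inf_greatest)
    fix v assume "v \<in> {ennreal s |s. 0 \<le> s \<and> emeasure halfline {x \<in> {0<..}. s < \<bar>u x\<bar>} \<le> ennreal t}"
    then obtain s where s: "0 \<le> s" "emeasure halfline {x \<in> {0<..}. s < \<bar>u x\<bar>} \<le> ennreal t" and v: "v = ennreal s"
      by auto
    show "ennreal ?r \<le> v" unfolding v
    proof (rule ccontr)
      assume "\<not> ennreal ?r \<le> ennreal s"
      hence "ennreal s < ennreal ?r" by (simp add: not_le)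
      hence "s \<le> ?r" using s(1) by (simp add: ennreal_less_iff)
      hence "distribution u ?r \<le> distribution u s" by (intro distribution_mono u)
      thus False using s(2) n unfolding A_def distribution_def by auto
    qed
  qed
  with r' show "ennreal r < mu t u" by simp
qed

lemma mu_antimono: "t \<le> t' \<Longrightarrow> mu t' u \<le> mu t u"
  unfolding mu_def by (intro Inf_superset_mono) (blast intro: order_trans ennreal_leI)

lemma L1_measurable: "u \<in> L1 \<Longrightarrow> u \<in> borel_measurable halfline"
  unfolding L1_def by auto

lemma excess_0: "excess u 0 = (\<integral>\<^sup>+ t. ennreal \<bar>u t\<bar> \<partial>halfline)"
  unfolding excess_def by simp

lemma excess_antimono: "s \<le> s' \<Longrightarrow> excess u s' \<le> excess u s"
  unfolding excess_def by (intro nn_integral_mono ennreal_leI) auto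

lemma excess_finite:
  assumes "u \<in> L1" "0 \<le> s" shows "excess u s < \<infinity>"
proof -
  have "excess u s \<le> excess u 0" by (rule excess_antimono) (rule assms)
  also have "\<dots> < \<infinity>" using assms unfolding excess_0 L1_def integrable_iff_bounded by simp
  finally show ?thesis .
qed

lemma distribution_tail:
  assumes "u \<in> L1" "0 < s"
  shows "ennreal s * distribution u s \<le> excess u 0"
proof -
  have "ennreal s * distribution u s = (\<integral>\<^sup>+ t. ennreal s * indicator {t\<in>{0<..}. s < \<bar>u t\<bar>} t \<partial>halfline)"
    unfolding distribution_def
    by (rule nn_integral_cmult_indicator[symmetric]) (intro distribution_sets L1_measurable assms)
  also have "\<dots> \<le> excess u 0" unfolding excess_0
    by (rule nn_integral_mono) (auto simp: indicator_def intro: ennreal_leI)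
  finally show ?thesis .
qed

text \<open>
  By Chebyshev's inequality the distribution function of an integrable function drops below any
  \<open>t > 0\<close> at a finite level.
\<close>

lemma mu_finite:
  assumes u: "u \<in> L1" and t: "0 < t"
  shows "mu t u < \<infinity>"
proof -
  obtain B where B: "excess u 0 = ennreal B" "0 \<le> B" using excess_finite[OF u, of 0] by (cases "excess u 0") auto
  define s where "s = B / t + 1"
  have s: "0 < s" using B t unfolding s_def by (auto intro: add_nonneg_pos)
  have "ennreal s * distribution u s \<le> ennreal B" using distribution_tail[OF u s] B by simp
  hence "distribution u s < \<infinity>" using s by (auto simp: less_top[symmetric] ennreal_mult_eq_top_iff top_unique)
  then obtain d where d: "distribution u s = ennreal d" "0 \<le> d" by (cases "distribution u s") auto
  have "s * d \<le> B" using \<open>ennreal s * distribution u s \<le> ennreal B\<close> d s B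
    by (simp add: ennreal_mult[symmetric])
  moreover have "s * t = B + t" using t unfolding s_def by (simp add: field_simps)
  ultimately have "s * d \<le> s * t" using t by linarith
  hence "d \<le> t" using s by simp
  hence "mu t u \<le> ennreal s" using d s by (intro mu_le) (auto intro: ennreal_leI)
  also have "ennreal s < \<infinity>" by simp
  finally show ?thesis .
qed

lemma ennreal_rearr: "u \<in> L1 \<Longrightarrow> 0 < t \<Longrightarrow> ennreal (rearr u t) = mu t u"
  unfolding rearr_def using mu_finite[of u t] by simp

lemma rearr_nonneg: "0 \<le> rearr u t"
  unfolding rearr_def by simp

lemma rearr_antimono: "u \<in> L1 \<Longrightarrow> 0 < t \<Longrightarrow> t \<le> t' \<Longrightarrow> rearr u t' \<le> rearr u t"
  using mu_antimono[of t t' u] ennreal_rearr[of u t] ennreal_rearr[of u t'] rearr_nonneg[of u t]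
  by (smt (verit) ennreal_le_iff)

lemma antimono_on_measurable:
  fixes f :: "real \<Rightarrow> real"
  assumes "\<And>t t'. 0 < t \<Longrightarrow> t \<le> t' \<Longrightarrow> f t' \<le> f t"
  shows "f \<in> borel_measurable (restrict_space borel {0<..})" 
    and "f \<in> borel_measurable halfline"
proof -
  have "(\<lambda>t. - f t) \<in> borel_measurable (restrict_space borel {0<..})"
    by (rule borel_measurable_mono_on_fnc) (use assms in \<open>auto simp: mono_on_def\<close>)
  thus 1: "f \<in> borel_measurable (restrict_space borel {0<..})" by simp
  have "f \<in> borel_measurable (lebesgue_on {0<..}) \<longleftrightarrow> (\<lambda>t. f t * indicator {0<..} t) \<in> borel_measurable lebesgue"
    using borel_measurable_restrict_space_iff[of "{0<..}" lebesgue f]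
    by (simp add: mult.commute)
  moreover have "(\<lambda>t. f t * indicator {0<..} t) \<in> borel_measurable borel"
    using 1 borel_measurable_restrict_space_iff[of "{0<..}" borel f]
    by (simp add: mult.commute)
  hence "(\<lambda>t. f t * indicator {0<..} t) \<in> borel_measurable lborel" by simp
  hence "(\<lambda>t. f t * indicator {0<..} t) \<in> borel_measurable lebesgue" by (rule measurable_completion)
  ultimately show "f \<in> borel_measurable halfline" by simp
qed

lemma rearr_measurable: "u \<in> L1 \<Longrightarrow> rearr u \<in> borel_measurable halfline"
  by (rule antimono_on_measurable(2)) (rule rearr_antimono)

text \<open>
  The set where the rearrangement exceeds \<open>r\<close> is an interval starting at 0 whose length is the value of
  the distribution function of \<open>u\<close>.
\<close>

lemma distribution_rearr:
  assumes u: "u \<in> L1" and r: "0 \<le> r"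
  shows "distribution (rearr u) r = distribution u r"
proof -
  have eq: "{t \<in> {0<..}. r < \<bar>rearr u t\<bar>} = {t \<in> {0<..}. ennreal t < distribution u r}"
  proof (intro Collect_cong conj_cong refl)
    fix t :: real assume "t \<in> {0<..}"
    thus "r < \<bar>rearr u t\<bar> \<longleftrightarrow> ennreal t < distribution u r"
      using less_mu_iff[OF L1_measurable[OF u] r, of t] ennreal_rearr[OF u, of t] rearr_nonneg[of u t] r
      by (metis abs_of_nonneg ennreal_less_iff greaterThan_iff)
  qed
  show ?thesis
  proof (cases "distribution u r")
    case (real d)
    hence "{t \<in> {0<..}. ennreal t < distribution u r} = {0<..<d}" by (auto simp: ennreal_less_iff)
    moreover have "emeasure halfline {0<..<d} = ennreal d" 
      using real by (subst emeasure_restrict_space) auto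
    ultimately show ?thesis using real eq unfolding distribution_def[of "rearr u"] by simp
  next
    case top
    hence "{t \<in> {0<..}. ennreal t < distribution u r} = {0<..}" by auto
    moreover have "emeasure halfline {0<..} = \<infinity>"
    proof (cases "emeasure halfline {0<..}")
      case (real d)
      have "ennreal (d + 1) = emeasure halfline {0<..<d + 1}"
        using real by (subst emeasure_restrict_space) auto
      also have "\<dots> \<le> emeasure halfline {0<..}" by (rule emeasure_mono) (auto simp: sets_restrict_space_iff)
      finally show ?thesis using real by (auto simp: ennreal_le_iff)
    qed auto
    ultimately show ?thesis using top eq unfolding distribution_def[of "rearr u"] by simp
  qed
qed

lemma excess_rearr:
  assumes u: "u \<in> L1" and s: "0 \<le> s"
  shows "excess (rearr u) s = excess u s"
  unfolding excess_eq_distribution_integral[OF rearr_measurable[OF u] s] excess_eq_distribution_integral[OF L1_measurable[OF u] s]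
  by (rule nn_integral_cong) (use s distribution_rearr[OF u] in \<open>auto simp: indicator_def\<close>)

lemma rearr_L1: "u \<in> L1 \<Longrightarrow> rearr u \<in> L1"
  using rearr_measurable[of u] excess_rearr[of u 0] excess_finite[of u 0]
  unfolding L1_def integrable_iff_bounded excess_0 by simp

lemma nn_integral_Ioo_halfline:
  "(\<integral>\<^sup>+ s\<in>{0<..<t}. f s \<partial>lebesgue) = (\<integral>\<^sup>+ s. f s * indicator {0<..<t} s \<partial>halfline)"
  by (subst nn_integral_restrict_space) (auto intro!: nn_integral_cong simp: indicator_def)

lemma mu_integral_eq:
  assumes u: "u \<in> L1"
  shows "(\<integral>\<^sup>+ s\<in>{0<..<t}. mu s u \<partial>lebesgue) = (\<integral>\<^sup>+ s. ennreal (rearr u s) * indicator {0<..<t} s \<partial>halfline)"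
  unfolding nn_integral_Ioo_halfline
  by (rule nn_integral_cong) (use ennreal_rearr[OF u] in \<open>auto simp: indicator_def\<close>)

lemma nn_integral_Ioo_le_excess:
  assumes f: "f \<in> L1" and s: "0 \<le> s" and t: "0 \<le> t"
  shows "(\<integral>\<^sup>+ r. ennreal \<bar>f r\<bar> * indicator {0<..<t} r \<partial>halfline) \<le> excess f s + ennreal (s * t)"
proof -
  note [measurable] = L1_measurable[OF f]
  have [measurable]: "{0<..<t} \<in> sets halfline" by (subst sets_restrict_space_iff) auto
  have "(\<integral>\<^sup>+ r. ennreal \<bar>f r\<bar> * indicator {0<..<t} r \<partial>halfline)
      \<le> (\<integral>\<^sup>+ r. ennreal (\<bar>f r\<bar> - s) + ennreal s * indicator {0<..<t} r \<partial>halfline)"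
  proof (rule nn_integral_mono)
    fix r
    have "ennreal \<bar>f r\<bar> \<le> ennreal (\<bar>f r\<bar> - s) + ennreal s"
    proof (cases "s \<le> \<bar>f r\<bar>")
      case True thus ?thesis using s by (subst ennreal_plus[symmetric]) auto
    next
      case False thus ?thesis using s by (auto intro!: ennreal_leI simp: ennreal_neg)
    qed
    thus "ennreal \<bar>f r\<bar> * indicator {0<..<t} r \<le> ennreal (\<bar>f r\<bar> - s) + ennreal s * indicator {0<..<t} r"
      by (auto simp: indicator_def)
  qed
  also have "\<dots> = excess f s + ennreal s * emeasure halfline {0<..<t}"
    unfolding excess_def by (subst nn_integral_add) (auto simp: nn_integral_cmult_indicator)
  also have "emeasure halfline {0<..<t} = ennreal t" using t by (subst emeasure_restrict_space) auto
  finally show ?thesis using s t by (simp add: ennreal_mult)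
qed

lemma mu_integral_le:
  assumes u: "u \<in> L1" and s: "0 \<le> s" and t: "0 \<le> t"
  shows "(\<integral>\<^sup>+ r\<in>{0<..<t}. mu r u \<partial>lebesgue) \<le> excess u s + ennreal (s * t)"
  using nn_integral_Ioo_le_excess[OF rearr_L1[OF u] s t] excess_rearr[OF u s] mu_integral_eq[OF u, of t]
  by (simp add: rearr_nonneg)

lemma ennreal_kyfan:
  assumes u: "u \<in> L1" and t: "0 \<le> t"
  shows "ennreal (kyfan u t) = (\<integral>\<^sup>+ r\<in>{0<..<t}. mu r u \<partial>lebesgue)"
  unfolding kyfan_def
proof (rule ennreal_enn2real)
  show "(\<integral>\<^sup>+ r\<in>{0<..<t}. mu r u \<partial>lebesgue) < top"
    using mu_integral_le[OF u, of 0 t] excess_finite[OF u, of 0] t by auto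
qed

text \<open>
  The level \<open>s = mu t u\<close> is optimal: before \<open>t\<close> the rearrangement lies above it and after \<open>t\<close> below it, so
  that truncating at \<open>s\<close> loses exactly \<open>s t\<close>.
\<close>

lemma mu_integral_attained:
  assumes u: "u \<in> L1" and t: "0 < t"
  shows "(\<integral>\<^sup>+ r\<in>{0<..<t}. mu r u \<partial>lebesgue) = excess u (rearr u t) + ennreal (rearr u t * t)"
proof -
  let ?s = "rearr u t"
  note [measurable] = rearr_measurable[OF u]
  have [measurable]: "{0<..<t} \<in> sets halfline" by (subst sets_restrict_space_iff) auto
  have "excess u ?s + ennreal (?s * t) = excess (rearr u) ?s + ennreal ?s * emeasure halfline {0<..<t}"
    using t by (subst emeasure_restrict_space) (auto simp: excess_rearr[OF u rearr_nonneg] ennreal_mult rearr_nonneg)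
  also have "\<dots> = (\<integral>\<^sup>+ r. ennreal (\<bar>rearr u r\<bar> - ?s) + ennreal ?s * indicator {0<..<t} r \<partial>halfline)"
    unfolding excess_def by (subst nn_integral_add) (auto simp: nn_integral_cmult_indicator)
  also have "\<dots> = (\<integral>\<^sup>+ r. ennreal (rearr u r) * indicator {0<..<t} r \<partial>halfline)"
  proof (rule nn_integral_cong)
    fix r assume "r \<in> space halfline"
    hence r: "0 < r" by simp
    show "ennreal (\<bar>rearr u r\<bar> - ?s) + ennreal ?s * indicator {0<..<t} r = ennreal (rearr u r) * indicator {0<..<t} r"
    proof (cases "r < t")
      case True
      thus ?thesis using r rearr_antimono[OF u r, of t] rearr_nonneg[of u]
        by (simp add: ennreal_plus[symmetric] del: ennreal_plus)
    next
      case False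
      thus ?thesis using t rearr_antimono[OF u t, of r] rearr_nonneg[of u]
        by (simp add: ennreal_neg)
    qed
  qed
  finally show ?thesis using mu_integral_eq[OF u, of t] by simp
qed

lemma kyfan_le:
  assumes "u \<in> L1" "0 \<le> s" "0 \<le> t"
  shows "ennreal (kyfan u t) \<le> excess u s + ennreal (s * t)"
  using mu_integral_le[OF assms] ennreal_kyfan[OF assms(1,3)] by simp

lemma kyfan_attained:
  assumes "u \<in> L1" "0 < t"
  obtains s where "0 \<le> s" "ennreal (kyfan u t) = excess u s + ennreal (s * t)"
  using mu_integral_attained[OF assms] ennreal_kyfan[of u t] assms rearr_nonneg[of u t] by auto

lemma ennreal_le_ennrealD: "ennreal a \<le> ennreal b \<Longrightarrow> 0 \<le> b \<Longrightarrow> a \<le> b"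
  by (simp add: ennreal_le_iff)

lemma kyfan_nonneg [simp]: "0 \<le> kyfan u t"
  unfolding kyfan_def by simp

lemma kyfan_nonpos [simp]: "t \<le> 0 \<Longrightarrow> kyfan u t = 0"
  unfolding kyfan_def by simp

lemma kyfan_cong: "(\<And>t. 0 < t \<Longrightarrow> mu t u = mu t v) \<Longrightarrow> kyfan u t = kyfan v t"
  unfolding kyfan_def by (intro arg_cong[where f=enn2real] nn_integral_cong) (auto simp: indicator_def)

lemma kyfan_mono:
  assumes "u \<in> L1" "t \<le> t'"
  shows "kyfan u t \<le> kyfan u t'"
proof (cases "t \<le> 0")
  case False
  have "ennreal (kyfan u t) \<le> ennreal (kyfan u t')"
    unfolding ennreal_kyfan[OF assms(1) less_imp_le[OF False[unfolded not_le]]]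
    using assms False
    by (subst ennreal_kyfan) (auto intro!: nn_integral_mono simp: indicator_def)
  thus ?thesis by simp
qed simp

lemma submajorized_iff_kyfan:
  assumes "u \<in> L1" "v \<in> L1"
  shows "v \<prec>\<prec> u \<longleftrightarrow> (\<forall>t\<ge>0. kyfan v t \<le> kyfan u t)"
proof -
  have "ennreal (kyfan v t) \<le> ennreal (kyfan u t) \<longleftrightarrow> kyfan v t \<le> kyfan u t" for t by simp
  thus ?thesis unfolding submajorized_def using ennreal_kyfan[OF assms(1)] ennreal_kyfan[OF assms(2)] by metis
qed

lemma kyfan_le_if_excess_le:
  assumes "u \<in> L1" "v \<in> L1" "\<And>s. 0 \<le> s \<Longrightarrow> excess v s \<le> excess u s"
  shows "kyfan v t \<le> kyfan u t"
proof (cases "t \<le> 0")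
  case False
  hence t: "0 < t" by simp
  obtain s where s: "0 \<le> s" "ennreal (kyfan u t) = excess u s + ennreal (s * t)"
    using kyfan_attained[OF assms(1) t] .
  have "ennreal (kyfan v t) \<le> ennreal (kyfan u t)"
    unfolding s(2) using kyfan_le[OF assms(2) s(1), of t] assms(3)[OF s(1)] t
    by (meson add_right_mono less_imp_le order_trans)
  thus ?thesis by simp
qed simp

lemma kyfan_rearr:
  assumes "u \<in> L1" shows "kyfan (rearr u) t = kyfan u t"
  by (intro antisym kyfan_le_if_excess_le) (simp_all add: assms rearr_L1 excess_rearr)

lemma L1_add: "u \<in> L1 \<Longrightarrow> v \<in> L1 \<Longrightarrow> (\<lambda>t. u t + v t) \<in> L1"
  unfolding L1_def by simp

lemma L1_cmult: "u \<in> L1 \<Longrightarrow> (\<lambda>t. c * u t) \<in> L1"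
  unfolding L1_def by simp

lemma L1_abs: "u \<in> L1 \<Longrightarrow> (\<lambda>t. \<bar>u t\<bar>) \<in> L1"
  unfolding L1_def by simp

text \<open>
  Adding optimal levels for \<open>u\<close> and \<open>v\<close> gives an admissible level for the sum, because
  \<open>(|u + v| - (s + r))\<^sup>+ \<le> (|u| - s)\<^sup>+ + (|v| - r)\<^sup>+\<close>.
\<close>

lemma kyfan_add_le:
  assumes u: "u \<in> L1" and v: "v \<in> L1"
  shows "kyfan (\<lambda>t. u t + v t) t \<le> kyfan u t + kyfan v t"
proof (cases "t \<le> 0")
  case False
  hence t: "0 < t" by simp
  note [measurable] = L1_measurable[OF u] L1_measurable[OF v]
  obtain s where s: "0 \<le> s" "ennreal (kyfan u t) = excess u s + ennreal (s * t)"
    using kyfan_attained[OF u t] .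
  obtain r where r: "0 \<le> r" "ennreal (kyfan v t) = excess v r + ennreal (r * t)"
    using kyfan_attained[OF v t] .
  have "excess (\<lambda>t. u t + v t) (s + r) \<le> (\<integral>\<^sup>+ t. ennreal (\<bar>u t\<bar> - s) + ennreal (\<bar>v t\<bar> - r) \<partial>halfline)"
    unfolding excess_def
  proof (rule nn_integral_mono)
    fix t
    have "\<bar>u t + v t\<bar> - (s + r) \<le> max 0 (\<bar>u t\<bar> - s) + max 0 (\<bar>v t\<bar> - r)" by linarith
    hence "ennreal (\<bar>u t + v t\<bar> - (s + r)) \<le> ennreal (max 0 (\<bar>u t\<bar> - s) + max 0 (\<bar>v t\<bar> - r))"
      by (rule ennreal_leI)
    also have "\<dots> = ennreal (\<bar>u t\<bar> - s) + ennreal (\<bar>v t\<bar> - r)"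
      by (subst ennreal_plus) (auto simp: max_def ennreal_neg)
    finally show "ennreal (\<bar>u t + v t\<bar> - (s + r)) \<le> ennreal (\<bar>u t\<bar> - s) + ennreal (\<bar>v t\<bar> - r)" .
  qed
  also have "\<dots> = excess u s + excess v r"
    unfolding excess_def by (rule nn_integral_add) measurable
  finally have *: "excess (\<lambda>t. u t + v t) (s + r) \<le> excess u s + excess v r" .
  have "ennreal (kyfan (\<lambda>t. u t + v t) t) \<le> excess (\<lambda>t. u t + v t) (s + r) + ennreal ((s + r) * t)"
    by (rule kyfan_le) (use u v s r t in \<open>auto intro: L1_add\<close>)
  also have "\<dots> \<le> (excess u s + excess v r) + (ennreal (s * t) + ennreal (r * t))"
    using * s r t by (subst ennreal_plus[symmetric]) (auto intro!: add_mono ennreal_leI simp: distrib_right)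
  also have "\<dots> = ennreal (kyfan u t + kyfan v t)"
    by (subst ennreal_plus) (simp_all add: s r algebra_simps)
  finally show ?thesis by (rule ennreal_le_ennrealD) simp
qed simp

text \<open>
  In the language of sets, \<open>u\<close> is integrated over a set of measure \<open>a\<close>, \<open>v\<close> over one of measure \<open>b\<close>, and both
  are contained in a set of measure \<open>a + b\<close>. Here one level \<open>s\<close>, optimal for the sum, serves both functions, since
  \<open>(u - s)\<^sup>+ + (v - s)\<^sup>+ \<le> (u + v - s)\<^sup>+\<close> for nonnegative \<open>u\<close>, \<open>v\<close> and \<open>s\<close>.
\<close>

lemma kyfan_add_ge:
  assumes u: "u \<in> L1" "nonneg_fun u" and v: "v \<in> L1" "nonneg_fun v" and a: "0 \<le> a" and b: "0 \<le> b"
  shows "kyfan u a + kyfan v b \<le> kyfan (\<lambda>t. u t + v t) (a + b)"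
proof (cases "a + b = 0")
  case False
  hence t: "0 < a + b" using a b by simp
  note [measurable] = L1_measurable[OF u(1)] L1_measurable[OF v(1)]
  obtain s where s: "0 \<le> s" "ennreal (kyfan (\<lambda>t. u t + v t) (a + b)) = excess (\<lambda>t. u t + v t) s + ennreal (s * (a + b))"
    using kyfan_attained[OF L1_add[OF u(1) v(1)] t] .
  have "excess u s + excess v s = (\<integral>\<^sup>+ t. ennreal (\<bar>u t\<bar> - s) + ennreal (\<bar>v t\<bar> - s) \<partial>halfline)"
    unfolding excess_def by (rule nn_integral_add[symmetric]) measurable
  also have "\<dots> \<le> excess (\<lambda>t. u t + v t) s"
    unfolding excess_def
  proof (rule nn_integral_mono_AE)
    show "AE t in halfline. ennreal (\<bar>u t\<bar> - s) + ennreal (\<bar>v t\<bar> - s) \<le> ennreal (\<bar>u t + v t\<bar> - s)"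
      using u(2) v(2) unfolding nonneg_fun_def
    proof eventually_elim
      fix t assume "0 \<le> u t" "0 \<le> v t"
      have "ennreal (\<bar>u t\<bar> - s) + ennreal (\<bar>v t\<bar> - s) = ennreal (max 0 (\<bar>u t\<bar> - s) + max 0 (\<bar>v t\<bar> - s))"
        by (subst ennreal_plus) (auto simp: max_def ennreal_neg)
      also have "max 0 (\<bar>u t\<bar> - s) + max 0 (\<bar>v t\<bar> - s) \<le> max 0 (\<bar>u t + v t\<bar> - s)"
        using \<open>0 \<le> u t\<close> \<open>0 \<le> v t\<close> s(1) by linarith
      hence "ennreal (max 0 (\<bar>u t\<bar> - s) + max 0 (\<bar>v t\<bar> - s)) \<le> ennreal (max 0 (\<bar>u t + v t\<bar> - s))"
        by (rule ennreal_leI)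
      also have "\<dots> = ennreal (\<bar>u t + v t\<bar> - s)" by (auto simp: max_def ennreal_neg)
      finally show "ennreal (\<bar>u t\<bar> - s) + ennreal (\<bar>v t\<bar> - s) \<le> ennreal (\<bar>u t + v t\<bar> - s)" .
    qed
  qed
  finally have *: "excess u s + excess v s \<le> excess (\<lambda>t. u t + v t) s" .
  have "ennreal (kyfan u a + kyfan v b) \<le> (excess u s + ennreal (s * a)) + (excess v s + ennreal (s * b))"
    using kyfan_le[OF u(1) s(1) a] kyfan_le[OF v(1) s(1) b] by (subst ennreal_plus) (auto intro: add_mono)
  also have "\<dots> = (excess u s + excess v s) + ennreal (s * (a + b))"
    using s a b by (simp add: distrib_left ennreal_plus algebra_simps)
  also have "\<dots> \<le> ennreal (kyfan (\<lambda>t. u t + v t) (a + b))"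
    unfolding s(2) using * by (rule add_right_mono)
  finally show ?thesis by (rule ennreal_le_ennrealD) simp
qed (use a b in auto)

lemma kyfan_cmult_le:
  assumes u: "u \<in> L1"
  shows "kyfan (\<lambda>t. c * u t) t \<le> \<bar>c\<bar> * kyfan u t"
proof (cases "t \<le> 0")
  case False
  hence t: "0 < t" by simp
  note [measurable] = L1_measurable[OF u]
  obtain s where s: "0 \<le> s" "ennreal (kyfan u t) = excess u s + ennreal (s * t)"
    using kyfan_attained[OF u t] .
  have "excess (\<lambda>t. c * u t) (\<bar>c\<bar> * s) = ennreal \<bar>c\<bar> * excess u s"
    unfolding excess_def
    by (subst nn_integral_cmult[symmetric]) (auto simp: ennreal_mult'[symmetric] abs_mult right_diff_distrib)
  hence "ennreal (kyfan (\<lambda>t. c * u t) t) \<le> ennreal \<bar>c\<bar> * excess u s + ennreal (\<bar>c\<bar> * s * t)"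
    using kyfan_le[OF L1_cmult[OF u, of c], of "\<bar>c\<bar> * s" t] s t by simp
  also have "\<dots> = ennreal (\<bar>c\<bar> * kyfan u t)"
    using s t by (simp add: ennreal_mult distrib_left mult.assoc)
  finally show ?thesis by (rule ennreal_le_ennrealD) simp
qed simp

lemma kyfan_cmult:
  assumes u: "u \<in> L1"
  shows "kyfan (\<lambda>t. c * u t) t = \<bar>c\<bar> * kyfan u t"
proof (cases "c = 0")
  case True
  thus ?thesis using kyfan_cmult_le[OF u, of 0 t] by (simp add: antisym)
next
  case False
  have "kyfan u t = kyfan (\<lambda>t. (1 / c) * (c * u t)) t" using False by simp
  also have "\<dots> \<le> \<bar>1 / c\<bar> * kyfan (\<lambda>t. c * u t) t" by (rule kyfan_cmult_le) (rule L1_cmult[OF u])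
  finally have "\<bar>c\<bar> * kyfan u t \<le> kyfan (\<lambda>t. c * u t) t" using False by (simp add: field_simps)
  thus ?thesis using kyfan_cmult_le[OF u, of c t] by simp
qed

lemma kyfan_dilate_le:
  assumes u: "u \<in> L1" and L: "1 \<le> L"
  shows "kyfan u (L * t) \<le> L * kyfan u t"
proof (cases "t \<le> 0")
  case True
  thus ?thesis using L by (simp add: mult_nonneg_nonpos)
next
  case False
  hence t: "0 < t" by simp
  obtain s where s: "0 \<le> s" "ennreal (kyfan u t) = excess u s + ennreal (s * t)"
    using kyfan_attained[OF u t] .
  have "ennreal (kyfan u (L * t)) \<le> excess u s + ennreal (s * (L * t))"
    using u s L t by (intro kyfan_le) auto
  also have "\<dots> \<le> ennreal L * excess u s + ennreal (s * (L * t))"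
    using mult_right_mono[of 1 "ennreal L" "excess u s"] L by (intro add_right_mono) simp
  also have "\<dots> = ennreal (L * kyfan u t)"
    using s t L by (simp add: ennreal_mult distrib_left mult.left_commute)
  finally show ?thesis by (rule ennreal_le_ennrealD) (use L in simp)
qed

lemma mu_mono_AE:
  assumes u: "u \<in> L1" and v: "v \<in> L1" and le: "AE t in halfline. \<bar>u t\<bar> \<le> \<bar>v t\<bar>"
  shows "mu t u \<le> mu t v"
proof -
  have "distribution u s \<le> distribution v s" for s
    unfolding distribution_def
    by (rule emeasure_mono_AE)
      (use le distribution_sets[OF L1_measurable[OF v]] in \<open>auto elim!: eventually_mono\<close>)
  thus ?thesis unfolding mu_def distribution_def
    by (intro Inf_superset_mono) (blast intro: order_trans)
qed

lemma nn_integral_rearr_Ico: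
  assumes w: "w \<in> L1" and ab: "0 \<le> a" "a \<le> b"
  shows "(\<integral>\<^sup>+ s. ennreal (rearr w s) * indicator {a..<b} s \<partial>halfline) = ennreal (kyfan w b - kyfan w a)"
proof -
  note [measurable] = rearr_measurable[OF w]
  let ?I = "\<integral>\<^sup>+ s. ennreal (rearr w s) * indicator {a..<b} s \<partial>halfline"
  have I: "(indicator {a..<b} :: real \<Rightarrow> ennreal) \<in> borel_measurable halfline"
    by (intro measurable_restrict_space1 borel_measurable_indicator) simp
  have R: "(\<lambda>s. ennreal (rearr w s)) \<in> borel_measurable halfline" by measurable
  have J: "(indicator {0<..<a} :: real \<Rightarrow> ennreal) \<in> borel_measurable halfline"
    by (intro borel_measurable_indicator) (subst sets_restrict_space_iff, auto)
  have "ennreal (kyfan w b) = (\<integral>\<^sup>+ s. ennreal (rearr w s) * indicator {0<..<a} s + ennreal (rearr w s) * indicator {a..<b} s \<partial>halfline)"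
    using ab mu_integral_eq[OF w, of b] ennreal_kyfan[OF w, of b]
    by (auto intro!: nn_integral_cong simp: indicator_def)
  also have "\<dots> = (\<integral>\<^sup>+ s. ennreal (rearr w s) * indicator {0<..<a} s \<partial>halfline) + ?I"
    by (rule nn_integral_add) (rule borel_measurable_times_ennreal[OF R] I J)+
  finally have "ennreal (kyfan w b) = ennreal (kyfan w a) + ?I"
    using mu_integral_eq[OF w, of a] ennreal_kyfan[OF w ab(1)] by simp
  thus ?thesis using kyfan_mono[OF w ab(2)]
    by (cases ?I) (auto simp: ennreal_plus[symmetric] simp del: ennreal_plus)
qed

text \<open>
  Not only the integrals from 0 but all increments are monotone, because they are integrals of
  pointwise monotone rearrangements.
\<close>

lemma kyfan_diff_mono:
  assumes u: "u \<in> L1" and v: "v \<in> L1" and le: "AE t in halfline. \<bar>u t\<bar> \<le> \<bar>v t\<bar>" and ab: "0 \<le> a" "a \<le> b"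
  shows "kyfan u b - kyfan u a \<le> kyfan v b - kyfan v a"
proof -
  let ?I = "\<lambda>w. (\<integral>\<^sup>+ s. ennreal (rearr w s) * indicator {a..<b} s \<partial>halfline)"
  have "?I u \<le> ?I v"
  proof (rule nn_integral_mono)
    fix s assume "s \<in> space halfline"
    hence "ennreal (rearr u s) \<le> ennreal (rearr v s)"
      using mu_mono_AE[OF u v le, of s] ennreal_rearr u v by simp
    thus "ennreal (rearr u s) * indicator {a..<b} s \<le> ennreal (rearr v s) * indicator {a..<b} s"
      by (rule mult_right_mono) simp
  qed
  thus ?thesis unfolding nn_integral_rearr_Ico[OF u ab] nn_integral_rearr_Ico[OF v ab]
    by (rule ennreal_le_ennrealD) (use kyfan_mono[OF v ab(2)] in simp)
qed

text \<open>
  By concavity the graph lies below its tangent at \<open>a\<close>, whose slope is the rearrangement.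
\<close>

lemma kyfan_supergradient:
  assumes u: "u \<in> L1" and a: "0 < a" and b: "0 \<le> b"
  shows "kyfan u b \<le> kyfan u a + rearr u a * (b - a)"
proof -
  let ?s = "rearr u a"
  obtain B where B: "excess u ?s = ennreal B" "0 \<le> B"
    using excess_finite[OF u rearr_nonneg[of u a]] by (cases "excess u ?s") auto
  have "ennreal (kyfan u a) = ennreal (B + ?s * a)"
    using mu_integral_attained[OF u a] ennreal_kyfan[OF u, of a] a B rearr_nonneg[of u a] by simp
  hence 1: "kyfan u a = B + ?s * a"
    by (subst (asm) ennreal_inj) (use B a rearr_nonneg[of u a] in simp_all)
  have "ennreal (kyfan u b) \<le> ennreal (B + ?s * b)"
    using kyfan_le[OF u rearr_nonneg[of u a] b] B b rearr_nonneg[of u a] by simp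
  hence "kyfan u b \<le> B + ?s * b" by (rule ennreal_le_ennrealD) (use B b rearr_nonneg[of u a] in simp)
  thus ?thesis using 1 by (simp add: algebra_simps)
qed

lemma rearr_mult_le_kyfan: "u \<in> L1 \<Longrightarrow> 0 < a \<Longrightarrow> rearr u a * a \<le> kyfan u a"
  using kyfan_supergradient[of u a 0] by simp

lemma kyfan_mono_AE:
  assumes u: "u \<in> L1" and v: "v \<in> L1" and le: "AE t in halfline. \<bar>u t\<bar> \<le> \<bar>v t\<bar>"
  shows "kyfan u t \<le> kyfan v t"
  using kyfan_diff_mono[OF assms, of 0 t] by (cases "t \<le> 0") auto

lemma integral_Ioo_le_kyfan:
  assumes f: "f \<in> L1" and t: "0 \<le> t"
  shows "(\<integral>\<^sup>+ r. ennreal \<bar>f r\<bar> * indicator {0<..<t} r \<partial>halfline) \<le> ennreal (kyfan f t)"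
proof (cases "t = 0")
  case False
  then obtain s where "0 \<le> s" "ennreal (kyfan f t) = excess f s + ennreal (s * t)"
    using kyfan_attained[OF f, of t] t by auto
  thus ?thesis using nn_integral_Ioo_le_excess[OF f _ t] by simp
qed simp

lemma ennreal_kyfan_rearr_integral:
  assumes "u \<in> L1" "0 \<le> t"
  shows "ennreal (kyfan u t) = (\<integral>\<^sup>+ r. ennreal (rearr u r) * indicator {0<..<t} r \<partial>halfline)"
  using ennreal_kyfan[OF assms] mu_integral_eq[OF assms(1)] by simp

text \<open>
  Two decreasing functions attain their maximal integrals on the same interval. This turns a sum of
  functions \<open>kyfan\<close> into the one of a single function.
\<close>

lemma kyfan_add_rearr:
  assumes u: "u \<in> L1" and v: "v \<in> L1"
  shows "kyfan u t + kyfan v t \<le> kyfan (\<lambda>t. rearr u t + rearr v t) t"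
proof (cases "t \<le> 0")
  case False
  note [measurable] = rearr_measurable[OF u] rearr_measurable[OF v]
  have [measurable]: "{0<..<t} \<in> sets halfline" by (subst sets_restrict_space_iff) auto
  have "ennreal (kyfan u t + kyfan v t) = (\<integral>\<^sup>+ r. ennreal (rearr u r) * indicator {0<..<t} r + ennreal (rearr v r) * indicator {0<..<t} r \<partial>halfline)"
    using False u v by (subst nn_integral_add) (auto simp: ennreal_kyfan_rearr_integral[symmetric])
  also have "\<dots> = (\<integral>\<^sup>+ r. ennreal \<bar>rearr u r + rearr v r\<bar> * indicator {0<..<t} r \<partial>halfline)"
    by (rule nn_integral_cong) (simp add: rearr_nonneg distrib_right)
  also have "\<dots> \<le> ennreal (kyfan (\<lambda>t. rearr u t + rearr v t) t)"
    using False by (intro integral_Ioo_le_kyfan L1_add rearr_L1 u v) auto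
  finally show ?thesis by (rule ennreal_le_ennrealD) simp
qed simp

lemma kyfan_small:
  assumes u: "u \<in> L1" and e: "0 < e"
  obtains t where "0 < t" "kyfan u t < e"
proof -
  note [measurable] = rearr_measurable[OF u]
  have "(\<lambda>n. \<integral>\<^sup>+ r. ennreal (rearr u r) * indicator {0<..<1 / real (Suc n)} r \<partial>halfline) \<longlonglongrightarrow> (\<integral>\<^sup>+ r. 0 \<partial>halfline)"
  proof (rule nn_integral_dominated_convergence[where w="\<lambda>r. ennreal (rearr u r)"])
    show "(\<integral>\<^sup>+ r. ennreal (rearr u r) \<partial>halfline) < \<infinity>"
      using excess_finite[OF rearr_L1[OF u], of 0] unfolding excess_0 by (simp add: rearr_nonneg)
    show "AE r in halfline. (\<lambda>n. ennreal (rearr u r) * indicator {0<..<1 / real (Suc n)} r) \<longlonglongrightarrow> 0"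
    proof (rule AE_I2)
      fix r assume "r \<in> space halfline"
      hence r: "0 < r" by simp
      obtain N where N: "1 / real (Suc N) < r" using reals_Archimedean[OF r] by (auto simp: inverse_eq_divide)
      have "\<forall>n\<ge>N. ennreal (rearr u r) * indicator {0<..<1 / real (Suc n)} r = 0"
      proof (intro allI impI)
        fix n assume "N \<le> n"
        hence "1 / real (Suc n) \<le> 1 / real (Suc N)" by (simp add: field_simps)
        thus "ennreal (rearr u r) * indicator {0<..<1 / real (Suc n)} r = 0" using N by (simp add: indicator_def)
      qed
      thus "(\<lambda>n. ennreal (rearr u r) * indicator {0<..<1 / real (Suc n)} r) \<longlonglongrightarrow> 0"
        by (intro tendsto_eventually) (auto simp: eventually_sequentially)
    qed
    show "AE r in halfline. ennreal (rearr u r) * indicator {0<..<1 / real (Suc n)} r \<le> ennreal (rearr u r)" for n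
      by (rule AE_I2) (simp split: split_indicator)
    have R: "(\<lambda>s. ennreal (rearr u s)) \<in> borel_measurable halfline" by measurable
    show "(\<lambda>r. ennreal (rearr u r) * indicator {0<..<1 / real (Suc n)} r) \<in> borel_measurable halfline" for n
      by (intro borel_measurable_times_ennreal R borel_measurable_indicator) (subst sets_restrict_space_iff, auto)
    show "(\<lambda>s. ennreal (rearr u s)) \<in> borel_measurable halfline" by (rule R)
    show "(\<lambda>s. 0) \<in> borel_measurable halfline" by simp
  qed
  hence "(\<lambda>n. ennreal (kyfan u (1 / real (Suc n)))) \<longlonglongrightarrow> 0"
    by (simp add: ennreal_kyfan_rearr_integral[OF u] del: of_nat_Suc)
  hence "eventually (\<lambda>n. ennreal (kyfan u (1 / real (Suc n))) < ennreal e) sequentially"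
    using e by (intro order_tendstoD(2)) auto
  then obtain n where "ennreal (kyfan u (1 / real (Suc n))) < ennreal e" by (auto simp: eventually_sequentially)
  hence "kyfan u (1 / real (Suc n)) < e" by (simp add: ennreal_less_iff)
  thus ?thesis using that[of "1 / real (Suc n)"] by simp
qed

lemma kyfan_le_bound:
  assumes u: "u \<in> L1" and k: "0 \<le> k" "AE t in halfline. \<bar>u t\<bar> \<le> k" and t: "0 \<le> t"
  shows "kyfan u t \<le> k * t"
proof -
  have "excess u k = 0" unfolding excess_def
    by (subst nn_integral_0_iff_AE) (use k L1_measurable[OF u] in \<open>auto elim: eventually_mono simp: ennreal_neg\<close>)
  hence "ennreal (kyfan u t) \<le> ennreal (k * t)" using kyfan_le[OF u k(1) t] by simp
  thus ?thesis by (rule ennreal_le_ennrealD) (use k(1) t in simp)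
qed

section \<open>The Hahn-Banach theorem for sublinear functionals\<close>

definition linear_space :: "('a \<Rightarrow> real) set \<Rightarrow> bool" where
  "linear_space V \<longleftrightarrow> (\<lambda>t. 0) \<in> V \<and> (\<forall>u\<in>V. \<forall>v\<in>V. (\<lambda>t. u t + v t) \<in> V) \<and> (\<forall>c. \<forall>u\<in>V. (\<lambda>t. c * u t) \<in> V)"

text \<open>
  The inequality for positive \<open>c\<close> already implies homogeneity and \<open>p 0 = 0\<close>, by applying it to \<open>1/c\<close> as well;
  see \<open>sublinear_onD\<close> below.
\<close>

definition sublinear_on :: "('a \<Rightarrow> real) set \<Rightarrow> (('a \<Rightarrow> real) \<Rightarrow> real) \<Rightarrow> bool" where
  "sublinear_on V p \<longleftrightarrow> (\<forall>u\<in>V. \<forall>v\<in>V. p (\<lambda>t. u t + v t) \<le> p u + p v) \<and>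
     (\<forall>c>0. \<forall>u\<in>V. p (\<lambda>t. c * u t) \<le> c * p u)"

lemma linear_spaceD:
  assumes "linear_space V"
  shows "(\<lambda>t. 0) \<in> V" "u \<in> V \<Longrightarrow> v \<in> V \<Longrightarrow> (\<lambda>t. u t + v t) \<in> V" "u \<in> V \<Longrightarrow> (\<lambda>t. c * u t) \<in> V"
    "u \<in> V \<Longrightarrow> (\<lambda>t. - u t) \<in> V" "u \<in> V \<Longrightarrow> v \<in> V \<Longrightarrow> (\<lambda>t. u t - v t) \<in> V"
proof -
  show 1: "(\<lambda>t. 0) \<in> V" "u \<in> V \<Longrightarrow> v \<in> V \<Longrightarrow> (\<lambda>t. u t + v t) \<in> V" "u \<in> V \<Longrightarrow> (\<lambda>t. c * u t) \<in> V" for u v c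
    using assms unfolding linear_space_def by auto
  show 2: "u \<in> V \<Longrightarrow> (\<lambda>t. - u t) \<in> V" for u using 1(3)[of u "-1"] by simp
  show "u \<in> V \<Longrightarrow> v \<in> V \<Longrightarrow> (\<lambda>t. u t - v t) \<in> V" using 1(2)[of u "\<lambda>t. - v t"] 2[of v] by simp
qed

lemma sublinear_onD:
  assumes V: "linear_space V" and p: "sublinear_on V p"
  shows "u \<in> V \<Longrightarrow> v \<in> V \<Longrightarrow> p (\<lambda>t. u t + v t) \<le> p u + p v"
    and "p (\<lambda>t. 0) = 0"
    and "0 \<le> c \<Longrightarrow> u \<in> V \<Longrightarrow> p (\<lambda>t. c * u t) = c * p u"
    and "u \<in> V \<Longrightarrow> - p (\<lambda>t. - u t) \<le> p u"
proof -
  show add: "u \<in> V \<Longrightarrow> v \<in> V \<Longrightarrow> p (\<lambda>t. u t + v t) \<le> p u + p v" for u v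
    using p unfolding sublinear_on_def by auto
  have le: "c > 0 \<Longrightarrow> u \<in> V \<Longrightarrow> p (\<lambda>t. c * u t) \<le> c * p u" for u c
    using p unfolding sublinear_on_def by auto
  show 0: "p (\<lambda>t. 0) = 0"
    using le[of "1/2" "\<lambda>t. 0"] le[of 2 "\<lambda>t. 0"] linear_spaceD(1)[OF V] by simp
  show "0 \<le> c \<Longrightarrow> u \<in> V \<Longrightarrow> p (\<lambda>t. c * u t) = c * p u"
  proof (cases "c = 0")
    case False
    assume c: "0 \<le> c" "u \<in> V"
    have "p u = p (\<lambda>t. (1 / c) * (c * u t))" using False by simp
    also have "\<dots> \<le> (1 / c) * p (\<lambda>t. c * u t)" using c False by (intro le linear_spaceD(3)[OF V]) auto
    finally show ?thesis using le[of c u] c False by (simp add: field_simps)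
  qed (use 0 in simp)
  show "u \<in> V \<Longrightarrow> - p (\<lambda>t. - u t) \<le> p u"
    using add[of u "\<lambda>t. - u t"] 0 linear_spaceD(4)[OF V, of u] by simp
qed

text \<open>
  The largest sublinear functional below \<open>q\<close> whose value at \<open>- v\<close> is at most \<open>- q v\<close>. Starting from a minimal \<open>q\<close>,
  it cannot be smaller than \<open>q\<close>, which yields additivity; starting from the given bound \<open>p\<close>, it fixes the value
  of the functional at a prescribed vector.
\<close>

lemma directional_infimum:
  assumes V: "linear_space V" and q: "sublinear_on V q" and v: "v \<in> V"
  defines "r \<equiv> \<lambda>u. INF s\<in>{0..}. q (\<lambda>t. u t + s * v t) - s * q v"
  shows "sublinear_on V r" and "\<And>u s. u \<in> V \<Longrightarrow> 0 \<le> s \<Longrightarrow> r u \<le> q (\<lambda>t. u t + s * v t) - s * q v"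
proof -
  note VD = linear_spaceD[OF V] and qD = sublinear_onD[OF V q]
  have bdd: "bdd_below ((\<lambda>s. q (\<lambda>t. u t + s * v t) - s * q v) ` {0..})" if u: "u \<in> V" for u
  proof (rule bdd_belowI2)
    fix s :: real assume "s \<in> {0..}"
    hence s: "0 \<le> s" by simp
    have "s * q v = q (\<lambda>t. (u t + s * v t) + - u t)" using qD(3)[OF s v] by simp
    also have "\<dots> \<le> q (\<lambda>t. u t + s * v t) + q (\<lambda>t. - u t)"
      by (rule qD(1)) (intro VD u v)+
    finally show "- q (\<lambda>t. - u t) \<le> q (\<lambda>t. u t + s * v t) - s * q v" by simp
  qed
  show lower: "r u \<le> q (\<lambda>t. u t + s * v t) - s * q v" if "u \<in> V" "0 \<le> s" for u s
    unfolding r_def by (rule cINF_lower[OF bdd]) (use that in auto)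
  have great: "c \<le> r u" if "\<And>s. 0 \<le> s \<Longrightarrow> c \<le> q (\<lambda>t. u t + s * v t) - s * q v" for c u
    unfolding r_def by (rule cINF_greatest) (use that in auto)
  show "sublinear_on V r"
    unfolding sublinear_on_def
  proof (intro conjI ballI allI impI)
    fix u w assume u: "u \<in> V" and w: "w \<in> V"
    have key: "r (\<lambda>t. u t + w t) \<le> (q (\<lambda>t. u t + s * v t) - s * q v) + (q (\<lambda>t. w t + s' * v t) - s' * q v)"
      if s: "0 \<le> s" "0 \<le> s'" for s s'
    proof -
      have "r (\<lambda>t. u t + w t) \<le> q (\<lambda>t. (u t + w t) + (s + s') * v t) - (s + s') * q v"
        using s by (intro lower VD u w) auto
      also have "(\<lambda>t. (u t + w t) + (s + s') * v t) = (\<lambda>t. (u t + s * v t) + (w t + s' * v t))"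
        by (auto simp: algebra_simps)
      also have "q \<dots> \<le> q (\<lambda>t. u t + s * v t) + q (\<lambda>t. w t + s' * v t)"
        by (rule qD(1)) (intro VD u v w)+
      finally show ?thesis by (simp add: algebra_simps)
    qed
    have "r (\<lambda>t. u t + w t) - (q (\<lambda>t. u t + s * v t) - s * q v) \<le> r w" if "0 \<le> s" for s
      by (rule great) (use key[OF that] in \<open>simp add: algebra_simps\<close>)
    hence "r (\<lambda>t. u t + w t) - r w \<le> q (\<lambda>t. u t + s * v t) - s * q v" if "0 \<le> s" for s
      using that by (metis diff_le_eq add.commute)
    hence "r (\<lambda>t. u t + w t) - r w \<le> r u" by (rule great)
    thus "r (\<lambda>t. u t + w t) \<le> r u + r w" by simp
  next
    fix c :: real and u assume c: "0 < c" and u: "u \<in> V"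
    have "r (\<lambda>t. c * u t) / c \<le> r u"
    proof (rule great)
      fix s :: real assume s: "0 \<le> s"
      have "r (\<lambda>t. c * u t) \<le> q (\<lambda>t. c * u t + (c * s) * v t) - (c * s) * q v"
        using c s by (intro lower VD u) auto
      also have "(\<lambda>t. c * u t + (c * s) * v t) = (\<lambda>t. c * (u t + s * v t))" by (auto simp: algebra_simps)
      also have "q \<dots> = c * q (\<lambda>t. u t + s * v t)"
        using c by (intro qD VD u v) auto
      finally show "r (\<lambda>t. c * u t) / c \<le> q (\<lambda>t. u t + s * v t) - s * q v"
        using c by (simp add: field_simps)
    qed
    thus "r (\<lambda>t. c * u t) \<le> c * r u" using c by (simp add: field_simps)
  qed
qed

text \<open>
  Zorn's lemma; the pointwise infimum of a chain is finite because each member is bounded below by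
  \<open>- p (- u)\<close>. Functionals are normalised to 0 outside \<open>V\<close> so that the pointwise order is antisymmetric.
\<close>

lemma minimal_sublinear_exists:
  assumes V: "linear_space V" and p: "sublinear_on V p"
  obtains q where "sublinear_on V q" "\<And>u. u \<in> V \<Longrightarrow> q u \<le> p u"
    "\<And>r u. sublinear_on V r \<Longrightarrow> (\<And>u. u \<in> V \<Longrightarrow> r u \<le> q u) \<Longrightarrow> u \<in> V \<Longrightarrow> r u = q u"
proof -
  define A where "A = {q. sublinear_on V q \<and> (\<forall>u\<in>V. q u \<le> p u) \<and> (\<forall>u. u \<notin> V \<longrightarrow> q u = 0)}"
  define P where "P = (\<lambda>q r :: ('a \<Rightarrow> real) \<Rightarrow> real. \<forall>u. r u \<le> q u)"
  note VD = linear_spaceD[OF V]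
  have cut: "sublinear_on V (\<lambda>u. if u \<in> V then q u else 0)" if "sublinear_on V q" for q
    using that VD unfolding sublinear_on_def by auto
  have "\<exists>m\<in>A. \<forall>a\<in>A. P m a \<longrightarrow> a = m"
  proof (rule predicate_Zorn)
    show "partial_order_on A (relation_of P A)"
    proof (rule partial_order_on_relation_ofI)
      fix q r assume "P q r" "P r q"
      hence "q u = r u" for u unfolding P_def by (intro antisym) auto
      thus "q = r" by (rule ext)
    next
      fix q r s assume "P q r" "P r s"
      hence "s u \<le> q u" for u unfolding P_def using order_trans[of "s u" "r u" "q u"] by simp
      thus "P q s" unfolding P_def by simp
    qed (simp add: P_def)
  next
    fix C assume C: "C \<in> Chains (relation_of P A)"
    hence CA: "C \<subseteq> A" by (rule Chains_relation_of)
    have total: "P q r \<or> P r q" if "q \<in> C" "r \<in> C" for q r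
      using C that unfolding Chains_def relation_of_def by auto
    show "\<exists>l\<in>A. \<forall>a\<in>C. P a l"
    proof (cases "C = {}")
      case True
      have "(\<lambda>u. if u \<in> V then p u else 0) \<in> A" unfolding A_def using cut[OF p] by auto
      thus ?thesis using True by auto
    next
      case False
      define l where "l u = (if u \<in> V then INF q\<in>C. q u else 0)" for u
      have low: "- p (\<lambda>t. - u t) \<le> q u" if u: "u \<in> V" and q: "q \<in> C" for u q
      proof -
        have "sublinear_on V q" "q (\<lambda>t. - u t) \<le> p (\<lambda>t. - u t)"
          using q CA VD(4)[OF u] unfolding A_def by auto
        thus ?thesis using sublinear_onD(4)[OF V _ u, of q] by simp
      qed
      have lower: "l u \<le> q u" if "u \<in> V" "q \<in> C" for u q
      proof -
        have "bdd_below ((\<lambda>q. q u) ` C)" by (rule bdd_belowI2) (rule low[OF that(1)])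
        thus ?thesis unfolding l_def using cINF_lower[of "\<lambda>q. q u" C q] that by simp
      qed
      have great: "c \<le> l u" if "u \<in> V" "\<And>q. q \<in> C \<Longrightarrow> c \<le> q u" for c u
        unfolding l_def using cINF_greatest[OF False, of c "\<lambda>q. q u"] that by simp
      have "sublinear_on V l" unfolding sublinear_on_def
      proof (intro conjI ballI allI impI)
        fix u w assume u: "u \<in> V" and w: "w \<in> V"
        have key: "l (\<lambda>t. u t + w t) \<le> q u + r w" if q: "q \<in> C" and r: "r \<in> C" for q r
        proof -
          obtain m where m: "m \<in> C" "m u \<le> q u" "m w \<le> r w"
            using total[OF q r] q r unfolding P_def by blast
          have mA: "sublinear_on V m" using CA m(1) unfolding A_def by auto
          have "l (\<lambda>t. u t + w t) \<le> m (\<lambda>t. u t + w t)" by (rule lower[OF VD(2)[OF u w] m(1)])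
          also have "\<dots> \<le> m u + m w" by (rule sublinear_onD(1)[OF V mA u w])
          finally show ?thesis using m by linarith
        qed
        have l1: "l (\<lambda>t. u t + w t) - q u \<le> l w" if "q \<in> C" for q
          by (rule great[OF w]) (use key[OF that] in \<open>simp add: algebra_simps\<close>)
        have "l (\<lambda>t. u t + w t) - l w \<le> q u" if "q \<in> C" for q
          using l1[OF that] by linarith
        hence "l (\<lambda>t. u t + w t) - l w \<le> l u" by (rule great[OF u])
        thus "l (\<lambda>t. u t + w t) \<le> l u + l w" by simp
      next
        fix c :: real and u assume c: "0 < c" and u: "u \<in> V"
        have "l (\<lambda>t. c * u t) / c \<le> l u"
        proof (rule great[OF u])
          fix q assume q: "q \<in> C"
          have qA: "sublinear_on V q" using CA q unfolding A_def by auto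
          have "l (\<lambda>t. c * u t) \<le> q (\<lambda>t. c * u t)" by (rule lower[OF VD(3)[OF u] q])
          also have "\<dots> = c * q u" using c by (intro sublinear_onD(3)[OF V qA _ u]) simp
          finally show "l (\<lambda>t. c * u t) / c \<le> q u" using c by (simp add: field_simps)
        qed
        thus "l (\<lambda>t. c * u t) \<le> c * l u" using c by (simp add: field_simps)
      qed
      moreover have "l u \<le> p u" if "u \<in> V" for u
      proof -
        obtain q where q: "q \<in> C" using False by auto
        have "l u \<le> q u" by (rule lower[OF that q])
        also have "\<dots> \<le> p u" using q CA that unfolding A_def by auto
        finally show ?thesis .
      qed
      moreover have "u \<notin> V \<longrightarrow> l u = 0" for u unfolding l_def by simp
      ultimately have lA: "l \<in> A" unfolding A_def by simp
      have "P q l" if q: "q \<in> C" for q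
      proof -
        have "q u = 0" if "u \<notin> V" for u using q CA that unfolding A_def by blast
        hence "l u \<le> q u" for u
          using lower[OF _ q, of u] by (cases "u \<in> V") (simp_all add: l_def)
        thus ?thesis unfolding P_def by simp
      qed
      with lA show ?thesis by (intro bexI[of _ l]) simp_all
    qed
  qed
  then obtain q where q: "q \<in> A" "\<And>a. a \<in> A \<Longrightarrow> P q a \<Longrightarrow> a = q" by blast
  show ?thesis
  proof (rule that[of q])
    show "sublinear_on V q" "\<And>u. u \<in> V \<Longrightarrow> q u \<le> p u" using q(1) unfolding A_def by auto
    fix r u assume r: "sublinear_on V r" "\<And>u. u \<in> V \<Longrightarrow> r u \<le> q u" and u: "u \<in> V"
    let ?r = "\<lambda>u. if u \<in> V then r u else 0"
    have "?r u \<le> p u" if "u \<in> V" for u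
    proof -
      have "q u \<le> p u" using q(1) that unfolding A_def by auto
      thus ?thesis using order_trans[OF r(2)[OF that]] that by simp
    qed
    hence rA: "?r \<in> A" using cut[OF r(1)] unfolding A_def by simp
    have "q u = 0" if "u \<notin> V" for u using q(1) that unfolding A_def by blast
    hence "P q ?r" unfolding P_def using r(2) by simp
    hence "?r = q" by (rule q(2)[OF rA])
    hence "?r u = q u" by (rule fun_cong)
    thus "r u = q u" using u by simp
  qed
qed

text \<open>
  A minimal sublinear functional is linear: comparing it with its directional infimum along \<open>v\<close> gives
  \<open>f u + f v \<le> f (u + v)\<close>.
\<close>

theorem Hahn_Banach_sublinear:
  assumes V: "linear_space V" and p: "sublinear_on V p" and v0: "v0 \<in> V"
  obtains f where "\<And>u v. u \<in> V \<Longrightarrow> v \<in> V \<Longrightarrow> f (\<lambda>t. u t + v t) = f u + f v"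
    "\<And>c u. u \<in> V \<Longrightarrow> f (\<lambda>t. c * u t) = c * f u"
    "\<And>u. u \<in> V \<Longrightarrow> f u \<le> p u" "f v0 = p v0"
proof -
  note VD = linear_spaceD[OF V]
  define r where "r = (\<lambda>u. INF s\<in>{0..}. p (\<lambda>t. u t + s * v0 t) - s * p v0)"
  have r: "sublinear_on V r" "\<And>u s. u \<in> V \<Longrightarrow> 0 \<le> s \<Longrightarrow> r u \<le> p (\<lambda>t. u t + s * v0 t) - s * p v0"
    using directional_infimum[OF V p v0] unfolding r_def by blast+
  obtain f where f: "sublinear_on V f" "\<And>u. u \<in> V \<Longrightarrow> f u \<le> r u"
    "\<And>q u. sublinear_on V q \<Longrightarrow> (\<And>u. u \<in> V \<Longrightarrow> q u \<le> f u) \<Longrightarrow> u \<in> V \<Longrightarrow> q u = f u"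
    using minimal_sublinear_exists[OF V r(1)] by blast
  note fD = sublinear_onD[OF V f(1)]
  have add: "f (\<lambda>t. u t + v t) = f u + f v" if u: "u \<in> V" and v: "v \<in> V" for u v
  proof (rule antisym)
    show "f (\<lambda>t. u t + v t) \<le> f u + f v" by (rule fD(1)[OF u v])
    define q where "q = (\<lambda>u. INF s\<in>{0..}. f (\<lambda>t. u t + s * v t) - s * f v)"
    have q: "sublinear_on V q" "\<And>u s. u \<in> V \<Longrightarrow> 0 \<le> s \<Longrightarrow> q u \<le> f (\<lambda>t. u t + s * v t) - s * f v"
      using directional_infimum[OF V f(1) v] unfolding q_def by blast+
    have "q u = f u" by (rule f(3)[OF q(1) _ u]) (use q(2)[of _ 0] in simp)
    thus "f u + f v \<le> f (\<lambda>t. u t + v t)" using q(2)[OF u, of 1] by simp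
  qed
  have neg: "f (\<lambda>t. - u t) = - f u" if u: "u \<in> V" for u
    using add[OF u VD(4)[OF u]] fD(2) by simp
  have hom: "f (\<lambda>t. c * u t) = c * f u" if u: "u \<in> V" for c u
  proof (cases "0 \<le> c")
    case True thus ?thesis by (rule fD(3)[OF _ u])
  next
    case False
    hence "f (\<lambda>t. - ((- c) * u t)) = - ((- c) * f u)"
      using fD(3)[of "- c" u] u neg[OF VD(3)[OF u, of "- c"]] by linarith
    thus ?thesis by simp
  qed
  have le: "f u \<le> p u" if u: "u \<in> V" for u using f(2)[OF u] r(2)[OF u, of 0] by simp
  have "f (\<lambda>t. - v0 t) \<le> - p v0"
    using f(2)[OF VD(4)[OF v0]] r(2)[OF VD(4)[OF v0], of 1] sublinear_onD(2)[OF V p] by simp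
  hence "f v0 = p v0" using neg[OF v0] le[OF v0] by simp
  thus ?thesis using that[of f] add hom le by blast
qed

section \<open>Balanced pairs and averages over scales\<close>

text \<open>
  The model case is \<open>P = \<Sum> u\<^sub>i\<close> and \<open>Q = \<Sum> v\<^sub>i\<close> for \<open>K\<close> pairs of nonnegative equimeasurable functions, with
  \<open>F b = \<Sum> kyfan u\<^sub>i b = \<Sum> kyfan v\<^sub>i b\<close>. Recording only the consequences for \<open>kyfan\<close> makes the notion stable
  under sums without carrying the summands along.
\<close>

definition balanced_by :: "(real \<Rightarrow> real) \<Rightarrow> real \<Rightarrow> (real \<Rightarrow> real) \<Rightarrow> (real \<Rightarrow> real) \<Rightarrow> bool"
  where "balanced_by F K P Q \<longleftrightarrow> nonneg_fun P \<and> nonneg_fun Q \<and> 1 \<le> K \<and>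
    (\<forall>b\<ge>0. kyfan P b \<le> F b \<and> F b \<le> kyfan Q (K * b) \<and> kyfan Q b \<le> F b \<and> F b \<le> kyfan P (K * b))"

definition balanced :: "(real \<Rightarrow> real) \<Rightarrow> (real \<Rightarrow> real) \<Rightarrow> bool"
  where "balanced P Q \<longleftrightarrow> (\<exists>F K. balanced_by F K P Q)"

lemma nonneg_fun_add:
  assumes "nonneg_fun u" "nonneg_fun v"
  shows "nonneg_fun (\<lambda>t. u t + v t)"
  using assms unfolding nonneg_fun_def by eventually_elim simp

lemma nonneg_fun_cmult: "nonneg_fun u \<Longrightarrow> 0 \<le> c \<Longrightarrow> nonneg_fun (\<lambda>t. c * u t)"
  unfolding nonneg_fun_def by (auto elim!: eventually_mono)

lemma balanced_equimeasurable:
  assumes "nonneg_fun u" "nonneg_fun v" "\<And>t. 0 < t \<Longrightarrow> mu t u = mu t v"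
  shows "balanced u v"
proof -
  have "kyfan u t = kyfan v t" for t by (rule kyfan_cong) (rule assms)
  hence "balanced_by (kyfan u) 1 u v" unfolding balanced_by_def using assms(1,2) by simp
  thus ?thesis unfolding balanced_def by blast
qed

lemma balanced_add:
  assumes L1: "P \<in> L1" "Q \<in> L1" "P' \<in> L1" "Q' \<in> L1" and "balanced P Q" "balanced P' Q'"
  shows "balanced (\<lambda>t. P t + P' t) (\<lambda>t. Q t + Q' t)"
proof -
  obtain F K where F: "balanced_by F K P Q" using assms(5) unfolding balanced_def by blast
  obtain F' K' where F': "balanced_by F' K' P' Q'" using assms(6) unfolding balanced_def by blast
  have ge: "kyfan u (K * b) + kyfan v (K' * b) \<le> kyfan (\<lambda>t. u t + v t) ((K + K') * b)"
    if "u \<in> L1" "nonneg_fun u" "v \<in> L1" "nonneg_fun v" "0 \<le> b" for u v b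
    using kyfan_add_ge[OF that(1-4), of "K * b" "K' * b"] F F' that(5)
    unfolding balanced_by_def by (simp add: distrib_right)
  have "balanced_by (\<lambda>b. F b + F' b) (K + K') (\<lambda>t. P t + P' t) (\<lambda>t. Q t + Q' t)"
    unfolding balanced_by_def
  proof (intro conjI allI impI)
    show "nonneg_fun (\<lambda>t. P t + P' t)" "nonneg_fun (\<lambda>t. Q t + Q' t)" "1 \<le> K + K'"
      using F F' unfolding balanced_by_def by (auto intro: nonneg_fun_add)
    fix b :: real assume b: "0 \<le> b"
    have *: "kyfan P b \<le> F b" "F b \<le> kyfan Q (K * b)" "kyfan Q b \<le> F b" "F b \<le> kyfan P (K * b)"
      "kyfan P' b \<le> F' b" "F' b \<le> kyfan Q' (K' * b)" "kyfan Q' b \<le> F' b" "F' b \<le> kyfan P' (K' * b)"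
      "nonneg_fun P" "nonneg_fun Q" "nonneg_fun P'" "nonneg_fun Q'"
      using F F' b unfolding balanced_by_def by auto
    show "kyfan (\<lambda>t. P t + P' t) b \<le> F b + F' b" using kyfan_add_le[OF L1(1,3), of b] * by linarith
    show "kyfan (\<lambda>t. Q t + Q' t) b \<le> F b + F' b" using kyfan_add_le[OF L1(2,4), of b] * by linarith
    show "F b + F' b \<le> kyfan (\<lambda>t. P t + P' t) ((K + K') * b)"
      using ge[OF L1(1) *(9) L1(3) *(11) b] * by linarith
    show "F b + F' b \<le> kyfan (\<lambda>t. Q t + Q' t) ((K + K') * b)"
      using ge[OF L1(2) *(10) L1(4) *(12) b] * by linarith
  qed
  thus ?thesis unfolding balanced_def by blast
qed

lemma balanced_cmult:
  assumes "P \<in> L1" "Q \<in> L1" "balanced P Q" "0 \<le> c"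
  shows "balanced (\<lambda>t. c * P t) (\<lambda>t. c * Q t)"
proof -
  obtain F K where F: "balanced_by F K P Q" using assms(3) unfolding balanced_def by blast
  have "balanced_by (\<lambda>b. c * F b) K (\<lambda>t. c * P t) (\<lambda>t. c * Q t)"
    using F assms(4) unfolding balanced_by_def kyfan_cmult[OF assms(1)] kyfan_cmult[OF assms(2)]
    by (auto intro: nonneg_fun_cmult mult_left_mono)
  thus ?thesis unfolding balanced_def by blast
qed

text \<open>
  The domination is rewritten as \<open>y + Q \<le> |x| + |w| + P\<close>, where all terms are nonnegative, and increments from
  \<open>L a\<close> to \<open>L b\<close> are compared. One unit of \<open>L = K + 1\<close> is spent on \<open>y\<close> or \<open>x\<close> and \<open>K\<close> units on \<open>Q\<close> or \<open>P\<close>.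
\<close>

lemma balanced_difference:
  assumes L1: "x \<in> L1" "y \<in> L1" "w \<in> L1" "P \<in> L1" "Q \<in> L1"
    and y: "nonneg_fun y" and bal: "balanced_by F K P Q"
    and le: "AE t in halfline. y t \<le> x t + w t + P t - Q t"
    and ab: "0 \<le> a" "a \<le> b"
  defines "L \<equiv> K + 1"
  shows "kyfan y b + F b - kyfan y (L * a) - F (L * a)
     \<le> kyfan x (L * b) + kyfan w (L * b) + F (L * b) - kyfan x a - F a"
proof -
  have PQ: "nonneg_fun P" "nonneg_fun Q" and K: "1 \<le> K"
    and F: "0 \<le> t \<Longrightarrow> kyfan P t \<le> F t" "0 \<le> t \<Longrightarrow> F t \<le> kyfan Q (K * t)"
      "0 \<le> t \<Longrightarrow> kyfan Q t \<le> F t" "0 \<le> t \<Longrightarrow> F t \<le> kyfan P (K * t)" for t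
    using bal unfolding balanced_by_def by auto
  have b: "0 \<le> b" and L: "1 \<le> L" using ab K unfolding L_def by auto
  let ?f = "\<lambda>t. y t + Q t" and ?x = "\<lambda>t. \<bar>x t\<bar>" and ?w = "\<lambda>t. \<bar>w t\<bar>"
  let ?xP = "\<lambda>t. \<bar>x t\<bar> + P t"
  let ?g = "\<lambda>t. (\<bar>x t\<bar> + P t) + \<bar>w t\<bar>"
  have in_L1: "?f \<in> L1" "?xP \<in> L1" "?g \<in> L1" "?x \<in> L1" "?w \<in> L1"
    by (intro L1_add L1_abs L1)+
  have nn: "nonneg_fun ?x" "nonneg_fun ?w" unfolding nonneg_fun_def by simp_all
  have xabs: "kyfan x t \<le> kyfan ?x t" and wabs: "kyfan ?w t \<le> kyfan w t" and xabs': "kyfan ?x t \<le> kyfan x t" for t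
    by (rule kyfan_mono_AE; use L1 in_L1 in simp)+
  have "AE t in halfline. \<bar>?f t\<bar> \<le> \<bar>?g t\<bar>"
    using le y PQ unfolding nonneg_fun_def by eventually_elim auto
  hence mono: "kyfan ?f (L * b) - kyfan ?f (L * a) \<le> kyfan ?g (L * b) - kyfan ?g (L * a)"
    by (rule kyfan_diff_mono[OF in_L1(1,3)]) (use ab L in \<open>auto intro: mult_left_mono\<close>)
  have 1: "kyfan y b + F b \<le> kyfan ?f (L * b)"
    using kyfan_add_ge[OF L1(2) y L1(5) PQ(2) b, of "K * b"] F(2)[OF b] b K
    unfolding L_def by (simp add: algebra_simps)
  have La: "0 \<le> L * a" and Lb: "0 \<le> L * b" using ab L by auto
  have 2: "kyfan ?f (L * a) \<le> kyfan y (L * a) + F (L * a)"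
    using kyfan_add_le[OF L1(2) L1(5), of "L * a"] F(3)[OF La] by linarith
  have 3: "kyfan ?g (L * b) \<le> kyfan x (L * b) + F (L * b) + kyfan w (L * b)"
    using kyfan_add_le[OF in_L1(2) in_L1(5), of "L * b"] kyfan_add_le[OF in_L1(4) L1(4), of "L * b"] F(1)[OF Lb]
      xabs'[of "L * b"] wabs[of "L * b"] by linarith
  have "kyfan x a + F a \<le> kyfan ?xP (L * a)"
    using kyfan_add_ge[OF in_L1(4) nn(1) L1(4) PQ(1) ab(1), of "K * a"] F(4)[OF ab(1)] ab K xabs[of a]
    unfolding L_def by (simp add: algebra_simps)
  also have "\<dots> \<le> kyfan ?g (L * a)"
    by (rule kyfan_mono_AE[OF in_L1(2,3)]) (use PQ in \<open>auto simp: nonneg_fun_def elim!: eventually_mono\<close>)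
  finally show ?thesis using mono 1 2 3 by linarith
qed

lemma telescope_geometric:
  fixes g :: "real \<Rightarrow> real"
  assumes "\<And>t. 0 \<le> t \<Longrightarrow> 0 \<le> g t" "0 \<le> a" "0 < L"
  shows "(\<Sum>j<n. g (L * (a / L ^ j)) - g (a / L ^ j)) \<le> g (L * a)"
proof -
  have "(\<Sum>j<n. g (L * (a / L ^ j)) - g (a / L ^ j)) = g (L * a) - g (L * (a / L ^ n))"
    using assms(3) by (induction n) (auto simp: field_simps)
  thus ?thesis using assms by simp
qed

text \<open>
  Summing the previous inequality over a geometric progression of scales with ratio \<open>L\<close>, every shift
  between a scale and its \<open>L\<close>-fold telescopes. In particular \<open>F\<close> disappears up to two boundary terms,
  whereas the defects \<open>kyfan x - kyfan y\<close> survive at all \<open>n\<close> scales.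
\<close>

lemma balanced_average:
  assumes L1: "x \<in> L1" "y \<in> L1" "w \<in> L1" "P \<in> L1" "Q \<in> L1"
    and y: "nonneg_fun y" and bal: "balanced_by F K P Q"
    and le: "AE t in halfline. y t \<le> x t + w t + P t - Q t"
    and yx: "\<And>t. 0 \<le> t \<Longrightarrow> kyfan y t \<le> kyfan x t"
    and ab: "0 \<le> a" "a \<le> b"
  defines "L \<equiv> K + 1"
  shows "(\<Sum>j<n. kyfan x (a / L ^ j) - kyfan y (a / L ^ j))
    \<le> (\<Sum>j<n. kyfan x (b / L ^ j) - kyfan y (b / L ^ j))
      + 2 * L * kyfan x b + (real n + L) * kyfan w b + 2 * K * L * kyfan Q b"
proof -
  have K: "1 \<le> K" and F: "0 \<le> t \<Longrightarrow> F t \<le> kyfan Q (K * t)" "0 \<le> t \<Longrightarrow> kyfan Q t \<le> F t" for t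
    using bal unfolding balanced_by_def by auto
  have L: "1 \<le> L" and b: "0 \<le> b" using K ab unfolding L_def by auto
  have F0: "0 \<le> t \<Longrightarrow> 0 \<le> F t" for t using F(2)[of t] kyfan_nonneg[of Q t] by linarith
  note tele = telescope_geometric[where L=L and n=n]
  have nonneg: "0 \<le> a / L ^ j" "a / L ^ j \<le> b / L ^ j" "0 \<le> b / L ^ j" for j
    using ab L b by (auto intro: divide_right_mono)
  have "(\<Sum>j<n. kyfan y (b / L ^ j) + F (b / L ^ j) - kyfan y (L * (a / L ^ j)) - F (L * (a / L ^ j)))
     \<le> (\<Sum>j<n. kyfan x (L * (b / L ^ j)) + kyfan w (L * (b / L ^ j)) + F (L * (b / L ^ j)) - kyfan x (a / L ^ j) - F (a / L ^ j))"
    unfolding L_def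
    by (rule sum_mono, rule balanced_difference[OF L1 y bal le]) (use nonneg in \<open>auto simp: L_def\<close>)
  hence "(\<Sum>j<n. kyfan x (a / L ^ j) - kyfan y (a / L ^ j)) \<le> (\<Sum>j<n. kyfan x (b / L ^ j) - kyfan y (b / L ^ j))
     + (\<Sum>j<n. kyfan y (L * (a / L ^ j)) - kyfan y (a / L ^ j)) + (\<Sum>j<n. kyfan x (L * (b / L ^ j)) - kyfan x (b / L ^ j))
     + (\<Sum>j<n. F (L * (b / L ^ j)) - F (b / L ^ j)) + (\<Sum>j<n. F (L * (a / L ^ j)) - F (a / L ^ j))
     + (\<Sum>j<n. kyfan w (L * (b / L ^ j)) - kyfan w (b / L ^ j)) + (\<Sum>j<n. kyfan w (b / L ^ j))"
    by (simp add: sum.distrib sum_subtractf algebra_simps)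
  moreover have "(\<Sum>j<n. kyfan y (L * (a / L ^ j)) - kyfan y (a / L ^ j)) \<le> L * kyfan x b"
  proof -
    have "(\<Sum>j<n. kyfan y (L * (a / L ^ j)) - kyfan y (a / L ^ j)) \<le> kyfan y (L * a)"
      by (rule tele) (use ab L in auto)
    also have "\<dots> \<le> L * kyfan y a" by (rule kyfan_dilate_le[OF L1(2) L])
    also have "kyfan y a \<le> kyfan x b"
      using yx[OF ab(1)] kyfan_mono[OF L1(1) ab(2)] by linarith
    finally show ?thesis using L by simp
  qed
  moreover have "(\<Sum>j<n. kyfan x (L * (b / L ^ j)) - kyfan x (b / L ^ j)) \<le> L * kyfan x b"
    using kyfan_dilate_le[OF L1(1) L, of b] b L by (intro order_trans[OF tele]) auto
  moreover have FL: "F (L * t) \<le> K * L * kyfan Q b" if t: "0 \<le> t" "t \<le> b" for t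
  proof -
    have "F (L * t) \<le> kyfan Q (K * (L * t))" using t L by (intro F) auto
    also have "\<dots> \<le> kyfan Q ((K * L) * b)" using t L K by (intro kyfan_mono[OF L1(5)]) (simp add: mult.assoc)
    also have "\<dots> \<le> (K * L) * kyfan Q b" using K L mult_mono[OF K L] by (intro kyfan_dilate_le[OF L1(5)]) simp
    finally show ?thesis .
  qed
  moreover have "(\<Sum>j<n. F (L * (b / L ^ j)) - F (b / L ^ j)) \<le> K * L * kyfan Q b"
    using F0 FL[OF b] b L by (intro order_trans[OF tele]) auto
  moreover have "(\<Sum>j<n. F (L * (a / L ^ j)) - F (a / L ^ j)) \<le> K * L * kyfan Q b"
    using F0 FL[OF ab] ab L by (intro order_trans[OF tele]) auto
  moreover have "(\<Sum>j<n. kyfan w (L * (b / L ^ j)) - kyfan w (b / L ^ j)) \<le> L * kyfan w b"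
    using kyfan_dilate_le[OF L1(3) L, of b] b L by (intro order_trans[OF tele]) auto
  moreover have "(\<Sum>j<n. kyfan w (b / L ^ j)) \<le> real n * kyfan w b"
  proof -
    have "kyfan w (b / L ^ j) \<le> kyfan w b" for j
      using L b one_le_power[OF L, of j] mult_left_mono[of 1 "L ^ j" b]
      by (intro kyfan_mono[OF L1(3)]) (auto simp: field_simps)
    thus ?thesis using sum_bounded_above[of "{..<n}" "\<lambda>j. kyfan w (b / L ^ j)" "kyfan w b"] by simp
  qed
  ultimately show ?thesis by (simp add: algebra_simps)
qed

section \<open>Positive symmetric functionals and a gauge\<close>

lemma L1_subset_L1_plus_Linf: "u \<in> L1 \<Longrightarrow> u \<in> L1_plus_Linf"
  unfolding L1_plus_Linf_def Linf_def
  by (intro CollectI bexI[of _ u] bexI[of _ "\<lambda>t. 0"]) auto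

locale symmetric_L1_space =
  fixes E :: "(real \<Rightarrow> real) set" and N :: "(real \<Rightarrow> real) \<Rightarrow> real"
  assumes fully_symmetric: "fully_symmetric_banach_space E N" and subset_L1: "E \<subseteq> L1"
begin

lemma in_L1: "u \<in> E \<Longrightarrow> u \<in> L1"
  using subset_L1 by auto

lemma linear_space_E: "linear_space E"
  using fully_symmetric unfolding fully_symmetric_banach_space_def function_subspace_def linear_space_def by auto

lemmas E_zero = linear_spaceD(1)[OF linear_space_E]
lemmas E_add = linear_spaceD(2)[OF linear_space_E]
lemmas E_cmult = linear_spaceD(3)[OF linear_space_E]
lemmas E_diff = linear_spaceD(5)[OF linear_space_E]

lemma N_nonneg: "u \<in> E \<Longrightarrow> 0 \<le> N u"
  and N_cmult: "u \<in> E \<Longrightarrow> N (\<lambda>t. c * u t) = \<bar>c\<bar> * N u"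
  and N_add: "u \<in> E \<Longrightarrow> v \<in> E \<Longrightarrow> N (\<lambda>t. u t + v t) \<le> N u + N v"
  using fully_symmetric unfolding fully_symmetric_banach_space_def norm_on_def by blast+

lemma N_zero: "N (\<lambda>t. 0) = 0"
  using N_cmult[OF E_zero, of 0] by simp

lemma kyfan_ideal:
  assumes "u \<in> E" "v \<in> L1" "\<And>t. 0 \<le> t \<Longrightarrow> kyfan v t \<le> kyfan u t"
  shows "v \<in> E" "N v \<le> N u"
proof -
  have "v \<prec>\<prec> u" using assms by (simp add: submajorized_iff_kyfan in_L1)
  thus "v \<in> E" "N v \<le> N u"
    using fully_symmetric assms(1) L1_subset_L1_plus_Linf[OF assms(2)]
    unfolding fully_symmetric_banach_space_def by blast+
qed

lemma kyfan_sum_dominator: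
  assumes u: "u \<in> E" and w: "w \<in> E"
  obtains h where "h \<in> E" "\<And>t. kyfan u t + kyfan w t \<le> kyfan h t" "N h \<le> N u + N w"
proof -
  have r: "rearr z \<in> E" "N (rearr z) \<le> N z" if "z \<in> E" for z
    using kyfan_ideal[OF that rearr_L1[OF in_L1[OF that]]] kyfan_rearr[OF in_L1[OF that]] by auto
  have "N (\<lambda>t. rearr u t + rearr w t) \<le> N (rearr u) + N (rearr w)" by (intro N_add r u w)
  also have "\<dots> \<le> N u + N w" by (intro add_mono r u w)
  finally show ?thesis
    using that[OF E_add[OF r(1)[OF u] r(1)[OF w]] kyfan_add_rearr[OF in_L1[OF u] in_L1[OF w]]] by blast
qed

text \<open>
  A linear functional lies below \<open>gauge\<close> only if it is nonpositive on nonpositive functions and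
  vanishes on differences of nonnegative equimeasurable functions, because both kinds of functions
  are dominated by \<open>w = 0\<close>.
\<close>

definition dominating :: "(real \<Rightarrow> real) \<Rightarrow> (real \<Rightarrow> real) set"
  where "dominating u = {w \<in> E. \<exists>P\<in>E. \<exists>Q\<in>E. balanced P Q \<and>
     (AE t in halfline. u t \<le> w t + P t - Q t)}"

definition gauge :: "(real \<Rightarrow> real) \<Rightarrow> real"
  where "gauge u = (INF w\<in>dominating u. N w)"

lemma zero_balanced: "balanced (\<lambda>t. 0) (\<lambda>t. 0)"
  by (rule balanced_equimeasurable) (auto simp: nonneg_fun_def)

lemma dominating_if_le:
  assumes "w \<in> E" "AE t in halfline. u t \<le> w t"
  shows "w \<in> dominating u"
  unfolding dominating_def using assms zero_balanced E_zero by (intro CollectI conjI bexI[of _ "\<lambda>t. 0"]) auto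

lemma gauge_le: "w \<in> dominating u \<Longrightarrow> gauge u \<le> N w"
  unfolding gauge_def
  by (rule cINF_lower) (auto intro!: bdd_belowI2[where m=0] simp: dominating_def N_nonneg)

lemma gauge_attained_approx:
  assumes "u \<in> E" "gauge u < c"
  obtains w where "w \<in> dominating u" "N w < c"
proof -
  have "dominating u \<noteq> {}" using dominating_if_le[of u u] assms(1) by auto
  hence "\<exists>w\<in>dominating u. N w < c" using assms(2) unfolding gauge_def
    by (subst (asm) cINF_less_iff) (auto intro!: bdd_belowI2[where m=0] simp: dominating_def N_nonneg)
  thus ?thesis using that by blast
qed

lemma gauge_sublinear: "sublinear_on E gauge"
  unfolding sublinear_on_def
proof (intro conjI ballI allI impI)
  fix u v assume u: "u \<in> E" and v: "v \<in> E"
  show "gauge (\<lambda>t. u t + v t) \<le> gauge u + gauge v"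
  proof (rule field_le_epsilon)
    fix e :: real assume e: "0 < e"
    obtain w where w: "w \<in> dominating u" "N w < gauge u + e / 2"
      using gauge_attained_approx[OF u, of "gauge u + e / 2"] e by auto
    obtain w' where w': "w' \<in> dominating v" "N w' < gauge v + e / 2"
      using gauge_attained_approx[OF v, of "gauge v + e / 2"] e by auto
    obtain P Q where P: "P \<in> E" "Q \<in> E" "balanced P Q" "AE t in halfline. u t \<le> w t + P t - Q t" and wE: "w \<in> E"
      using w(1) unfolding dominating_def by auto
    obtain P' Q' where P': "P' \<in> E" "Q' \<in> E" "balanced P' Q'" "AE t in halfline. v t \<le> w' t + P' t - Q' t" and wE': "w' \<in> E"
      using w'(1) unfolding dominating_def by auto
    have "balanced (\<lambda>t. P t + P' t) (\<lambda>t. Q t + Q' t)" using P P' by (intro balanced_add in_L1)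
    moreover have "AE t in halfline. u t + v t \<le> (w t + w' t) + (P t + P' t) - (Q t + Q' t)"
      using P(4) P'(4) by eventually_elim simp
    ultimately have "(\<lambda>t. w t + w' t) \<in> dominating (\<lambda>t. u t + v t)"
      unfolding dominating_def using E_add[OF wE wE'] E_add[OF P(1) P'(1)] E_add[OF P(2) P'(2)] by auto
    hence "gauge (\<lambda>t. u t + v t) \<le> N (\<lambda>t. w t + w' t)" by (rule gauge_le)
    also have "\<dots> \<le> N w + N w'" by (rule N_add[OF wE wE'])
    finally show "gauge (\<lambda>t. u t + v t) \<le> gauge u + gauge v + e" using w(2) w'(2) by simp
  qed
next
  fix c :: real and u assume c: "0 < c" and u: "u \<in> E"
  show "gauge (\<lambda>t. c * u t) \<le> c * gauge u"
  proof (rule field_le_epsilon)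
    fix e :: real assume e: "0 < e"
    obtain w where w: "w \<in> dominating u" "N w < gauge u + e / c"
      using gauge_attained_approx[OF u, of "gauge u + e / c"] e c by auto
    obtain P Q where P: "P \<in> E" "Q \<in> E" "balanced P Q" "AE t in halfline. u t \<le> w t + P t - Q t" and wE: "w \<in> E"
      using w(1) unfolding dominating_def by auto
    have "balanced (\<lambda>t. c * P t) (\<lambda>t. c * Q t)" using P c by (intro balanced_cmult in_L1) auto
    moreover have "AE t in halfline. c * u t \<le> c * w t + c * P t - c * Q t"
      using P(4)
    proof eventually_elim
      fix t assume "u t \<le> w t + P t - Q t"
      hence "c * u t \<le> c * (w t + P t - Q t)" using c by (intro mult_left_mono) auto
      thus "c * u t \<le> c * w t + c * P t - c * Q t" by (simp add: algebra_simps)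
    qed
    ultimately have "(\<lambda>t. c * w t) \<in> dominating (\<lambda>t. c * u t)"
      unfolding dominating_def using E_cmult wE P(1,2) by auto
    hence "gauge (\<lambda>t. c * u t) \<le> c * N w" using gauge_le N_cmult[OF wE, of c] c by fastforce
    also have "\<dots> \<le> c * (gauge u + e / c)" using w(2) c by (intro mult_left_mono) auto
    finally show "gauge (\<lambda>t. c * u t) \<le> c * gauge u + e" using c by (simp add: algebra_simps)
  qed
qed

lemma functional_below_gauge:
  assumes add: "\<And>u v. u \<in> E \<Longrightarrow> v \<in> E \<Longrightarrow> f (\<lambda>t. u t + v t) = f u + f v"
    and hom: "\<And>c u. u \<in> E \<Longrightarrow> f (\<lambda>t. c * u t) = c * f u"
    and le: "\<And>u. u \<in> E \<Longrightarrow> f u \<le> gauge u"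
  shows "positive_symmetric_functional E f"
proof -
  have diff: "f (\<lambda>t. u t - v t) = f u - f v" if "u \<in> E" "v \<in> E" for u v
    using add[OF that(1) E_cmult[OF that(2), of "-1"]] hom[OF that(2), of "-1"] by simp
  have zero: "f u \<le> 0" if "u \<in> E" "(\<lambda>t. 0) \<in> dominating u" for u
    using le[OF that(1)] gauge_le[OF that(2)] N_zero by linarith
  have mono: "f u \<le> f v" if "u \<in> E" "v \<in> E" "AE t in halfline. u t \<le> v t" for u v
    using zero[OF E_diff[OF that(1,2)] dominating_if_le[OF E_zero]] diff[OF that(1,2)] that(3) by simp
  have sym: "f u \<le> f v" if "u \<in> E" "v \<in> E" "nonneg_fun u" "nonneg_fun v" "\<And>t. 0 < t \<Longrightarrow> mu t u = mu t v" for u v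
  proof -
    have "(\<lambda>t. 0) \<in> dominating (\<lambda>t. u t - v t)"
      unfolding dominating_def using that balanced_equimeasurable[OF that(3-5)] E_zero by auto
    thus ?thesis using zero[OF E_diff[OF that(1,2)]] diff[OF that(1,2)] by simp
  qed
  have "f (\<lambda>t. 0) = 0" using hom[OF E_zero, of 0] by simp
  hence "positive_on E f" unfolding positive_on_def using mono[OF E_zero] by (auto simp: nonneg_fun_def)
  moreover have "symmetric_on E f" unfolding symmetric_on_def by (auto intro!: antisym sym)
  moreover have "linear_functional_on E f" unfolding linear_functional_on_def
    by (auto simp: add hom intro!: antisym mono elim: eventually_mono)
  ultimately show ?thesis unfolding positive_symmetric_functional_def by blast
qed

text \<open>
  The Hahn-Banach functional with \<open>f (y - x) = gauge (y - x)\<close> is positive and symmetric, so the hypothesis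
  gives \<open>gauge (y - x) \<le> 0\<close>.
\<close>

lemma approximate_domination:
  assumes x: "x \<in> E" and y: "y \<in> E" 
    and hyp: "\<And>f. positive_symmetric_functional E f \<Longrightarrow> f y \<le> f x" and e: "0 < e"
  obtains w P Q F K where "w \<in> E" "P \<in> E" "Q \<in> E" "N w < e" "balanced_by F K P Q"
    "AE t in halfline. y t \<le> x t + w t + P t - Q t"
proof -
  obtain f where f: "\<And>u v. u \<in> E \<Longrightarrow> v \<in> E \<Longrightarrow> f (\<lambda>t. u t + v t) = f u + f v"
    "\<And>c u. u \<in> E \<Longrightarrow> f (\<lambda>t. c * u t) = c * f u"
    "\<And>u. u \<in> E \<Longrightarrow> f u \<le> gauge u" "f (\<lambda>t. y t - x t) = gauge (\<lambda>t. y t - x t)"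
    using Hahn_Banach_sublinear[OF linear_space_E gauge_sublinear E_diff[OF y x]] by blast
  have "f (\<lambda>t. y t + (- 1) * x t) = f y + (- 1) * f x"
    using f(1)[OF y E_cmult[OF x, of "-1"]] f(2)[OF x, of "-1"] by simp
  hence "gauge (\<lambda>t. y t - x t) = f y - f x" using f(4) by simp
  also have "\<dots> < e" using hyp[OF functional_below_gauge[OF f(1-3)]] e by fastforce
  finally obtain w where w: "w \<in> dominating (\<lambda>t. y t - x t)" "N w < e"
    using gauge_attained_approx[OF E_diff[OF y x]] by blast
  then obtain P Q where PQ: "w \<in> E" "P \<in> E" "Q \<in> E" "balanced P Q" "AE t in halfline. y t - x t \<le> w t + P t - Q t"
    unfolding dominating_def by auto
  moreover have "AE t in halfline. y t \<le> x t + w t + P t - Q t" using PQ(5) by eventually_elim simp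
  ultimately show ?thesis using that w(2) unfolding balanced_def by blast
qed

end

section \<open>Defects created by averaging\<close>

text \<open>
  With \<open>L = K + 1\<close> and \<open>L^n \<le> M\<close>, the scales \<open>M b / L^j\<close> stay in \<open>[b, M b]\<close>, where the defect vanishes, and the scales
  \<open>b / (M L^j)\<close> stay in \<open>[b/M\<^sup>2, b/M]\<close>, where it is large. The boundary term \<open>2 L X(M b)\<close> of the averaged
  inequality is absorbed because \<open>X(M b) \<le> X(b/M\<^sup>2)/\<delta>\<close> and \<open>n \<ge> 8 L/\<delta>\<close>.
\<close>

lemma domination_at_scale:
  assumes L1: "x \<in> L1" "y \<in> L1" "w \<in> L1" "P \<in> L1" "Q \<in> L1"
    and y: "nonneg_fun y" and bal: "balanced_by F K P Q"
    and le: "AE t in halfline. y t \<le> x t + w t + P t - Q t"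
    and yx: "\<And>t. 0 \<le> t \<Longrightarrow> kyfan y t \<le> kyfan x t"
    and n: "0 < n" "K + 1 \<le> real n" "8 * (K + 1) / \<delta> \<le> real n" and \<delta>: "0 < \<delta>"
    and M: "(K + 1) ^ n \<le> M" and b: "0 < b"
    and good: "\<delta> * kyfan x (M * b) \<le> kyfan x (b / M\<^sup>2)"
    and eq: "\<And>t. b \<le> t \<Longrightarrow> t \<le> M * b \<Longrightarrow> kyfan y t = kyfan x t"
    and gap: "\<And>t. b / M\<^sup>2 \<le> t \<Longrightarrow> t \<le> b / M \<Longrightarrow> kyfan x (b / M\<^sup>2) / 2 \<le> kyfan x t - kyfan y t"
  shows "kyfan x (b / M\<^sup>2) \<le> 8 * kyfan w (M * b) + 8 * K * (K + 1) / real n * kyfan Q (M * b)"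
proof -
  let ?X = "kyfan x" and ?L = "K + 1" and ?s = "b / M\<^sup>2"
  have K: "1 \<le> K" using bal unfolding balanced_by_def by simp
  hence L: "1 \<le> ?L" by simp
  have M1: "1 \<le> M" using one_le_power[OF L, of n] M by linarith
  have pow: "1 \<le> ?L ^ j" "?L ^ j \<le> M" if "j < n" for j
    using one_le_power[OF L, of j] power_increasing[of j n ?L] that L M by auto
  have "real n * (?X ?s / 2) = (\<Sum>j<n. ?X ?s / 2)" by simp
  also have "\<dots> \<le> (\<Sum>j<n. ?X (b / M / ?L ^ j) - kyfan y (b / M / ?L ^ j))"
  proof (rule sum_mono)
    fix j assume "j \<in> {..<n}"
    hence j: "1 \<le> ?L ^ j" "?L ^ j \<le> M" using pow by auto
    have "b / M / M \<le> b / M / ?L ^ j" by (rule divide_left_mono) (use j b M1 in auto)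
    moreover have "b / M / ?L ^ j \<le> b / M / 1" by (rule divide_left_mono) (use j b M1 in auto)
    ultimately show "?X ?s / 2 \<le> ?X (b / M / ?L ^ j) - kyfan y (b / M / ?L ^ j)"
      by (intro gap) (simp_all add: power2_eq_square)
  qed
  also have "\<dots> \<le> (\<Sum>j<n. ?X (M * b / ?L ^ j) - kyfan y (M * b / ?L ^ j))
      + 2 * ?L * ?X (M * b) + (real n + ?L) * kyfan w (M * b) + 2 * K * ?L * kyfan Q (M * b)"
  proof (rule balanced_average[OF L1 y bal le yx])
    show "0 \<le> b / M" using b M1 by simp
    have "b / M \<le> b / 1" by (rule divide_left_mono) (use b M1 in auto)
    also have "\<dots> \<le> M * b" using b M1 by (simp add: mult_le_cancel_right1)
    finally show "b / M \<le> M * b" .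
  qed
  also have "(\<Sum>j<n. ?X (M * b / ?L ^ j) - kyfan y (M * b / ?L ^ j)) = 0"
  proof (rule sum.neutral, rule ballI)
    fix j assume "j \<in> {..<n}"
    hence j: "1 \<le> ?L ^ j" "?L ^ j \<le> M" using pow by auto
    have "M * b / M \<le> M * b / ?L ^ j" by (rule divide_left_mono) (use j b M1 in auto)
    moreover have "M * b / ?L ^ j \<le> M * b / 1" by (rule divide_left_mono) (use j b M1 in auto)
    ultimately show "?X (M * b / ?L ^ j) - kyfan y (M * b / ?L ^ j) = 0"
      using eq[of "M * b / ?L ^ j"] M1 by simp
  qed
  finally have 1: "real n * (?X ?s / 2) \<le> 2 * ?L * ?X (M * b) + (real n + ?L) * kyfan w (M * b) + 2 * K * ?L * kyfan Q (M * b)"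
    by simp
  have "2 * ?L * ?X (M * b) \<le> 2 * ?L * (?X ?s / \<delta>)"
    using good \<delta> L by (intro mult_left_mono) (auto simp: pos_le_divide_eq mult.commute)
  also have "\<dots> = (8 * ?L / \<delta>) * (?X ?s / 4)" using \<delta> by (simp add: field_simps)
  also have "\<dots> \<le> real n * (?X ?s / 4)" by (rule mult_right_mono[OF n(3)]) simp
  finally have 2: "2 * ?L * ?X (M * b) \<le> real n * (?X ?s / 4)" .
  have 3: "(real n + ?L) * kyfan w (M * b) \<le> (2 * real n) * kyfan w (M * b)"
    using n(2) by (intro mult_right_mono) auto
  have "real n * ?X ?s \<le> real n * (8 * kyfan w (M * b)) + 8 * K * ?L * kyfan Q (M * b)"
    using 1 2 3 by (simp add: algebra_simps)
  also have "\<dots> = real n * (8 * kyfan w (M * b) + 8 * K * ?L / real n * kyfan Q (M * b))"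
    using n(1) by (simp add: distrib_left)
  finally show ?thesis using n(1) by simp
qed

lemma nn_integral_le_by_pieces:
  fixes f g :: "'a \<Rightarrow> ennreal"
  assumes G: "countable G" and disj: "disjoint_family_on J G" and J: "\<And>p. p \<in> G \<Longrightarrow> J p \<in> sets M"
    and f: "f \<in> borel_measurable M" and g: "g \<in> borel_measurable M"
    and out: "\<And>t. t \<in> space M \<Longrightarrow> t \<notin> \<Union> (J ` G) \<Longrightarrow> f t \<le> g t"
    and on_piece: "\<And>p. p \<in> G \<Longrightarrow> (\<integral>\<^sup>+ t. f t * indicator (J p) t \<partial>M) \<le> (\<integral>\<^sup>+ t. g t * indicator (J p) t \<partial>M)"
  shows "(\<integral>\<^sup>+ t. f t \<partial>M) \<le> (\<integral>\<^sup>+ t. g t \<partial>M)"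
proof -
  let ?U = "\<Union> (J ` G)"
  have U: "?U \<in> sets M" using sets.countable_UN'[OF G, of J M] J by blast
  have split: "(\<integral>\<^sup>+ t. h t \<partial>M) = (\<integral>\<^sup>+ t. h t * indicator (space M - ?U) t \<partial>M) +
      (\<integral>\<^sup>+ p. (\<integral>\<^sup>+ t. h t * indicator (J p) t \<partial>M) \<partial>count_space G)"
    if h: "h \<in> borel_measurable M" for h
  proof -
    have "(\<integral>\<^sup>+ t. h t \<partial>M) = (\<integral>\<^sup>+ t. h t * indicator (space M - ?U) t + h t * indicator ?U t \<partial>M)"
      by (rule nn_integral_cong) (auto split: split_indicator)
    also have "\<dots> = (\<integral>\<^sup>+ t. h t * indicator (space M - ?U) t \<partial>M) + (\<integral>\<^sup>+ t. h t * indicator ?U t \<partial>M)"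
      using h U by (intro nn_integral_add borel_measurable_times_ennreal borel_measurable_indicator) auto
    also have "(\<integral>\<^sup>+ t. h t * indicator ?U t \<partial>M) = emeasure (density M h) ?U"
      by (rule emeasure_density[OF h U, symmetric])
    also have "\<dots> = (\<integral>\<^sup>+ p. emeasure (density M h) (J p) \<partial>count_space G)"
      by (rule emeasure_UN_countable[OF _ G disj]) (simp add: J)
    also have "\<dots> = (\<integral>\<^sup>+ p. (\<integral>\<^sup>+ t. h t * indicator (J p) t \<partial>M) \<partial>count_space G)"
      by (rule nn_integral_cong) (use emeasure_density[OF h J] in auto)
    finally show ?thesis .
  qed
  show ?thesis
    unfolding split[OF f] split[OF g]
  proof (rule add_mono)
    show "(\<integral>\<^sup>+ t. f t * indicator (space M - ?U) t \<partial>M) \<le> (\<integral>\<^sup>+ t. g t * indicator (space M - ?U) t \<partial>M)"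
      by (rule nn_integral_mono) (use out in \<open>auto split: split_indicator\<close>)
    show "(\<integral>\<^sup>+ p. (\<integral>\<^sup>+ t. f t * indicator (J p) t \<partial>M) \<partial>count_space G) \<le> (\<integral>\<^sup>+ p. (\<integral>\<^sup>+ t. g t * indicator (J p) t \<partial>M) \<partial>count_space G)"
      by (rule nn_integral_mono) (use on_piece in auto)
  qed
qed

text \<open>
  The function \<open>y\<close> is the conditional expectation of the rearrangement of \<open>x\<close> with respect to the
  partition given by the intervals. Jensen's inequality for \<open>(\<cdot> - s)\<^sup>+\<close> on each interval gives
  \<open>y \<prec>\<prec> x\<close>. Integrals up to a point outside the intervals are unchanged. For the last estimate, \<open>y\<close>
  is split at \<open>c\<close>: its integral before \<open>c\<close> is at most \<open>X(c)\<close>, and after \<open>c\<close> it is bounded by \<open>X(b)/b\<close>.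
\<close>

lemma averaging_on_intervals:
  fixes x :: "real \<Rightarrow> real" and G :: "(real \<times> real) set"
  assumes x: "x \<in> L1" and G: "countable G"
    and interval: "\<And>c b. (c, b) \<in> G \<Longrightarrow> 0 \<le> c \<and> c < b"
    and disj: "\<And>c b c' b'. (c, b) \<in> G \<Longrightarrow> (c', b') \<in> G \<Longrightarrow> (c, b) \<noteq> (c', b') \<Longrightarrow> b \<le> c' \<or> b' \<le> c"
  obtains y where "y \<in> L1" "nonneg_fun y" "\<forall>t\<ge>0. kyfan y t \<le> kyfan x t"
    "\<forall>t>0. (\<forall>(c, b)\<in>G. \<not> (c < t \<and> t < b)) \<longrightarrow> kyfan y t = kyfan x t"
    "\<forall>(c, b)\<in>G. \<forall>t\<ge>0. kyfan y t \<le> kyfan x c + t * (kyfan x b / b)"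
proof -
  let ?X = "kyfan x" and ?z = "rearr x"
  \<comment> \<open>The left end point may be 0, which does not belong to the half-line.\<close>
  define J where "J p = {fst p..<snd p} \<inter> {0<..}" for p :: "real \<times> real"
  define av where "av p = (?X (snd p) - ?X (fst p)) / (snd p - fst p)" for p :: "real \<times> real"
  define y where "y t = (if \<exists>p\<in>G. t \<in> J p then av (SOME p. p \<in> G \<and> t \<in> J p) else ?z t)" for t
  have JJ: "disjoint_family_on J G"
    unfolding disjoint_family_on_def J_def using disj by fastforce
  have y_in: "y t = av p" if "p \<in> G" "t \<in> J p" for p t
  proof -
    have "(SOME p. p \<in> G \<and> t \<in> J p) \<in> G \<and> t \<in> J (SOME p. p \<in> G \<and> t \<in> J p)"
      by (rule someI[of "\<lambda>p. p \<in> G \<and> t \<in> J p"]) (use that in simp)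
    hence "(SOME p. p \<in> G \<and> t \<in> J p) = p"
      using JJ that unfolding disjoint_family_on_def by blast
    thus ?thesis using that unfolding y_def by auto
  qed
  have y_out: "y t = ?z t" if "\<And>p. p \<in> G \<Longrightarrow> t \<notin> J p" for t
    using that unfolding y_def by auto
  have J_sets: "J p \<in> sets halfline" for p
    unfolding J_def by (subst sets_restrict_space_iff) auto
  have av_nonneg: "0 \<le> av p" if "p \<in> G" for p
    using kyfan_mono[OF x, of "fst p" "snd p"] interval[of "fst p" "snd p"] that unfolding av_def by simp
  have av_mult: "av (c, b) * (b - c) = ?X b - ?X c" if "(c, b) \<in> G" for c b
    using interval[OF that] unfolding av_def by simp
  have y_nonneg: "0 \<le> y t" for t
    using y_in y_out[of t] av_nonneg rearr_nonneg[of x t] by (cases "\<exists>p\<in>G. t \<in> J p") auto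
  note z_meas = rearr_measurable[OF x]
  have y_meas: "y \<in> borel_measurable halfline"
  proof (rule measurable_piecewise_restrict[where C="insert (space halfline - \<Union> (J ` G)) (J ` G)"])
    show "countable (insert (space halfline - \<Union> (J ` G)) (J ` G))" using G by simp
    have "\<Union> (J ` G) \<in> sets halfline" using sets.countable_UN'[OF G, of J halfline] J_sets by blast
    thus "\<Omega> \<inter> space halfline \<in> sets halfline" if "\<Omega> \<in> insert (space halfline - \<Union> (J ` G)) (J ` G)" for \<Omega>
      using that J_sets by auto
    show "space halfline \<subseteq> \<Union> (insert (space halfline - \<Union> (J ` G)) (J ` G))" by auto
    fix \<Omega> assume "\<Omega> \<in> insert (space halfline - \<Union> (J ` G)) (J ` G)"
    then consider "\<Omega> = space halfline - \<Union> (J ` G)" | p where "p \<in> G" "\<Omega> = J p" by auto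
    thus "y \<in> borel_measurable (restrict_space halfline \<Omega>)"
    proof cases
      case 1
      have "?z \<in> borel_measurable (restrict_space halfline \<Omega>)" by (rule measurable_restrict_space1[OF z_meas])
      thus ?thesis by (rule measurable_cong[THEN iffD2, rotated]) (use 1 y_out in \<open>auto simp: space_restrict_space\<close>)
    next
      case 2
      have "(\<lambda>t. av p) \<in> borel_measurable (restrict_space halfline \<Omega>)" by simp
      thus ?thesis by (rule measurable_cong[THEN iffD2, rotated]) (use 2 y_in in \<open>auto simp: space_restrict_space\<close>)
    qed
  qed
  have J_meas: "emeasure halfline (J (c, b)) = ennreal (b - c)" if "(c, b) \<in> G" for c b
  proof -
    have "emeasure halfline (J (c, b)) = emeasure lebesgue ({c..<b} \<inter> {0<..})"
      unfolding J_def by (subst emeasure_restrict_space) auto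
    also have "\<dots> = ennreal (b - c)"
    proof (cases "c = 0")
      case True
      hence "{c..<b} \<inter> {0<..} = {0<..<b}" by auto
      thus ?thesis using True interval[OF that] by simp
    next
      case False
      hence "{c..<b} \<inter> {0<..} = {c..<b}" using interval[OF that] by auto
      thus ?thesis using interval[OF that] by simp
    qed
    finally show ?thesis .
  qed
  have Jz: "(\<integral>\<^sup>+ t. ennreal (?z t) * indicator (J (c, b)) t \<partial>halfline) = ennreal (?X b - ?X c)" if "(c, b) \<in> G" for c b
  proof -
    have "(\<integral>\<^sup>+ t. ennreal (?z t) * indicator (J (c, b)) t \<partial>halfline) = (\<integral>\<^sup>+ t. ennreal (?z t) * indicator {c..<b} t \<partial>halfline)"
      by (rule nn_integral_cong) (auto simp: J_def split: split_indicator)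
    thus ?thesis using nn_integral_rearr_Ico[OF x, of c b] interval[OF that] by simp
  qed
  have Jconst: "(\<integral>\<^sup>+ t. h (y t) * indicator (J (c, b)) t \<partial>halfline) = h (av (c, b)) * ennreal (b - c)"
    if p: "(c, b) \<in> G" for c b and h :: "real \<Rightarrow> ennreal"
  proof -
    have "(\<integral>\<^sup>+ t. h (y t) * indicator (J (c, b)) t \<partial>halfline) = (\<integral>\<^sup>+ t. h (av (c, b)) * indicator (J (c, b)) t \<partial>halfline)"
      by (rule nn_integral_cong) (use y_in[OF p] in \<open>auto split: split_indicator\<close>)
    also have "\<dots> = h (av (c, b)) * ennreal (b - c)"
      by (simp add: nn_integral_cmult_indicator J_sets J_meas[OF p])
    finally show ?thesis .
  qed
  have excess_y: "excess y s \<le> excess x s" if s: "0 \<le> s" for s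
  proof -
    have "excess y s \<le> excess ?z s"
      unfolding excess_def
    proof (rule nn_integral_le_by_pieces[OF G JJ J_sets])
      show "(\<lambda>t. ennreal (\<bar>y t\<bar> - s)) \<in> borel_measurable halfline" "(\<lambda>t. ennreal (\<bar>?z t\<bar> - s)) \<in> borel_measurable halfline"
        using y_meas z_meas by measurable
      show "ennreal (\<bar>y t\<bar> - s) \<le> ennreal (\<bar>?z t\<bar> - s)" if "t \<notin> \<Union> (J ` G)" for t
        using y_out[of t] that by auto
      fix p assume p: "p \<in> G"
      obtain c b where cb: "p = (c, b)" by (cases p)
      have cb': "0 \<le> c" "c < b" using interval[of c b] p cb by auto
      let ?K = "\<integral>\<^sup>+ t. ennreal (\<bar>?z t\<bar> - s) * indicator (J p) t \<partial>halfline"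
      show "(\<integral>\<^sup>+ t. ennreal (\<bar>y t\<bar> - s) * indicator (J p) t \<partial>halfline) \<le> ?K"
      proof (cases "s \<le> av p")
        case True
        have "ennreal (?X b - ?X c) \<le> (\<integral>\<^sup>+ t. ennreal (\<bar>?z t\<bar> - s) * indicator (J p) t + ennreal s * indicator (J p) t \<partial>halfline)"
          unfolding Jz[OF p[unfolded cb], symmetric] cb
        proof (rule nn_integral_mono)
          fix t
          have "ennreal (?z t) \<le> ennreal (\<bar>?z t\<bar> - s) + ennreal s"
            using s rearr_nonneg[of x t]
            by (cases "s \<le> ?z t") (auto simp: ennreal_plus[symmetric] ennreal_neg simp del: ennreal_plus intro: ennreal_leI)
          thus "ennreal (?z t) * indicator (J (c, b)) t \<le> ennreal (\<bar>?z t\<bar> - s) * indicator (J (c, b)) t + ennreal s * indicator (J (c, b)) t"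
            by (simp split: split_indicator)
        qed
        also have "\<dots> = ?K + ennreal s * ennreal (b - c)"
        proof (subst nn_integral_add)
          have "(\<lambda>t. ennreal (\<bar>?z t\<bar> - s)) \<in> borel_measurable halfline" using z_meas by measurable
          thus "(\<lambda>t. ennreal (\<bar>?z t\<bar> - s) * indicator (J p) t) \<in> borel_measurable halfline"
            by (rule borel_measurable_times_ennreal[OF _ borel_measurable_indicator[OF J_sets]])
          show "(\<lambda>t. ennreal s * indicator (J p) t) \<in> borel_measurable halfline"
            by (rule borel_measurable_times_ennreal[OF _ borel_measurable_indicator[OF J_sets]]) simp
          show "?K + (\<integral>\<^sup>+ t. ennreal s * indicator (J p) t \<partial>halfline) = ?K + ennreal s * ennreal (b - c)"
            by (simp add: nn_integral_cmult_indicator J_sets J_meas[OF p[unfolded cb]] cb)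
        qed
        finally have "ennreal (?X b - ?X c) \<le> ?K + ennreal (s * (b - c))"
          using s cb' by (simp add: ennreal_mult)
        hence "ennreal (?X b - ?X c) - ennreal (s * (b - c)) \<le> ?K"
          by (simp add: ennreal_minus_le_iff add.commute)
        moreover have "ennreal (?X b - ?X c) - ennreal (s * (b - c)) = ennreal (?X b - ?X c - s * (b - c))"
          using s cb' by (intro ennreal_minus) simp
        moreover have "?X b - ?X c - s * (b - c) = (av p - s) * (b - c)"
          using av_mult[of c b] p cb by (simp add: left_diff_distrib)
        ultimately have K: "ennreal ((av p - s) * (b - c)) \<le> ?K" by simp
        have "(\<integral>\<^sup>+ t. ennreal (\<bar>y t\<bar> - s) * indicator (J p) t \<partial>halfline) = ennreal (\<bar>av p\<bar> - s) * ennreal (b - c)"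
          unfolding cb by (rule Jconst) (use p cb in simp)
        also have "\<dots> = ennreal ((av p - s) * (b - c))"
          using True av_nonneg[OF p] cb' by (simp add: ennreal_mult)
        finally show ?thesis using K by simp
      next
        case False
        have "(\<integral>\<^sup>+ t. ennreal (\<bar>y t\<bar> - s) * indicator (J p) t \<partial>halfline) = ennreal (\<bar>av p\<bar> - s) * ennreal (b - c)"
          unfolding cb by (rule Jconst) (use p cb in simp)
        thus ?thesis using False av_nonneg[OF p] by (simp add: ennreal_neg)
      qed
    qed
    thus ?thesis using excess_rearr[OF x s] by simp
  qed
  have y_L1: "y \<in> L1"
    using excess_y[of 0] excess_finite[OF x, of 0] y_meas
    unfolding L1_def integrable_iff_bounded excess_0 by (auto intro: le_less_trans)
  have le: "kyfan y t \<le> ?X t" for t by (rule kyfan_le_if_excess_le[OF x y_L1 excess_y])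
  have eq: "kyfan y t = ?X t" if t: "0 < t" and out: "\<And>c b. (c, b) \<in> G \<Longrightarrow> \<not> (c < t \<and> t < b)" for t
  proof (rule antisym[OF le])
    have It: "{0<..<t} \<in> sets halfline" by (subst sets_restrict_space_iff) auto
    have "ennreal (?X t) = (\<integral>\<^sup>+ r. ennreal (?z r) * indicator {0<..<t} r \<partial>halfline)"
      using ennreal_kyfan_rearr_integral[OF x, of t] t by simp
    also have "\<dots> \<le> (\<integral>\<^sup>+ r. ennreal (y r) * indicator {0<..<t} r \<partial>halfline)"
    proof (rule nn_integral_le_by_pieces[OF G JJ J_sets])
      show "(\<lambda>r. ennreal (?z r) * indicator {0<..<t} r) \<in> borel_measurable halfline" "(\<lambda>r. ennreal (y r) * indicator {0<..<t} r) \<in> borel_measurable halfline"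
        using y_meas z_meas It by (auto intro!: borel_measurable_times_ennreal borel_measurable_indicator)
      show "ennreal (?z r) * indicator {0<..<t} r \<le> ennreal (y r) * indicator {0<..<t} r" if "r \<notin> \<Union> (J ` G)" for r
        using y_out[of r] that by auto
      fix p assume p: "p \<in> G"
      obtain c b where cb: "p = (c, b)" by (cases p)
      have cb': "0 \<le> c" "c < b" using interval[of c b] p cb by auto
      show "(\<integral>\<^sup>+ r. ennreal (?z r) * indicator {0<..<t} r * indicator (J p) r \<partial>halfline)
         \<le> (\<integral>\<^sup>+ r. ennreal (y r) * indicator {0<..<t} r * indicator (J p) r \<partial>halfline)"
      proof (cases "b \<le> t")
        case True
        have "(\<integral>\<^sup>+ r. ennreal (?z r) * indicator {0<..<t} r * indicator (J p) r \<partial>halfline) = (\<integral>\<^sup>+ r. ennreal (?z r) * indicator (J p) r \<partial>halfline)"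
          by (rule nn_integral_cong) (use True in \<open>auto simp: J_def cb split: split_indicator\<close>)
        also have "\<dots> = ennreal (?X b - ?X c)" using Jz p cb by simp
        also have "?X b - ?X c = av p * (b - c)" using av_mult[of c b] p cb by simp
        also have "ennreal \<dots> = ennreal (av p) * ennreal (b - c)" using cb' av_nonneg[OF p] by (simp add: ennreal_mult)
        also have "\<dots> = (\<integral>\<^sup>+ r. ennreal (y r) * indicator (J p) r \<partial>halfline)"
          unfolding cb by (rule Jconst[symmetric]) (use p cb in simp)
        also have "\<dots> = (\<integral>\<^sup>+ r. ennreal (y r) * indicator {0<..<t} r * indicator (J p) r \<partial>halfline)"
          by (rule nn_integral_cong) (use True in \<open>auto simp: J_def cb split: split_indicator\<close>)
        finally show ?thesis by simp
      next
        case False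
        hence "t \<le> c" using out[of c b] p cb by auto
        have "(\<integral>\<^sup>+ r. ennreal (?z r) * indicator {0<..<t} r * indicator (J p) r \<partial>halfline) = (\<integral>\<^sup>+ r. 0 \<partial>halfline)"
          by (rule nn_integral_cong) (use \<open>t \<le> c\<close> in \<open>auto simp: J_def cb split: split_indicator\<close>)
        thus ?thesis by simp
      qed
    qed
    also have "\<dots> = (\<integral>\<^sup>+ r. ennreal \<bar>y r\<bar> * indicator {0<..<t} r \<partial>halfline)" using y_nonneg by simp
    also have "\<dots> \<le> ennreal (kyfan y t)" by (rule integral_Ioo_le_kyfan[OF y_L1]) (use t in simp)
    finally show "?X t \<le> kyfan y t" by (rule ennreal_le_ennrealD) simp
  qed
  have upper: "kyfan y t \<le> ?X c + t * (?X b / b)" if p: "(c, b) \<in> G" and t: "0 \<le> t" for c b t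
  proof -
    have cb: "0 \<le> c" "c < b" using interval[OF p] by auto
    hence b: "0 < b" by simp
    define y1 where "y1 r = y r * indicator {0<..<c} r" for r
    define y2 where "y2 r = y r * indicator ({c..} \<inter> {0<..}) r" for r
    have c_set: "{0<..<c} \<in> sets halfline" by (subst sets_restrict_space_iff) auto
    have c_set': "{c..} \<inter> {0<..} \<in> sets halfline" by (subst sets_restrict_space_iff) auto
    have y1: "y1 \<in> L1"
      using integrable_real_mult_indicator[OF c_set, of y] y_L1 unfolding L1_def y1_def by simp
    have y2: "y2 \<in> L1"
      using integrable_real_mult_indicator[OF c_set', of y] y_L1 unfolding L1_def y2_def by simp
    have "kyfan y t \<le> kyfan (\<lambda>r. y1 r + y2 r) t"
    proof (rule kyfan_mono_AE[OF y_L1 L1_add[OF y1 y2]])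
      show "AE r in halfline. \<bar>y r\<bar> \<le> \<bar>y1 r + y2 r\<bar>"
        by (rule AE_I2) (auto simp: y1_def y2_def split: split_indicator)
    qed
    also have "\<dots> \<le> kyfan y1 t + kyfan y2 t" by (rule kyfan_add_le[OF y1 y2])
    also have "kyfan y1 t \<le> ?X c"
    proof -
      have "ennreal (kyfan y1 t) \<le> excess y1 0" using kyfan_le[OF y1, of 0 t] t by simp
      also have "\<dots> = (\<integral>\<^sup>+ r. ennreal \<bar>y r\<bar> * indicator {0<..<c} r \<partial>halfline)"
        unfolding excess_0 by (rule nn_integral_cong) (auto simp: y1_def split: split_indicator)
      also have "\<dots> \<le> ennreal (kyfan y c)" by (rule integral_Ioo_le_kyfan[OF y_L1 cb(1)])
      also have "\<dots> \<le> ennreal (?X c)" by (intro ennreal_leI le)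
      finally show ?thesis by (rule ennreal_le_ennrealD) simp
    qed
    also have "kyfan y2 t \<le> (?X b / b) * t"
    proof (rule kyfan_le_bound[OF y2 _ _ t])
      show "0 \<le> ?X b / b" using b by simp
      have zb: "?z b \<le> ?X b / b" using rearr_mult_le_kyfan[OF x b] b by (simp add: field_simps)
      have "y r \<le> ?X b / b" if r: "0 < r" "c \<le> r" for r
      proof (cases "\<exists>p\<in>G. r \<in> J p")
        case False
        have "r \<notin> J (c, b)" using False p by auto
        hence "b \<le> r" using r unfolding J_def by auto
        hence "?z r \<le> ?z b" by (rule rearr_antimono[OF x b])
        thus ?thesis using y_out[of r] False zb by auto
      next
        case True
        then obtain c' b' where p': "(c', b') \<in> G" "r \<in> J (c', b')" by auto
        have cb': "0 \<le> c'" "c' < b'" using interval[OF p'(1)] by auto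
        show ?thesis
        proof (cases "(c', b') = (c, b)")
          case True
          have "c * ?X b \<le> b * ?X c"
          proof (cases "c = 0")
            case False
            hence "?X ((b / c) * c) \<le> (b / c) * ?X c" using cb by (intro kyfan_dilate_le[OF x]) simp
            thus ?thesis using False cb by (simp add: field_simps)
          qed (use b in simp)
          hence "av (c, b) \<le> ?X b / b" using cb b by (simp add: av_def field_simps)
          thus ?thesis using y_in[OF p'] True by simp
        next
          case False
          hence "b \<le> c'" using disj[OF p'(1) p] p'(2) r cb unfolding J_def by auto
          hence c': "0 < c'" using b by simp
          have "?X b' - ?X c' \<le> ?z c' * (b' - c')" using kyfan_supergradient[OF x c', of b'] cb' by simp
          hence "av (c', b') \<le> ?z c'" using cb' by (simp add: av_def field_simps)
          also have "\<dots> \<le> ?z b" by (rule rearr_antimono[OF x b \<open>b \<le> c'\<close>])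
          finally show ?thesis using y_in[OF p'] zb by simp
        qed
      qed
      thus "AE r in halfline. \<bar>y2 r\<bar> \<le> ?X b / b"
        using b y_nonneg by (intro AE_I2) (auto simp: y2_def split: split_indicator)
    qed
    finally show ?thesis by (simp add: mult.commute)
  qed
  have "nonneg_fun y" unfolding nonneg_fun_def using y_nonneg by simp
  show ?thesis
    by (rule that[OF y_L1 \<open>nonneg_fun y\<close>]) (use le eq upper in blast)+
qed

section \<open>Greedy choice of scales\<close>

fun greedy :: "(nat \<Rightarrow> bool) \<Rightarrow> (nat \<Rightarrow> nat \<Rightarrow> bool) \<Rightarrow> nat \<Rightarrow> bool"
  where "greedy g R p \<longleftrightarrow> g p \<and> (\<forall>q\<in>{..<p}. greedy g R q \<longrightarrow> R q p)"

declare greedy.simps [simp del]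

lemma greedyD: "greedy g R p \<Longrightarrow> g p" "greedy g R p \<Longrightarrow> q < p \<Longrightarrow> greedy g R q \<Longrightarrow> R q p"
  by (subst (asm) greedy.simps, simp)+

lemma not_greedyE:
  assumes "\<not> greedy g R p" "g p"
  obtains q where "q < p" "greedy g R q" "\<not> R q p"
  using assms by (subst (asm) greedy.simps) auto

lemma power_bracket:
  fixes M y :: real
  assumes "1 < M" "1 \<le> y"
  obtains p where "M ^ p \<le> y" "y < M ^ Suc p"
proof -
  let ?P = "\<lambda>n. y < M ^ n"
  have ex: "\<exists>n. ?P n" using real_arch_pow[OF assms(1)] by blast
  have "?P (LEAST n. ?P n)" using ex by (rule LeastI_ex)
  moreover have "(LEAST n. ?P n) \<noteq> 0" using calculation assms(2) by (metis not_le power_0)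
  ultimately obtain p where p: "(LEAST n. ?P n) = Suc p" "y < M ^ Suc p" by (metis not0_implies_Suc)
  have "\<not> ?P p" by (rule not_less_Least) (simp add: p(1))
  thus ?thesis using that p(2) by (simp add: not_less)
qed

text \<open>
  Scales \<open>b = \<sigma> M^p\<close> are good when \<open>X(b/M\<^sup>2)\<close> is not negligible against \<open>X(M b)\<close>; among the good
  ones, a scale is selected if \<open>X\<close> has grown by a factor 8 since every previously selected scale. For \<open>t\<close> in
  the range, let \<open>b\<close> be the scale with \<open>M\<^sup>2 b \<le> t < M\<^sup>3 b\<close>. If \<open>b\<close> is not good, \<open>X(t/M^5)\<close> is below
  \<open>\<delta> X(t)\<close>. If it is good but not selected, some selected smaller scale \<open>c\<close> satisfies \<open>X(b/M\<^sup>2) < 8 X(M c)\<close>, and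
  \<open>X(M c) \<le> X(c/M\<^sup>2)/\<delta>\<close> as \<open>c\<close> is good, so the bound for \<open>W\<close> at \<open>M c \<le> t\<close> applies. Working from small to
  large scales matters here: \<open>W\<close> is increasing, so only smaller scales help.
\<close>

lemma greedy_scales:
  assumes x: "x \<in> L1" and \<delta>: "0 < \<delta>" "\<delta> \<le> 1" and M: "1 < M" and \<sigma>: "0 < \<sigma>"
  obtains T where "countable T" "\<forall>b\<in>T. \<sigma> \<le> b \<and> M\<^sup>2 * b \<le> r \<and> \<delta> * kyfan x (M * b) \<le> kyfan x (b / M\<^sup>2)"
    "\<forall>b\<in>T. \<forall>b'\<in>T. b < b' \<longrightarrow> 8 * kyfan x (M * b) \<le> kyfan x (b' / M\<^sup>2)"
    "\<forall>W b. (\<forall>c\<in>T. kyfan x (c / M\<^sup>2) \<le> W (M * c)) \<longrightarrow> mono_on {0..} W \<longrightarrow> (\<forall>t. 0 \<le> W t) \<longrightarrow>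
       M\<^sup>2 * \<sigma> \<le> b \<longrightarrow> b \<le> r \<longrightarrow> kyfan x (b / M ^ 5) \<le> \<delta> * kyfan x b + (8 / \<delta>) * W b"
proof -
  let ?X = "kyfan x"
  define pt where "pt p = \<sigma> * M ^ p" for p :: nat
  define good where "good p \<longleftrightarrow> M\<^sup>2 * pt p \<le> r \<and> \<delta> * ?X (M * pt p) \<le> ?X (pt p / M\<^sup>2)" for p
  define sep where "sep q p \<longleftrightarrow> 8 * ?X (M * pt q) \<le> ?X (pt p / M\<^sup>2)" for q p
  define T where "T = pt ` {p. greedy good sep p}"
  have pt_pos: "0 < pt p" for p using \<sigma> M by (simp add: pt_def)
  have pt_less: "pt q < pt p \<longleftrightarrow> q < p" for p q using \<sigma> M by (simp add: pt_def)
  have X_mono: "s \<le> t \<Longrightarrow> ?X s \<le> ?X t" for s t by (rule kyfan_mono[OF x])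
  have T_good: "\<sigma> \<le> b \<and> M\<^sup>2 * b \<le> r \<and> \<delta> * ?X (M * b) \<le> ?X (b / M\<^sup>2)" if "b \<in> T" for b
  proof -
    obtain p where p: "b = pt p" "good p" using \<open>b \<in> T\<close> greedyD(1) unfolding T_def by blast
    have "\<sigma> * 1 \<le> \<sigma> * M ^ p" using \<sigma> M by (intro mult_left_mono one_le_power) auto
    thus ?thesis using p unfolding good_def by (simp add: pt_def)
  qed
  show ?thesis
  proof (rule that[of T])
    show "countable T" unfolding T_def by simp
    show "\<forall>b\<in>T. \<sigma> \<le> b \<and> M\<^sup>2 * b \<le> r \<and> \<delta> * ?X (M * b) \<le> ?X (b / M\<^sup>2)" using T_good by blast
    show "\<forall>b\<in>T. \<forall>b'\<in>T. b < b' \<longrightarrow> 8 * ?X (M * b) \<le> ?X (b' / M\<^sup>2)"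
    proof (intro ballI impI)
      fix b b' assume "b \<in> T" "b' \<in> T" "b < b'"
      then obtain q p where "b = pt q" "b' = pt p" "greedy good sep q" "greedy good sep p" "q < p"
        unfolding T_def using pt_less by blast
      thus "8 * ?X (M * b) \<le> ?X (b' / M\<^sup>2)"
        using greedyD(2)[of good sep p q] by (simp add: sep_def)
    qed
    show "\<forall>W b. (\<forall>c\<in>T. ?X (c / M\<^sup>2) \<le> W (M * c)) \<longrightarrow> mono_on {0..} W \<longrightarrow> (\<forall>t. 0 \<le> W t) \<longrightarrow>
       M\<^sup>2 * \<sigma> \<le> b \<longrightarrow> b \<le> r \<longrightarrow> ?X (b / M ^ 5) \<le> \<delta> * ?X b + (8 / \<delta>) * W b"
    proof (intro allI impI)
      fix W :: "real \<Rightarrow> real" and b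
      assume W0: "\<forall>c\<in>T. ?X (c / M\<^sup>2) \<le> W (M * c)" "mono_on {0..} W" "\<forall>t. 0 \<le> W t" and b: "M\<^sup>2 * \<sigma> \<le> b" "b \<le> r"
      have W: "\<And>c. c \<in> T \<Longrightarrow> ?X (c / M\<^sup>2) \<le> W (M * c)" "mono_on {0..} W" "\<And>t. 0 \<le> W t" using W0 by auto
      have "1 \<le> b / (M\<^sup>2 * \<sigma>)" using b M \<sigma> by (simp add: field_simps)
      then obtain p where p: "M ^ p \<le> b / (M\<^sup>2 * \<sigma>)" "b / (M\<^sup>2 * \<sigma>) < M ^ Suc p"
        using power_bracket[OF M] by blast
      have pb: "M\<^sup>2 * pt p \<le> b" using p(1) M \<sigma> by (simp add: pt_def field_simps)
      have "b < M ^ 3 * pt p" using p(2) M \<sigma> by (simp add: pt_def field_simps eval_nat_numeral)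
      hence "b / M ^ 5 \<le> pt p / M\<^sup>2" using M by (simp add: field_simps eval_nat_numeral)
      hence Xb: "?X (b / M ^ 5) \<le> ?X (pt p / M\<^sup>2)" by (rule X_mono)
      have b0: "0 \<le> b" using pb pt_pos[of p] M by (meson less_imp_le mult_nonneg_nonneg order_trans zero_le_power2)
      have Mpt: "M * pt q \<le> b" if "q \<le> p" for q
      proof -
        have "M * pt q \<le> M * pt p" using pt_less[of p q] that M by (intro mult_left_mono) (auto simp: not_less[symmetric])
        also have "\<dots> \<le> M\<^sup>2 * pt p" using M pt_pos[of p] by (simp add: power2_eq_square)
        finally show ?thesis using pb by simp
      qed
      have W_le: "?X (pt q / M\<^sup>2) \<le> W b" if "greedy good sep q" "q \<le> p" for q
      proof -
        have "?X (pt q / M\<^sup>2) \<le> W (M * pt q)" using that by (intro W(1)) (simp add: T_def)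
        also have "\<dots> \<le> W b" using M pt_pos[of q] Mpt[OF that(2)] b0 by (intro mono_onD[OF W(2)]) auto
        finally show ?thesis .
      qed
      have W_coef: "W b \<le> 8 / \<delta> * W b"
        using \<delta> W(3)[of b] mult_right_mono[of 1 "8 / \<delta>" "W b"] by (simp add: field_simps)
      show "?X (b / M ^ 5) \<le> \<delta> * ?X b + (8 / \<delta>) * W b"
      proof (cases "good p")
        case False
        hence "?X (pt p / M\<^sup>2) \<le> \<delta> * ?X (M * pt p)" using pb b unfolding good_def by auto
        also have "\<dots> \<le> \<delta> * ?X b" using Mpt[of p] \<delta> by (intro mult_left_mono X_mono) auto
        finally show ?thesis using Xb W_coef W(3)[of b] by linarith
      next
        case good: True
        have dX: "0 \<le> \<delta> * ?X b" using \<delta> by simp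
        show ?thesis
        proof (cases "greedy good sep p")
          case True
          thus ?thesis using W_le[of p] Xb W_coef dX by linarith
        next
          case False
          then obtain q where q: "q < p" "greedy good sep q" "\<not> sep q p"
            using not_greedyE[OF False good] by blast
          have "?X (pt p / M\<^sup>2) \<le> 8 * ?X (M * pt q)" using q(3) unfolding sep_def by simp
          also have "\<delta> * ?X (M * pt q) \<le> ?X (pt q / M\<^sup>2)" using greedyD(1)[OF q(2)] by (simp add: good_def)
          hence "8 * ?X (M * pt q) \<le> 8 / \<delta> * ?X (pt q / M\<^sup>2)" using \<delta> by (simp add: field_simps)
          also have "\<dots> \<le> 8 / \<delta> * W b" using W_le[OF q(2)] q(1) \<delta> by (intro mult_left_mono) auto
          finally show ?thesis using Xb dX by linarith
        qed
      qed
    qed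
  qed
qed

section \<open>Cut dilates\<close>

definition cut_dilate :: "(real \<Rightarrow> real) \<Rightarrow> real \<Rightarrow> real \<Rightarrow> real \<Rightarrow> real"
  where "cut_dilate x m a t = 1 / m * rearr x (t / m) * indicator {a<..<1} t"

lemma kyfan_dilate_rearr:
  assumes x: "x \<in> L1" and m: "0 < m"
  defines "f \<equiv> \<lambda>t. 1 / m * rearr x (t / m)"
  shows "f \<in> L1" "0 \<le> t \<Longrightarrow> kyfan f t \<le> kyfan x (t / m)"
proof -
  have f_meas: "f \<in> borel_measurable halfline"
    by (rule antimono_on_measurable(2))
      (use m in \<open>auto simp: f_def intro!: divide_right_mono rearr_antimono[OF x]\<close>)
  have ex: "excess f (s / m) = excess x s" if s: "0 \<le> s" for s
  proof -
    let ?g = "\<lambda>r. ennreal (\<bar>rearr x r\<bar> - s) * indicator {0<..} r"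
    have "(\<lambda>r. ennreal (\<bar>rearr x r\<bar> - s)) \<in> borel_measurable halfline"
      using rearr_measurable[OF x] by measurable
    hence g: "?g \<in> borel_measurable lebesgue"
      by (subst (asm) borel_measurable_restrict_space_iff_ennreal) simp_all
    have "excess x s = excess (rearr x) s" by (rule excess_rearr[OF x s, symmetric])
    also have "\<dots> = (\<integral>\<^sup>+ r. ?g r \<partial>lebesgue)"
      unfolding excess_def by (subst nn_integral_restrict_space) auto
    also have "\<dots> = ennreal \<bar>1 / m\<bar> * (\<integral>\<^sup>+ r. ?g (0 + 1 / m * r) \<partial>lebesgue)"
      by (rule nn_integral_real_affine_lebesgue[OF g]) (use m in simp)
    also have "\<dots> = (\<integral>\<^sup>+ r. ennreal \<bar>1 / m\<bar> * ?g (0 + 1 / m * r) \<partial>lebesgue)"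
    proof (rule nn_integral_cmult[symmetric])
      show "(\<lambda>r. ?g (0 + 1 / m * r)) \<in> borel_measurable lebesgue"
        using measurable_compose[OF lebesgue_measurable_scaling[of "1 / m"] g] by simp
    qed
    also have "\<dots> = (\<integral>\<^sup>+ r. ennreal (\<bar>f r\<bar> - s / m) * indicator {0<..} r \<partial>lebesgue)"
    proof (rule nn_integral_cong)
      fix r :: real
      have "ennreal \<bar>1 / m\<bar> * ennreal (\<bar>rearr x (r / m)\<bar> - s) = ennreal (\<bar>f r\<bar> - s / m)"
        using m by (simp add: ennreal_mult'[symmetric] f_def abs_mult diff_divide_distrib)
      moreover have "0 < r / m \<longleftrightarrow> 0 < r" using m by (simp add: zero_less_divide_iff)
      ultimately show "ennreal \<bar>1 / m\<bar> * ?g (0 + 1 / m * r) = ennreal (\<bar>f r\<bar> - s / m) * indicator {0<..} r"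
        by (simp add: indicator_def)
    qed
    also have "\<dots> = excess f (s / m)"
      unfolding excess_def by (subst nn_integral_restrict_space) auto
    finally show ?thesis ..
  qed
  have "excess f 0 < \<infinity>" using ex[of 0] excess_finite[OF x, of 0] by simp
  thus f_L1: "f \<in> L1"
    using f_meas unfolding L1_def integrable_iff_bounded excess_0 by simp
  assume t: "0 \<le> t"
  show "kyfan f t \<le> kyfan x (t / m)"
  proof (cases "t = 0")
    case False
    then obtain s where s: "0 \<le> s" "ennreal (kyfan x (t / m)) = excess x s + ennreal (s * (t / m))"
      using kyfan_attained[OF x, of "t / m"] t m by auto
    have "ennreal (kyfan f t) \<le> excess f (s / m) + ennreal (s / m * t)"
      by (rule kyfan_le[OF f_L1]) (use s m t in auto)
    also have "\<dots> = ennreal (kyfan x (t / m))" using s ex[OF s(1)] by simp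
    finally show ?thesis by (rule ennreal_le_ennrealD) simp
  qed simp
qed

lemma cut_dilate_L1:
  assumes x: "x \<in> L1" and m: "0 < m" and a: "0 \<le> a"
  shows "cut_dilate x m a \<in> L1"
proof -
  have "{a<..<1} \<in> sets halfline" using a by (subst sets_restrict_space_iff) auto
  thus ?thesis
    using integrable_real_mult_indicator[of "{a<..<1}" halfline "\<lambda>t. 1 / m * rearr x (t / m)"] kyfan_dilate_rearr(1)[OF x m]
    unfolding L1_def cut_dilate_def by simp
qed

lemma kyfan_cut_dilate_le:
  assumes x: "x \<in> L1" and m: "0 < m" and a: "0 \<le> a" and t: "0 \<le> t"
  shows "kyfan (cut_dilate x m a) t \<le> kyfan x (t / m)"
proof -
  have "kyfan (cut_dilate x m a) t \<le> kyfan (\<lambda>t. 1 / m * rearr x (t / m)) t"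
    by (rule kyfan_mono_AE[OF cut_dilate_L1[OF x m a] kyfan_dilate_rearr(1)[OF x m]])
      (auto simp: cut_dilate_def split: split_indicator)
  thus ?thesis using kyfan_dilate_rearr(2)[OF x m t] by simp
qed

lemma kyfan_cut_dilate_after_1:
  assumes x: "x \<in> L1" and m: "0 < m" and a: "0 \<le> a" and t: "0 \<le> t"
  shows "kyfan (cut_dilate x m a) t \<le> kyfan (cut_dilate x m a) 1"
proof -
  note v = cut_dilate_L1[OF x m a]
  have "ennreal (kyfan (cut_dilate x m a) t) \<le> excess (cut_dilate x m a) 0"
    using kyfan_le[OF v, of 0 t] t by simp
  also have "\<dots> = (\<integral>\<^sup>+ r. ennreal \<bar>cut_dilate x m a r\<bar> * indicator {0<..<1} r \<partial>halfline)"
    unfolding excess_0 by (rule nn_integral_cong) (auto simp: cut_dilate_def split: split_indicator)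
  also have "\<dots> \<le> ennreal (kyfan (cut_dilate x m a) 1)" by (rule integral_Ioo_le_kyfan[OF v]) simp
  finally show ?thesis by (rule ennreal_le_ennrealD) simp
qed

text \<open>
  A dilate cut off below \<open>a\<close> is bounded by its value at \<open>a\<close>. Hence below \<open>a\<close> its function is dominated by a
  chord of \<open>X(t/m)\<close>, and an estimate at \<open>a\<close> extends to all smaller arguments.
\<close>

lemma kyfan_cut_dilate_linear:
  assumes x: "x \<in> L1" and m: "0 < m" and a: "0 < a" and t: "0 \<le> t"
  shows "kyfan (cut_dilate x m a) t \<le> kyfan x (a / m) / a * t"
proof (rule kyfan_le_bound[OF cut_dilate_L1[OF x m less_imp_le[OF a]] _ _ t])
  show "0 \<le> kyfan x (a / m) / a" using a by simp
  have am: "0 < a / m" using a m by simp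
  have "1 / m * rearr x (r / m) \<le> kyfan x (a / m) / a" if "a < r" for r
  proof -
    have "rearr x (r / m) \<le> rearr x (a / m)" using that m am by (intro rearr_antimono[OF x]) (auto intro: divide_right_mono)
    also have "\<dots> \<le> kyfan x (a / m) / (a / m)" using rearr_mult_le_kyfan[OF x am] by (simp only: pos_le_divide_eq[OF am])
    finally show ?thesis using m a by (simp add: field_simps)
  qed
  thus "AE r in halfline. \<bar>cut_dilate x m a r\<bar> \<le> kyfan x (a / m) / a"
    using a m by (intro AE_I2) (auto simp: cut_dilate_def rearr_nonneg split: split_indicator)
qed

definition quasiconcave :: "(real \<Rightarrow> real) \<Rightarrow> bool"
  where "quasiconcave W \<longleftrightarrow> (\<forall>t. 0 \<le> W t) \<and> mono_on {0..} W \<and> (\<forall>b c. 0 \<le> b \<longrightarrow> b \<le> c \<longrightarrow> 0 < c \<longrightarrow> b / c * W c \<le> W b)"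

lemma quasiconcave_kyfan: "u \<in> L1 \<Longrightarrow> quasiconcave (kyfan u)"
  unfolding quasiconcave_def
proof (intro conjI allI impI)
  assume u: "u \<in> L1"
  show "0 \<le> kyfan u t" for t by simp
  show "mono_on {0..} (kyfan u)" by (rule mono_onI) (rule kyfan_mono[OF u])
  fix b c :: real assume b: "0 \<le> b" "b \<le> c" and c: "0 < c"
  show "b / c * kyfan u c \<le> kyfan u b"
  proof (cases "b = 0")
    case False
    hence "kyfan u ((c / b) * b) \<le> (c / b) * kyfan u b" using b by (intro kyfan_dilate_le[OF u]) simp
    thus ?thesis using False b c by (simp add: field_simps)
  qed simp
qed

lemma quasiconcave_combination:
  assumes "quasiconcave V" "quasiconcave W" "0 \<le> p" "0 \<le> q"
  shows "quasiconcave (\<lambda>t. p * V t + q * W t)"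
  unfolding quasiconcave_def
proof (intro conjI allI impI)
  show "0 \<le> p * V t + q * W t" for t using assms unfolding quasiconcave_def by auto
  show "mono_on {0..} (\<lambda>t. p * V t + q * W t)"
    using assms unfolding quasiconcave_def mono_on_def by (auto intro!: add_mono mult_left_mono)
  fix b c :: real assume b: "0 \<le> b" "b \<le> c" "0 < c"
  have "b / c * V c \<le> V b" "b / c * W c \<le> W b"
    using assms(1,2) b unfolding quasiconcave_def by blast+
  hence "p * (b / c * V c) \<le> p * V b" "q * (b / c * W c) \<le> q * W b"
    using assms(3,4) by (blast intro: mult_left_mono)+
  thus "b / c * (p * V c + q * W c) \<le> p * V b + q * W b" by (simp add: algebra_simps)
qed

text \<open>
  The point \<open>c\<close> is the supremum of all \<open>c'\<close> with \<open>8 X(c') \<le> X(s)\<close>. The weaker constant 4 at \<open>c\<close> itself replaces an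
  appeal to continuity and only uses \<open>X(c) \<le> 2 X(c/2)\<close>.
\<close>

lemma cut_point:
  assumes x: "x \<in> L1" and s: "0 < s" "0 < kyfan x s"
  obtains c where "0 \<le> c" "c \<le> s" "kyfan x c \<le> kyfan x s / 4" 
    "\<And>c'. 0 \<le> c' \<Longrightarrow> 8 * kyfan x c' \<le> kyfan x s \<Longrightarrow> c' \<le> c"
proof -
  define A where "A = {c. 0 \<le> c \<and> 8 * kyfan x c \<le> kyfan x s}"
  have bound: "c \<le> s" if "c \<in> A" for c
  proof (rule ccontr)
    assume "\<not> c \<le> s"
    hence "kyfan x s \<le> kyfan x c" by (intro kyfan_mono[OF x]) simp
    thus False using that s(2) unfolding A_def by auto
  qed
  have bdd: "bdd_above A" using bound by (rule bdd_aboveI)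
  have zero: "0 \<in> A" using s unfolding A_def by simp
  have sup_ge: "c \<le> Sup A" if "c \<in> A" for c by (rule cSup_upper[OF that bdd])
  show ?thesis
  proof (rule that[of "Sup A"])
    show nonneg: "0 \<le> Sup A" by (rule sup_ge[OF zero])
    show "Sup A \<le> s" by (rule cSup_least) (use zero bound in auto)
    show "c' \<le> Sup A" if "0 \<le> c'" "8 * kyfan x c' \<le> kyfan x s" for c'
      using that by (intro sup_ge) (simp add: A_def)
    show "kyfan x (Sup A) \<le> kyfan x s / 4"
    proof (cases "Sup A = 0")
      case False
      hence "Sup A / 2 < Sup A" using nonneg by simp
      then obtain c where c: "c \<in> A" "Sup A / 2 < c" using less_cSup_iff[OF _ bdd] zero by blast
      have "kyfan x (Sup A) \<le> 2 * kyfan x (Sup A / 2)" using kyfan_dilate_le[OF x, of 2 "Sup A / 2"] by simp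
      also have "kyfan x (Sup A / 2) \<le> kyfan x c" using c(2) by (intro kyfan_mono[OF x]) simp
      finally show ?thesis using c(1) unfolding A_def by simp
    qed (use s in simp)
  qed
qed

section \<open>Blocks of scales in a space with a Fatou norm\<close>

locale Fatou_symmetric_L1_space = symmetric_L1_space +
  assumes Fatou: "fatou_norm E N"
begin

lemma cut_dilate_E:
  assumes x: "x \<in> E" and m: "1 \<le> m" and a: "0 \<le> a"
  shows "cut_dilate x m a \<in> E"
proof (rule kyfan_ideal(1)[OF x])
  show "cut_dilate x m a \<in> L1" using m by (intro cut_dilate_L1[OF in_L1[OF x] _ a]) simp
  fix t :: real assume t: "0 \<le> t"
  have "kyfan (cut_dilate x m a) t \<le> kyfan x (t / m)" using m by (intro kyfan_cut_dilate_le[OF in_L1[OF x] _ a t]) simp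
  also have "\<dots> \<le> kyfan x t" using t m by (intro kyfan_mono[OF in_L1[OF x]]) (simp add: divide_le_eq mult_le_cancel_left1)
  finally show "kyfan (cut_dilate x m a) t \<le> kyfan x t" .
qed

text \<open>
  The functions cut at \<open>r/(n+1)\<close> converge pointwise to the full one. If all their norms were at most
  \<open>\<eta>/2\<close>, so would be the norm of the limit.
\<close>

lemma Fatou_cut:
  assumes x: "x \<in> E" and m: "1 \<le> m" and \<eta>: "0 < \<eta>" "\<eta> \<le> N (cut_dilate x m 0)" and r: "0 < r"
  obtains a where "0 < a" "a \<le> r" "\<eta> / 2 < N (cut_dilate x m a)"
proof -
  have "\<exists>a. 0 < a \<and> a \<le> r \<and> \<eta> / 2 < N (cut_dilate x m a)"
  proof (rule ccontr)
    assume neg: "\<not> ?thesis"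
    define a where "a n = r / real (Suc n)" for n
    have a: "0 < a n" "a n \<le> r" for n using r by (auto simp: a_def divide_le_eq mult_le_cancel_left1)
    have small: "N (cut_dilate x m (a n)) \<le> \<eta> / 2" for n using neg a[of n] by (auto simp: not_less)
    have inE: "cut_dilate x m (a n) \<in> E" for n using cut_dilate_E[OF x m] a(1)[of n] by simp
    have "N (\<lambda>t. (2 / \<eta>) * cut_dilate x m 0 t) \<le> 1"
    proof -
      have "\<forall>n. (\<lambda>t. (2 / \<eta>) * cut_dilate x m (a n) t) \<in> E \<and> N (\<lambda>t. (2 / \<eta>) * cut_dilate x m (a n) t) \<le> 1"
      proof (intro allI conjI)
        fix n
        show "(\<lambda>t. (2 / \<eta>) * cut_dilate x m (a n) t) \<in> E" by (rule E_cmult[OF inE])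
        have "(2 / \<eta>) * N (cut_dilate x m (a n)) \<le> (2 / \<eta>) * (\<eta> / 2)"
          by (rule mult_left_mono[OF small]) (use \<eta> in simp)
        thus "N (\<lambda>t. (2 / \<eta>) * cut_dilate x m (a n) t) \<le> 1"
          unfolding N_cmult[OF inE] using \<eta> by simp
      qed
      moreover have "(\<lambda>t. (2 / \<eta>) * cut_dilate x m 0 t) \<in> borel_measurable halfline"
        by (intro L1_measurable in_L1 E_cmult cut_dilate_E[OF x m]) simp
      moreover have "AE t in halfline. (\<lambda>n. (2 / \<eta>) * cut_dilate x m (a n) t) \<longlonglongrightarrow> (2 / \<eta>) * cut_dilate x m 0 t"
      proof (rule AE_I2)
        fix t assume "t \<in> space halfline"
        hence t: "0 < t" by simp
        obtain k where k: "r / t < real k" using reals_Archimedean2 by blast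
        have "cut_dilate x m (a n) t = cut_dilate x m 0 t" if "k \<le> n" for n
        proof -
          have "r / t < real (Suc n)" using k that by simp
          hence "a n < t" using t by (simp add: a_def field_simps)
          thus ?thesis using t by (simp add: cut_dilate_def indicator_def)
        qed
        thus "(\<lambda>n. (2 / \<eta>) * cut_dilate x m (a n) t) \<longlonglongrightarrow> (2 / \<eta>) * cut_dilate x m 0 t"
          by (intro tendsto_eventually) (auto simp: eventually_sequentially)
      qed
      ultimately show ?thesis
        using Fatou[unfolded fatou_norm_def, rule_format, of "\<lambda>n t. (2 / \<eta>) * cut_dilate x m (a n) t" "\<lambda>t. (2 / \<eta>) * cut_dilate x m 0 t"]
        by blast
    qed
    moreover have "N (\<lambda>t. (2 / \<eta>) * cut_dilate x m 0 t) = (2 / \<eta>) * N (cut_dilate x m 0)"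
      using \<eta> by (subst N_cmult[OF cut_dilate_E[OF x m]]) auto
    moreover have "(2 / \<eta>) * \<eta> \<le> (2 / \<eta>) * N (cut_dilate x m 0)"
      by (rule mult_left_mono[OF \<eta>(2)]) (use \<eta>(1) in simp)
    moreover have "(2 / \<eta>) * \<eta> = 2" using \<eta>(1) by simp
    ultimately show False by linarith
  qed
  thus ?thesis using that by blast
qed

text \<open>
  The greedily selected scales \<open>T\<close> between \<open>\<sigma>\<close> and \<open>r\<close>, together with a witness \<open>v\<close> of the size of the dilates:
  any quasiconcave \<open>W\<close> that is large at the selected scales controls \<open>v\<close>, up to \<open>\<delta> X\<close>.
\<close>

definition scale_block :: "(real \<Rightarrow> real) \<Rightarrow> real \<Rightarrow> real \<Rightarrow> real \<Rightarrow> real \<Rightarrow> real \<Rightarrow> real set \<Rightarrow> bool"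
  where "scale_block x \<eta> \<delta> r M \<sigma> T \<longleftrightarrow> 1 < M \<and> 4 / \<delta> \<le> M \<and> 0 < \<sigma> \<and> \<sigma> \<le> r \<and> countable T \<and>
    (\<forall>b\<in>T. \<sigma> \<le> b \<and> M\<^sup>2 * b \<le> r \<and> \<delta> * kyfan x (M * b) \<le> kyfan x (b / M\<^sup>2)) \<and>
    (\<forall>b\<in>T. \<forall>b'\<in>T. b < b' \<longrightarrow> 8 * kyfan x (M * b) \<le> kyfan x (b' / M\<^sup>2)) \<and>
    (\<exists>v\<in>E. \<eta> / 2 < N v \<and> (\<forall>W. quasiconcave W \<longrightarrow> (\<forall>b\<in>T. kyfan x (b / M\<^sup>2) \<le> W (M * b)) \<longrightarrow>
       (\<forall>b\<ge>0. kyfan v b \<le> \<delta> * kyfan x b + (8 / \<delta>) * W b)))"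

text \<open>
  The factor \<open>M\<close> is chosen after \<open>r\<close>, so large that \<open>X(1/M^5) \<le> \<delta> X(r)\<close>; then the arguments between \<open>r\<close> and \<open>1\<close>
  need no selected scales. It is the fifth root of some \<open>m\<close> for which the dilate has norm at least
  \<open>\<eta>\<close>, matching the shift by \<open>M^5\<close> in \<open>greedy_scales\<close>. The Fatou property then determines the cut \<open>a\<close>, and
  \<open>\<sigma> = a/M\<^sup>2\<close> makes the estimate of \<open>greedy_scales\<close> available from \<open>a\<close> on.
\<close>

lemma scale_block_exists:
  assumes x: "x \<in> E" and \<eta>: "0 < \<eta>" and freq: "\<And>k. \<exists>m\<ge>k. \<eta> \<le> N (cut_dilate x m 0)"
    and pos: "\<And>t. 0 < t \<Longrightarrow> 0 < kyfan x t" and \<delta>: "0 < \<delta>" "\<delta> \<le> 1" and r: "0 < r" "r \<le> 1"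
  obtains M \<sigma> T where "k \<le> M" "scale_block x \<eta> \<delta> r M \<sigma> T"
proof -
  let ?X = "kyfan x"
  note L1 = in_L1[OF x]
  have "0 < \<delta> * ?X r" using pos[OF r(1)] \<delta> by simp
  then obtain \<tau> where \<tau>: "0 < \<tau>" "?X \<tau> < \<delta> * ?X r" using kyfan_small[OF L1] by blast
  define k0 where "k0 = max (max (\<bar>k\<bar> + 2) (4 / \<delta>)) (1 / \<tau>)"
  have k0: "2 \<le> k0" "k \<le> k0" "4 / \<delta> \<le> k0" "1 / \<tau> \<le> k0" unfolding k0_def by auto
  obtain m where m: "k0 ^ 5 \<le> m" "\<eta> \<le> N (cut_dilate x m 0)" using freq by blast
  define M where "M = root 5 m"
  have m0: "0 \<le> m" using m(1) k0(1) zero_le_power[of k0 5] by linarith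
  have Mm: "M ^ 5 = m" unfolding M_def using m0 by simp
  have M_ge: "k0 \<le> M"
  proof -
    have "root 5 (k0 ^ 5) \<le> root 5 m" using m(1) by simp
    thus ?thesis using k0(1) unfolding M_def by (simp add: real_root_power_cancel)
  qed
  hence M: "1 < M" using k0 by simp
  have m1: "1 \<le> m" using one_le_power[of M 5] M Mm by simp
  have Mm': "M \<le> m" using power_increasing[of 1 5 M] M Mm by simp
  obtain a where a: "0 < a" "a \<le> r" "\<eta> / 2 < N (cut_dilate x m a)"
    using Fatou_cut[OF x m1 \<eta> m(2) r(1)] by blast
  define \<sigma> where "\<sigma> = a / M\<^sup>2"
  have \<sigma>: "0 < \<sigma>" "M\<^sup>2 * \<sigma> = a" using a M by (auto simp: \<sigma>_def)
  have "\<sigma> \<le> a" using a M one_le_power[of M 2] by (simp add: \<sigma>_def divide_le_eq mult_le_cancel_left1)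
  hence \<sigma>r: "\<sigma> \<le> r" using a by simp
  obtain T where T: "countable T" "\<forall>b\<in>T. \<sigma> \<le> b \<and> M\<^sup>2 * b \<le> r \<and> \<delta> * ?X (M * b) \<le> ?X (b / M\<^sup>2)"
    "\<forall>b\<in>T. \<forall>b'\<in>T. b < b' \<longrightarrow> 8 * ?X (M * b) \<le> ?X (b' / M\<^sup>2)"
    "\<forall>W b. (\<forall>c\<in>T. ?X (c / M\<^sup>2) \<le> W (M * c)) \<longrightarrow> mono_on {0..} W \<longrightarrow> (\<forall>t. 0 \<le> W t) \<longrightarrow>
       M\<^sup>2 * \<sigma> \<le> b \<longrightarrow> b \<le> r \<longrightarrow> ?X (b / M ^ 5) \<le> \<delta> * ?X b + (8 / \<delta>) * W b"
    by (rule greedy_scales[OF L1 \<delta> M \<sigma>(1), where r=r]) (rule that; assumption)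
  let ?v = "cut_dilate x m a"
  have key: "kyfan ?v b \<le> \<delta> * ?X b + (8 / \<delta>) * W b"
    if W: "quasiconcave W" "\<And>c. c \<in> T \<Longrightarrow> ?X (c / M\<^sup>2) \<le> W (M * c)" and b: "0 \<le> b" for W b
  proof -
    let ?R = "\<lambda>t. \<delta> * ?X t + (8 / \<delta>) * W t"
    have R: "quasiconcave ?R" using \<delta> by (intro quasiconcave_combination quasiconcave_kyfan[OF L1] W) auto
    have W': "mono_on {0..} W" "\<And>t. 0 \<le> W t" using W(1) unfolding quasiconcave_def by auto
    have mid: "?X (t / m) \<le> ?R t" if "a \<le> t" "t \<le> 1" for t
    proof (cases "t \<le> r")
      case True
      thus ?thesis using T(4)[rule_format, of W t] W(2) W' \<sigma>(2) that Mm by simp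
    next
      case False
      have "t / m \<le> \<tau>"
      proof -
        have "1 / \<tau> \<le> m" using k0 M_ge Mm' by linarith
        hence "1 \<le> m * \<tau>" using \<tau> by (simp add: field_simps)
        hence "t \<le> \<tau> * m" using that by (simp add: mult.commute)
        thus ?thesis using m1 by (simp add: divide_le_eq)
      qed
      hence "?X (t / m) \<le> ?X \<tau>" by (rule kyfan_mono[OF L1])
      also have "\<dots> \<le> \<delta> * ?X r" using \<tau> by simp
      also have "\<dots> \<le> \<delta> * ?X t" using False \<delta> by (intro mult_left_mono kyfan_mono[OF L1]) auto
      also have "\<dots> \<le> ?R t" using W'(2)[of t] \<delta> by simp
      finally show ?thesis .
    qed
    have v_le: "kyfan ?v t \<le> ?X (t / m)" if "0 \<le> t" for t
      using m1 a that by (intro kyfan_cut_dilate_le[OF L1]) auto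
    consider "1 \<le> b" | "a \<le> b" "b \<le> 1" | "b < a" by linarith
    thus ?thesis
    proof cases
      case 1
      have "kyfan ?v b \<le> kyfan ?v 1" using m1 a b by (intro kyfan_cut_dilate_after_1[OF L1]) auto
      also have "\<dots> \<le> ?R 1" using v_le[of 1] mid[of 1] a r by linarith
      also have "\<dots> \<le> ?R b" using R 1 unfolding quasiconcave_def by (intro mono_onD[of "{0..}" ?R]) auto
      finally show ?thesis .
    next
      case 2
      thus ?thesis using v_le[OF b] mid[of b] by linarith
    next
      case 3
      have "kyfan ?v b \<le> ?X (a / m) / a * b" using m1 by (intro kyfan_cut_dilate_linear[OF L1 _ a(1) b]) simp
      also have "\<dots> = b / a * ?X (a / m)" by simp
      also have "\<dots> \<le> b / a * ?R a" using mid[of a] a r b by (intro mult_left_mono) auto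
      also have "\<dots> \<le> ?R b" using R 3 b a(1) unfolding quasiconcave_def by auto
      finally show ?thesis .
    qed
  qed
  have vE: "?v \<in> E" using a by (intro cut_dilate_E[OF x m1]) simp
  have "4 / \<delta> \<le> M" "k \<le> M" using k0 M_ge by auto
  moreover from this have "scale_block x \<eta> \<delta> r M \<sigma> T"
    unfolding scale_block_def using M \<sigma>(1) \<sigma>r T(1-3) vE a(3) key by blast
  ultimately show ?thesis using that by blast
qed

text \<open>
  Each block ends so close to 0 that \<open>X\<close> at its right end is negligible against \<open>X\<close> at the
  smallest relevant scale of the preceding block, and hence of all earlier ones.
\<close>

lemma scale_block_sequence:
  assumes x: "x \<in> E" and \<eta>: "0 < \<eta>" and freq: "\<And>k. \<exists>m\<ge>k. \<eta> \<le> N (cut_dilate x m 0)"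
    and pos: "\<And>t. 0 < t \<Longrightarrow> 0 < kyfan x t" and \<delta>: "0 < \<delta>" "\<delta> \<le> 1"
  obtains r M \<sigma> :: "nat \<Rightarrow> real" and T :: "nat \<Rightarrow> real set"
  where "\<forall>k. real k \<le> M k" "\<forall>k. scale_block x \<eta> \<delta> (r k) (M k) (\<sigma> k) (T k)"
    "\<forall>k. 8 * kyfan x (r (Suc k)) \<le> kyfan x (\<sigma> k / (M k)\<^sup>2)" "\<forall>k. r (Suc k) \<le> \<sigma> k"
proof -
  note L1 = in_L1[OF x]
  define P where "P k s \<longleftrightarrow> (case s of (r, M, \<sigma>, T) \<Rightarrow> real k \<le> M \<and> 0 < r \<and> r \<le> 1 \<and> scale_block x \<eta> \<delta> r M \<sigma> T)" for k s
  define Q where "Q k s s' \<longleftrightarrow> (case s of (r, M, \<sigma>, T) \<Rightarrow> 8 * kyfan x (fst s') \<le> kyfan x (\<sigma> / M\<^sup>2) \<and> fst s' \<le> \<sigma>)"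
    for k :: nat and s s' :: "real \<times> real \<times> real \<times> real set"
  have ex: "\<exists>M \<sigma> T. P k (r, M, \<sigma>, T)" if "0 < r" "r \<le> 1" for k r
    using scale_block_exists[OF x \<eta> freq pos \<delta> that, of "real k"] that unfolding P_def by (metis (mono_tags, lifting) case_prod_conv)
  have "\<exists>f. \<forall>k. P k (f k) \<and> Q k (f k) (f (Suc k))"
  proof (rule dependent_nat_choice)
    show "\<exists>s. P 0 s" using ex[of 1 0] by auto
    fix s k assume "P k s"
    then obtain r M \<sigma> T where s: "s = (r, M, \<sigma>, T)" and b: "scale_block x \<eta> \<delta> r M \<sigma> T" "r \<le> 1"
      unfolding P_def by (cases s) auto
    have \<sigma>: "0 < \<sigma>" "1 < M" "\<sigma> \<le> r" using b unfolding scale_block_def by auto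
    hence "0 < kyfan x (\<sigma> / M\<^sup>2)" by (intro pos) simp
    then obtain t where t: "0 < t" "kyfan x t < kyfan x (\<sigma> / M\<^sup>2) / 8" using kyfan_small[OF L1, of "kyfan x (\<sigma> / M\<^sup>2) / 8"] by auto
    define r' where "r' = min t \<sigma>"
    have r': "0 < r'" "r' \<le> 1" "r' \<le> \<sigma>" "r' \<le> t" using t \<sigma> b(2) unfolding r'_def by auto
    have "kyfan x r' \<le> kyfan x t" by (rule kyfan_mono[OF L1 r'(4)])
    hence "8 * kyfan x r' \<le> kyfan x (\<sigma> / M\<^sup>2)" using t(2) by linarith
    moreover obtain M' \<sigma>' T' where "P (Suc k) (r', M', \<sigma>', T')" using ex[OF r'(1,2)] by blast
    ultimately show "\<exists>s'. P (Suc k) s' \<and> Q k s s'"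
      using r'(3) unfolding Q_def s by (intro exI[of _ "(r', M', \<sigma>', T')"]) simp
  qed
  then obtain f where f: "\<And>k. P k (f k)" "\<And>k. Q k (f k) (f (Suc k))" by blast
  show ?thesis
  proof (rule that[of "\<lambda>k. fst (snd (f k))" "\<lambda>k. fst (f k)" "\<lambda>k. fst (snd (snd (f k)))" "\<lambda>k. snd (snd (snd (f k)))"]; rule allI)
    fix k
    show "real k \<le> fst (snd (f k))" "scale_block x \<eta> \<delta> (fst (f k)) (fst (snd (f k))) (fst (snd (snd (f k)))) (snd (snd (snd (f k))))"
      using f(1)[of k] unfolding P_def by (auto split: prod.splits)
    show "8 * kyfan x (fst (f (Suc k))) \<le> kyfan x (fst (snd (snd (f k))) / (fst (snd (f k)))\<^sup>2)"
      "fst (f (Suc k)) \<le> fst (snd (snd (f k)))"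
      using f(2)[of k] unfolding Q_def by (auto split: prod.splits)
  qed
qed

text \<open>
  For a selected \<open>b\<close> the interval of averaging is \<open>(c,b)\<close>, where \<open>c\<close> is the point given by \<open>cut_point\<close> for \<open>s = b/M\<^sup>2\<close>. The
  separation by the factor 8, within blocks and between them, is exactly what places \<open>M b'\<close>, for every
  smaller selected \<open>b'\<close>, to the left of \<open>c\<close>. So the intervals are disjoint and \<open>[b', M b']\<close> meets none of
  their interiors.
\<close>

lemma averaging_on_blocks:
  fixes r M \<sigma> :: "nat \<Rightarrow> real" and T :: "nat \<Rightarrow> real set"
  assumes x: "x \<in> E" and pos: "\<And>t. 0 < t \<Longrightarrow> 0 < kyfan x t" and \<delta>: "0 < \<delta>" "\<delta> \<le> 1"
    and block: "\<And>k. scale_block x \<eta> \<delta> (r k) (M k) (\<sigma> k) (T k)"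
    and sep: "\<And>k. 8 * kyfan x (r (Suc k)) \<le> kyfan x (\<sigma> k / (M k)\<^sup>2)" "\<And>k. r (Suc k) \<le> \<sigma> k"
  obtains y where "y \<in> E" "nonneg_fun y" "\<forall>t\<ge>0. kyfan y t \<le> kyfan x t"
    "\<forall>k. \<forall>b\<in>T k. \<forall>t\<in>{b..M k * b}. kyfan y t = kyfan x t"
    "\<forall>k. \<forall>b\<in>T k. \<forall>t\<in>{b / (M k)\<^sup>2..b / M k}. kyfan x (b / (M k)\<^sup>2) / 2 \<le> kyfan x t - kyfan y t"
proof -
  let ?X = "kyfan x"
  note L1 = in_L1[OF x]
  have M: "1 < M k" and M\<delta>: "4 / \<delta> \<le> M k" and \<sigma>: "0 < \<sigma> k" "\<sigma> k \<le> r k" and cT: "countable (T k)" for k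
    using block[of k] unfolding scale_block_def by auto
  have Tb: "\<sigma> k \<le> b" "(M k)\<^sup>2 * b \<le> r k" "\<delta> * ?X (M k * b) \<le> ?X (b / (M k)\<^sup>2)" if "b \<in> T k" for k b
    using block[of k] that unfolding scale_block_def by auto
  have Tsep: "8 * ?X (M k * b) \<le> ?X (b' / (M k)\<^sup>2)" if "b \<in> T k" "b' \<in> T k" "b < b'" for k b b'
    using block[of k] that unfolding scale_block_def by auto
  have b_pos: "0 < b" if "b \<in> T k" for k b using Tb(1)[OF that] \<sigma>(1)[of k] by simp
  have r_dec: "r l \<le> r (Suc k)" if "k < l" for k l
  proof -
    have "decseq r" by (rule decseq_SucI) (use sep(2) \<sigma>(2) order_trans in blast)
    thus ?thesis by (rule decseqD) (use that in simp)
  qed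
  have s_pos: "0 < b / (M k)\<^sup>2" if "b \<in> T k" for k b using b_pos[OF that] M[of k] by simp
  have "\<exists>c. 0 \<le> c \<and> c \<le> s \<and> ?X c \<le> ?X s / 4 \<and> (\<forall>c'. 0 \<le> c' \<longrightarrow> 8 * ?X c' \<le> ?X s \<longrightarrow> c' \<le> c)" if s: "0 < s" for s
    using cut_point[OF L1 s pos[OF s]] by blast
  then obtain cp where cp: "\<And>s. 0 < s \<Longrightarrow> 0 \<le> cp s" "\<And>s. 0 < s \<Longrightarrow> cp s \<le> s" "\<And>s. 0 < s \<Longrightarrow> ?X (cp s) \<le> ?X s / 4"
    "\<And>s c'. 0 < s \<Longrightarrow> 0 \<le> c' \<Longrightarrow> 8 * ?X c' \<le> ?X s \<Longrightarrow> c' \<le> cp s"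
    by metis
  define G where "G = (\<Union>k. (\<lambda>b. (cp (b / (M k)\<^sup>2), b)) ` T k)"
  have s_less: "b / (M k)\<^sup>2 < b" if "b \<in> T k" for k b
    using b_pos[OF that] M[of k] one_less_power[of "M k" 2] by (simp add: divide_less_eq)
  have Mb: "b \<le> M k * b" if "b \<in> T k" for k b
    using b_pos[OF that] M[of k] by (simp add: mult_le_cancel_right1)
  have MbR: "M k * b \<le> r k" if "b \<in> T k" for k b
  proof -
    have "M k * b \<le> M k * (M k * b)" using M[of k] by (intro mult_left_mono Mb[OF that]) simp
    thus ?thesis using Tb(2)[OF that] by (simp add: power2_eq_square)
  qed
  have order: "M k * b \<le> cp (b' / (M l)\<^sup>2)" if b: "b \<in> T k" and b': "b' \<in> T l" and le: "b \<le> b'" and ne: "(k, b) \<noteq> (l, b')" for k l b b'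
  proof (rule cp(4)[OF s_pos[OF b']])
    show "0 \<le> M k * b" using b_pos[OF b] M[of k] by simp
    consider "k = l" | "k < l" | "l < k" by linarith
    thus "8 * ?X (M k * b) \<le> ?X (b' / (M l)\<^sup>2)"
    proof cases
      case 1
      thus ?thesis using Tsep[of b k b'] b b' le ne by auto
    next
      case 2
      have "b' \<le> M l * b'" by (rule Mb[OF b'])
      also have "\<dots> < (M l)\<^sup>2 * b'" using M[of l] b_pos[OF b'] by (simp add: power2_eq_square)
      also have "\<dots> \<le> r l" by (rule Tb(2)[OF b'])
      also have "\<dots> \<le> \<sigma> k" using r_dec[OF 2] sep(2)[of k] by linarith
      also have "\<dots> \<le> b" by (rule Tb(1)[OF b])
      finally show ?thesis using le by simp
    next
      case 3
      have "?X (M k * b) \<le> ?X (r (Suc l))" using MbR[OF b] r_dec[OF 3] by (intro kyfan_mono[OF L1]) linarith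
      moreover have "?X (\<sigma> l / (M l)\<^sup>2) \<le> ?X (b' / (M l)\<^sup>2)"
        using Tb(1)[OF b'] by (intro kyfan_mono[OF L1] divide_right_mono) auto
      ultimately show ?thesis using sep(1)[of l] by linarith
    qed
  qed
  have GE: "\<exists>k. b \<in> T k \<and> c = cp (b / (M k)\<^sup>2)" if "(c, b) \<in> G" for c b
    using that unfolding G_def by auto
  have interval: "0 \<le> c \<and> c < b" if g: "(c, b) \<in> G" for c b
  proof -
    obtain k where k: "b \<in> T k" "c = cp (b / (M k)\<^sup>2)" using GE[OF g] by blast
    thus ?thesis using cp(1,2)[OF s_pos[OF k(1)]] s_less[OF k(1)] by auto
  qed
  have disjoint: "b \<le> c' \<or> b' \<le> c" if g: "(c, b) \<in> G" "(c', b') \<in> G" "(c, b) \<noteq> (c', b')" for c b c' b'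
  proof -
    obtain k where k: "b \<in> T k" "c = cp (b / (M k)\<^sup>2)" using GE[OF g(1)] by blast
    obtain l where l: "b' \<in> T l" "c' = cp (b' / (M l)\<^sup>2)" using GE[OF g(2)] by blast
    have ne: "(k, b) \<noteq> (l, b')" using g(3) k(2) l(2) by auto
    show ?thesis
    proof (cases "b \<le> b'")
      case True
      thus ?thesis using order[OF k(1) l(1) True ne] Mb[OF k(1)] l(2) by linarith
    next
      case False
      hence "M l * b' \<le> c" using order[OF l(1) k(1)] ne k(2) by auto
      thus ?thesis using Mb[OF l(1)] by linarith
    qed
  qed
  have "countable G" unfolding G_def using cT by auto
  note cG = this
  obtain y where y0: "y \<in> L1" "nonneg_fun y" "\<forall>t\<ge>0. kyfan y t \<le> ?X t"
    "\<forall>t>0. (\<forall>(c, b)\<in>G. \<not> (c < t \<and> t < b)) \<longrightarrow> kyfan y t = ?X t"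
    "\<forall>(c, b)\<in>G. \<forall>t\<ge>0. kyfan y t \<le> ?X c + t * (?X b / b)"
    by (rule averaging_on_intervals[OF L1 cG])
      ((rule interval; assumption) | (rule disjoint; assumption) | (rule that; assumption))+
  have y: "y \<in> L1" "nonneg_fun y" "\<And>t. 0 \<le> t \<Longrightarrow> kyfan y t \<le> ?X t"
    "\<And>t. 0 < t \<Longrightarrow> (\<And>c b. (c, b) \<in> G \<Longrightarrow> \<not> (c < t \<and> t < b)) \<Longrightarrow> kyfan y t = ?X t"
    "\<And>c b t. (c, b) \<in> G \<Longrightarrow> 0 \<le> t \<Longrightarrow> kyfan y t \<le> ?X c + t * (?X b / b)"
    using y0 by blast+
  show ?thesis
  proof (rule that)
    show "y \<in> E" by (rule kyfan_ideal(1)[OF x y(1,3)])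
    show "nonneg_fun y" by (rule y(2))
    show "\<forall>t\<ge>0. kyfan y t \<le> ?X t" by (rule y0(3))
    have "kyfan y t = ?X t" if b: "b \<in> T k" and t: "b \<le> t" "t \<le> M k * b" for k b t
    proof (rule y(4))
      show "0 < t" using b_pos[OF b] t by simp
      fix c' b' assume "(c', b') \<in> G"
      then obtain l where l: "b' \<in> T l" "c' = cp (b' / (M l)\<^sup>2)" using GE by blast
      show "\<not> (c' < t \<and> t < b')"
      proof (cases "b' \<le> b")
        case True thus ?thesis using t by auto
      next
        case False
        hence "M k * b \<le> c'" unfolding l(2) by (intro order[OF b l(1)]) auto
        thus ?thesis using t by auto
      qed
    qed
    thus "\<forall>k. \<forall>b\<in>T k. \<forall>t\<in>{b..M k * b}. kyfan y t = ?X t" by auto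
    have "?X (b / (M k)\<^sup>2) / 2 \<le> ?X t - kyfan y t" if b: "b \<in> T k" and t: "b / (M k)\<^sup>2 \<le> t" "t \<le> b / M k" for k b t
    proof -
      let ?s = "b / (M k)\<^sup>2"
      have t0: "0 \<le> t" using t(1) s_pos[OF b] by simp
      have "(cp ?s, b) \<in> G" using b unfolding G_def by auto
      hence "kyfan y t \<le> ?X (cp ?s) + t * (?X b / b)" using t0 by (rule y(5))
      also have "?X (cp ?s) \<le> ?X ?s / 4" by (rule cp(3)[OF s_pos[OF b]])
      also have "t * (?X b / b) \<le> ?X ?s / 4"
      proof -
        have "t * (?X b / b) \<le> b / M k * (?X b / b)" using t(2) b_pos[OF b] by (intro mult_right_mono) auto
        also have "\<dots> = ?X b / M k" using b_pos[OF b] by simp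
        also have "\<dots> \<le> ?X (M k * b) / M k" using M[of k] Mb[OF b] by (intro divide_right_mono kyfan_mono[OF L1]) auto
        also have "\<dots> \<le> (?X ?s / \<delta>) / M k"
          using Tb(3)[OF b] \<delta> M[of k] by (intro divide_right_mono) (auto simp: pos_le_divide_eq mult.commute)
        also have "\<dots> = ?X ?s / (\<delta> * M k)" by simp
        also have "\<dots> \<le> ?X ?s / 4"
        proof (rule divide_left_mono)
          show "4 \<le> \<delta> * M k" using M\<delta>[of k] \<delta> by (simp add: field_simps)
          thus "0 < \<delta> * M k * 4" by simp
        qed simp
        finally show ?thesis .
      qed
      finally have "kyfan y t \<le> ?X ?s / 2" by simp
      moreover have "?X ?s \<le> ?X t" by (rule kyfan_mono[OF L1 t(1)])
      ultimately show ?thesis by simp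
    qed
    thus "\<forall>k. \<forall>b\<in>T k. \<forall>t\<in>{b / (M k)\<^sup>2..b / M k}. ?X (b / (M k)\<^sup>2) / 2 \<le> ?X t - kyfan y t" by auto
  qed
qed

text \<open>
  The order of choices: \<open>\<delta>\<close> from \<open>\<eta>\<close> and the norm of \<open>x\<close>, then the blocks and \<open>y\<close>, then \<open>w\<close>, \<open>P\<close>, \<open>Q\<close>, \<open>K\<close> from \<open>y\<close>, then
  \<open>n\<close> from \<open>K\<close> and \<open>Q\<close>, and finally the block \<open>k\<close> with \<open>M k \<ge> (K + 1)^n\<close>. Each of the three contributions
  \<open>\<delta> x\<close>, \<open>w\<close> and \<open>Q\<close> to the witness \<open>v\<close> of that block then has norm at most \<open>\<eta>/8\<close>, but \<open>v\<close> has norm above \<open>\<eta>/2\<close>.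
\<close>

theorem norm_cut_dilate_small:
  assumes x: "x \<in> E"
    and hyp: "\<And>f y. positive_symmetric_functional E f \<Longrightarrow> y \<in> E \<Longrightarrow> nonneg_fun y \<Longrightarrow> y \<prec>\<prec> x \<Longrightarrow> f y \<le> f x"
    and \<eta>: "0 < \<eta>"
  shows "\<exists>k. \<forall>m\<ge>k. N (cut_dilate x m 0) < \<eta>"
proof (rule ccontr)
  assume "\<not> ?thesis"
  hence freq: "\<exists>m\<ge>k. \<eta> \<le> N (cut_dilate x m 0)" for k by (auto simp: not_less)
  let ?X = "kyfan x"
  note L1 = in_L1[OF x]
  \<comment> \<open>By concavity \<open>X\<close> cannot vanish anywhere without vanishing identically.\<close>
  have pos: "0 < ?X t" if t: "0 < t" for t
  proof (rule ccontr)
    assume "\<not> 0 < ?X t"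
    hence Xt: "?X t = 0" using kyfan_nonneg[of x t] by linarith
    have X0: "?X s \<le> 0" for s
    proof (cases "s \<le> t")
      case True thus ?thesis using kyfan_mono[OF L1 True] Xt by simp
    next
      case False
      hence "?X ((s / t) * t) \<le> (s / t) * ?X t" using t by (intro kyfan_dilate_le[OF L1]) simp
      thus ?thesis using Xt t by simp
    qed
    obtain m where m: "1 \<le> m" "\<eta> \<le> N (cut_dilate x m 0)" using freq by blast
    have "N (cut_dilate x m 0) \<le> N (\<lambda>t. 0)"
    proof (rule kyfan_ideal(2)[OF E_zero])
      show "cut_dilate x m 0 \<in> L1" using m by (intro in_L1 cut_dilate_E[OF x]) auto
      fix s :: real assume s: "0 \<le> s"
      have "kyfan (cut_dilate x m 0) s \<le> ?X (s / m)" using m s by (intro kyfan_cut_dilate_le[OF L1]) auto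
      also have "\<dots> \<le> 0" by (rule X0)
      finally show "kyfan (cut_dilate x m 0) s \<le> kyfan (\<lambda>t. 0) s" using kyfan_nonneg[of "\<lambda>t. 0" s] by linarith
    qed
    thus False using N_zero m(2) \<eta> by simp
  qed
  define \<delta> where "\<delta> = min 1 (\<eta> / (8 * (N x + 1)))"
  have Nx: "0 \<le> N x" by (rule N_nonneg[OF x])
  have \<delta>: "0 < \<delta>" "\<delta> \<le> 1" "\<delta> * N x \<le> \<eta> / 8"
  proof -
    show "0 < \<delta>" "\<delta> \<le> 1" using \<eta> Nx unfolding \<delta>_def by auto
    have "\<delta> * N x \<le> \<eta> / (8 * (N x + 1)) * (N x + 1)"
      using Nx \<eta> by (intro mult_mono) (auto simp: \<delta>_def)
    also have "\<dots> = \<eta> / 8" using Nx by (simp add: nonzero_divide_eq_eq)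
    finally show "\<delta> * N x \<le> \<eta> / 8" .
  qed
  obtain r M \<sigma> T where bl0: "\<forall>k. real k \<le> M k" "\<forall>k. scale_block x \<eta> \<delta> (r k) (M k) (\<sigma> k) (T k)"
    "\<forall>k. 8 * ?X (r (Suc k)) \<le> ?X (\<sigma> k / (M k)\<^sup>2)" "\<forall>k. r (Suc k) \<le> \<sigma> k"
    by (rule scale_block_sequence[OF x \<eta> freq pos \<delta>(1,2)]) (assumption | rule that)+
  note bl = bl0[rule_format]
  obtain y where y0: "y \<in> E" "nonneg_fun y" "\<forall>t\<ge>0. kyfan y t \<le> ?X t"
    "\<forall>k. \<forall>b\<in>T k. \<forall>t\<in>{b..M k * b}. kyfan y t = ?X t"
    "\<forall>k. \<forall>b\<in>T k. \<forall>t\<in>{b / (M k)\<^sup>2..b / M k}. ?X (b / (M k)\<^sup>2) / 2 \<le> ?X t - kyfan y t"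
    by (rule averaging_on_blocks[where r=r and M=M and \<sigma>=\<sigma> and T=T and \<eta>=\<eta>, OF x pos \<delta>(1,2) bl(2-4)]) (assumption | rule that)+
  have y: "y \<in> E" "nonneg_fun y" "\<And>t. 0 \<le> t \<Longrightarrow> kyfan y t \<le> ?X t"
    "\<And>k b t. b \<in> T k \<Longrightarrow> b \<le> t \<Longrightarrow> t \<le> M k * b \<Longrightarrow> kyfan y t = ?X t"
    "\<And>k b t. b \<in> T k \<Longrightarrow> b / (M k)\<^sup>2 \<le> t \<Longrightarrow> t \<le> b / M k \<Longrightarrow> ?X (b / (M k)\<^sup>2) / 2 \<le> ?X t - kyfan y t"
    using y0 by simp_all
  have "y \<prec>\<prec> x" using y(3) submajorized_iff_kyfan[OF L1 in_L1[OF y(1)]] by simp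
  hence f_le: "f y \<le> f x" if "positive_symmetric_functional E f" for f using hyp[OF that y(1,2)] by simp
  have "0 < \<delta> * \<eta> / 512" using \<delta>(1) \<eta> by simp
  then obtain w P Q F K where w: "w \<in> E" "P \<in> E" "Q \<in> E" "N w < \<delta> * \<eta> / 512" "balanced_by F K P Q"
    "AE t in halfline. y t \<le> x t + w t + P t - Q t"
    by (rule approximate_domination[OF x y(1), rotated]) ((rule f_le; assumption) | (rule that; assumption))+
  have K: "1 \<le> K" using w(5) unfolding balanced_by_def by simp
  have NQ: "0 \<le> N Q" by (rule N_nonneg[OF w(3)])
  obtain n :: nat where n': "max (8 * (K + 1) / \<delta>) (512 * K * (K + 1) * N Q / (\<delta> * \<eta>)) < real n"
    using reals_Archimedean2 by blast
  have n: "8 * (K + 1) / \<delta> \<le> real n" "512 * K * (K + 1) * N Q / (\<delta> * \<eta>) \<le> real n" using n' by auto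
  have "K + 1 \<le> 8 * (K + 1) / \<delta>" using K \<delta> by (simp add: pos_le_divide_eq) (smt (verit) mult_left_le mult.commute)
  hence nK: "K + 1 \<le> real n" using n(1) by linarith
  hence n0: "0 < n" using K by auto
  \<comment> \<open>A block fine enough for all \<open>n\<close> scales to fit between \<open>b\<close> and \<open>M b\<close>.\<close>
  obtain k :: nat where "(K + 1) ^ n < real k" using reals_Archimedean2 by blast
  hence Mk: "(K + 1) ^ n \<le> M k" using bl(1)[of k] by linarith
  define W where "W t = 8 * kyfan w t + 8 * K * (K + 1) / real n * kyfan Q t" for t
  have "quasiconcave W"
    unfolding W_def using K by (intro quasiconcave_combination quasiconcave_kyfan in_L1 w) auto
  moreover have "\<forall>b\<in>T k. ?X (b / (M k)\<^sup>2) \<le> W (M k * b)"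
  proof
    fix b assume b: "b \<in> T k"
    have good: "\<delta> * ?X (M k * b) \<le> ?X (b / (M k)\<^sup>2)" and b0: "0 < b"
      using bl(2)[of k] b unfolding scale_block_def by auto
    show "?X (b / (M k)\<^sup>2) \<le> W (M k * b)"
      unfolding W_def
      by (rule domination_at_scale[OF L1 in_L1[OF y(1)] in_L1[OF w(1)] in_L1[OF w(2)] in_L1[OF w(3)] y(2) w(5,6) y(3) n0 nK n(1) \<delta>(1) Mk b0 good y(4,5)[OF b]])
  qed
  ultimately obtain v where v: "v \<in> E" "\<eta> / 2 < N v" "\<And>b. 0 \<le> b \<Longrightarrow> kyfan v b \<le> \<delta> * ?X b + (8 / \<delta>) * W b"
    using bl(2)[of k] unfolding scale_block_def by blast
  define \<alpha> where "\<alpha> = 64 / \<delta>"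
  define \<beta> where "\<beta> = 64 * K * (K + 1) / (\<delta> * real n)"
  have \<alpha>\<beta>: "0 \<le> \<alpha>" "0 \<le> \<beta>" using \<delta> K unfolding \<alpha>_def \<beta>_def by auto
  obtain h where h: "h \<in> E" "\<And>t. kyfan (\<lambda>t. \<alpha> * w t) t + kyfan (\<lambda>t. \<beta> * Q t) t \<le> kyfan h t"
    "N h \<le> N (\<lambda>t. \<alpha> * w t) + N (\<lambda>t. \<beta> * Q t)"
    using kyfan_sum_dominator[OF E_cmult[OF w(1)] E_cmult[OF w(3)]] by blast
  obtain g where g: "g \<in> E" "\<And>t. kyfan (\<lambda>t. \<delta> * x t) t + kyfan h t \<le> kyfan g t" "N g \<le> N (\<lambda>t. \<delta> * x t) + N h"
    using kyfan_sum_dominator[OF E_cmult[OF x] h(1)] by blast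
  have "N v \<le> N g"
  proof (rule kyfan_ideal(2)[OF g(1) in_L1[OF v(1)]])
    fix t :: real assume t: "0 \<le> t"
    have "kyfan v t \<le> \<delta> * ?X t + (8 / \<delta>) * W t" by (rule v(3)[OF t])
    also have "\<dots> = \<delta> * ?X t + (\<alpha> * kyfan w t + \<beta> * kyfan Q t)"
      using \<delta> n0 by (simp add: W_def \<alpha>_def \<beta>_def field_simps)
    also have "\<dots> = kyfan (\<lambda>t. \<delta> * x t) t + (kyfan (\<lambda>t. \<alpha> * w t) t + kyfan (\<lambda>t. \<beta> * Q t) t)"
      using \<delta> \<alpha>\<beta> by (simp add: kyfan_cmult in_L1 x w)
    also have "\<dots> \<le> kyfan g t" using h(2)[of t] g(2)[of t] by linarith
    finally show "kyfan v t \<le> kyfan g t" .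
  qed
  also have "\<dots> \<le> \<delta> * N x + (\<alpha> * N w + \<beta> * N Q)"
    using g(3) h(3) \<delta> \<alpha>\<beta> by (simp add: N_cmult x w)
  also have "\<alpha> * N w \<le> \<eta> / 8"
  proof -
    have "\<alpha> * N w \<le> \<alpha> * (\<delta> * \<eta> / 512)" using w(4) \<alpha>\<beta> by (intro mult_left_mono) auto
    thus ?thesis using \<delta> by (simp add: \<alpha>_def)
  qed
  also have "\<beta> * N Q \<le> \<eta> / 8"
  proof -
    have "512 * K * (K + 1) * N Q \<le> real n * (\<delta> * \<eta>)"
      using n(2) \<delta> \<eta> by (simp add: pos_divide_le_eq)
    hence "64 * K * (K + 1) * N Q \<le> \<eta> / 8 * (\<delta> * real n)" by (simp add: algebra_simps)
    thus ?thesis using \<delta> n0 unfolding \<beta>_def by (simp add: pos_divide_le_eq)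
  qed
  finally show False using v(2) \<delta>(3) \<eta> by linarith
qed

end

theorem theorem48:
  fixes E :: "(real \<Rightarrow> real) set" and N :: "(real \<Rightarrow> real) \<Rightarrow> real" and x :: "real \<Rightarrow> real"
  assumes "fully_symmetric_banach_space E N"
    and "fatou_norm E N"
    and "E \<subseteq> L1"
    and "x \<in> E"
    and "\<And>\<phi> y. positive_symmetric_functional E \<phi> \<Longrightarrow> y \<in> E \<Longrightarrow> nonneg_fun y \<Longrightarrow> y \<prec>\<prec> x
          \<Longrightarrow> \<phi> y \<le> \<phi> x"
  shows "((\<lambda>m::real. (1 / m) * N (\<lambda>t. dilation m (rearr x) t * indicator {0<..<1} t))
           \<longlongrightarrow> 0) at_top"
proof -
  interpret Fatou_symmetric_L1_space E N
    by unfold_locales (fact assms)+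
  have eq: "(1 / m) * N (\<lambda>t. dilation m (rearr x) t * indicator {0<..<1} t) = N (cut_dilate x m 0)"
    if m: "1 \<le> m" for m
  proof -
    have "(\<lambda>t. dilation m (rearr x) t * indicator {0<..<1} t) = (\<lambda>t. m * cut_dilate x m 0 t)"
      using m by (auto simp: dilation_def cut_dilate_def)
    thus ?thesis using m by (simp add: N_cmult[OF cut_dilate_E[OF assms(4) m]])
  qed
  show ?thesis
  proof (rule tendstoI)
    fix \<eta> :: real assume "0 < \<eta>"
    then obtain k where k: "\<And>m. k \<le> m \<Longrightarrow> N (cut_dilate x m 0) < \<eta>"
      using norm_cut_dilate_small[OF assms(4,5)] by blast
    show "\<forall>\<^sub>F m in at_top. dist ((1 / m) * N (\<lambda>t. dilation m (rearr x) t * indicator {0<..<1} t)) 0 < \<eta>"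
      using eventually_ge_at_top[of "max 1 k"]
    proof eventually_elim
      fix m :: real assume "max 1 k \<le> m"
      hence m: "1 \<le> m" "k \<le> m" by auto
      show "dist ((1 / m) * N (\<lambda>t. dilation m (rearr x) t * indicator {0<..<1} t)) 0 < \<eta>"
        unfolding eq[OF m(1)] using k[OF m(2)] N_nonneg[OF cut_dilate_E[OF assms(4) m(1)]] by simp
    qed
  qed
qed

end
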